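(* Assume the basic hypotheses, the convexity hypothesis, and either the measure–modulus hypothesis or the compact-range hypothesis (all stated in the context). Then, for all $s\in[0,T)$ and $\varphi\in L^2$, the set of trajectories $S_{[s,T]}(\varphi)$ is compact in $C([s,T];L^2)$.
   Context: Setup. $T>0$; $(\Omega,d_\Omega,\mu)$ is a metric measure space; $L^2:=L^2(\mu,\Omega;\mathbb{R}^n)$; $U$ is a set-valued map on $[0,T]$ with values in $\mathbb{R}^m$; $f:[0,T]\times\mathbb{R}^n\times\mathbb{R}^m\times\Omega\to\mathbb{R}^n$; $g:\mathbb{R}^n\times\Omega\to\mathbb{R}$. Basic hypotheses. (i) $(\Omega,d_\Omega)$ is compact and $\mu$ is a finite Radon measure. (ii) $U$ is upper semicontinuous with nonempty compact values contained in a fixed compact set $\mathbf{U}\subset\mathbb{R}^m$ (upper semicontinuous: $\{t: U(t)\cap C\ne\emptyset\}$ is closed for every closed $C$). (iii) $f$ is measurable in $t$ and continuous in the other variables, and there are constants $c,k>0$ with $|f(t,x,u,\omega)|\le c(1+|x|)$ and $|f(t,x,u,\omega)-f(t,x',u,\omega)|\le k|x-x'|$ for all $x,x'\in\mathbb{R}^n$, $u\in\mathbb{R}^m$, $\omega\in\Omega$, a.e. $t\in(0,T)$. (iv) $g$ is $\mathcal{L}\otimes\mu$-measurable ($\mathcal{L}$ Lebesgue measure), $g(\cdot,\omega)$ is lower semicontinuous for every $\omega$, and $g(x,\omega)\ge a(\omega)-b|x|^2$ for all $(x,\omega)$, for some $a\in L^1(\mu,\Omega)$ and $b\ge0$. Set-valued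 dynamics and trajectories. $F(t,\varphi)=\{f(t,\varphi(\cdot),u,\cdot):u\in U(t)\}\subset L^2$ for $(t,\varphi)\in[0,T]\times L^2$. $S_{[s,T]}(\varphi)$ is the set of all (absolutely continuous, $W^{1,1}([s,T];L^2)$) functions $x\in C([s,T];L^2)$ with $x(s,\cdot)=\varphi(\cdot)$ and $\dot x(t,\cdot)\in F(t,x(t,\cdot))$ for a.e. $t\in[s,T]$. $C([s,T];L^2)$ carries the supremum norm. Additional hypotheses. Measure–modulus hypothesis: for every $r>0$, $\inf\{\mu(\mathcal{B}_r(\omega)):\omega\in\Omega\}>0$ ($\mathcal{B}_r(\omega)$ the open ball), and there is a modulus of continuity $\theta_f$ (nondecreasing, $\theta_f(r)\to0$ as $r\to0^+$) with $\int_0^T\sup_{u\in U(t),\,x,y\in\mathbb{R}^n}|f(t,x,u,\omega_1)-f(t,y,u,\omega_2)|\,dt\le\theta_f(d_\Omega(\omega_1,\omega_2))$ for all $\omega_1,\omega_2\in\Omega$. Compact-range hypothesis: there is a compact set $K\subset L^2$ with $F(t,\varphi)\subset K$ for every $(t,\varphi)\in[0,T]\times L^2$. Convexity hypothesis: $F(t,\varphi)$ is convex for every $(t,\varphi)\in[0,T]\times L^2$. *)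

theory Defs
  imports "HOL-Analysis.Analysis"
begin

section \<open>The space of square-integrable maps modulo almost-everywhere equality\<close>

text \<open>
  An element of \<open>L\<^sup>2\<close> is a class of measurable functions modulo almost-everywhere equality.
  Since the space depends on a measure it is a carrier set, not a type; it is made a metric space
  via the library's \<^typ>\<open>'a metric\<close>.  Linear operations are performed on representatives.
\<close>

definition ae_class :: "'w measure \<Rightarrow> ('w \<Rightarrow> 'b::euclidean_space) \<Rightarrow> ('w \<Rightarrow> 'b) set" where
  "ae_class M h = {h' \<in> borel_measurable M. AE w in M. h' w = h w}"

definition rep :: "('w \<Rightarrow> 'b) set \<Rightarrow> 'w \<Rightarrow> 'b" where
  "rep A = (SOME h. h \<in> A)"

definition L2 :: "'w measure \<Rightarrow> ('w \<Rightarrow> 'b::euclidean_space) set set" where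
  "L2 M = ae_class M ` {h \<in> borel_measurable M. integrable M (\<lambda>w. (norm (h w))\<^sup>2)}"

definition l2norm :: "'w measure \<Rightarrow> ('w \<Rightarrow> 'b::euclidean_space) \<Rightarrow> real" where
  "l2norm M h = sqrt (LINT w|M. (norm (h w))\<^sup>2)"

definition L2_dist :: "'w measure \<Rightarrow> ('w \<Rightarrow> 'b::euclidean_space) set \<Rightarrow> ('w \<Rightarrow> 'b) set \<Rightarrow> real" where
  "L2_dist M A B = l2norm M (\<lambda>w. rep A w - rep B w)"

definition L2_metric :: "'w measure \<Rightarrow> ('w \<Rightarrow> 'b::euclidean_space) set metric" where
  "L2_metric M = metric (L2 M, L2_dist M)"

definition L2_convex :: "'w measure \<Rightarrow> ('w \<Rightarrow> 'b::euclidean_space) set set \<Rightarrow> bool" where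
  "L2_convex M C \<longleftrightarrow>
     (\<forall>A\<in>C. \<forall>B\<in>C. \<forall>r\<in>{0..1}. ae_class M (\<lambda>w. (1 - r) *\<^sub>R rep A w + r *\<^sub>R rep B w) \<in> C)"

lemma ae_class_eq_iff:
  assumes [measurable]: "h \<in> borel_measurable M"
  shows "ae_class M h = ae_class M h' \<longleftrightarrow> (AE w in M. h w = h' w)"
proof
  assume "ae_class M h = ae_class M h'"
  moreover have "h \<in> ae_class M h" by (simp add: ae_class_def)
  ultimately show "AE w in M. h w = h' w" by (simp add: ae_class_def)
next
  assume *: "AE w in M. h w = h' w"
  have "(AE w in M. k w = h w) \<longleftrightarrow> (AE w in M. k w = h' w)" for k
    using * by (auto elim: eventually_elim2)
  then show "ae_class M h = ae_class M h'" by (simp add: ae_class_def)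
qed

lemma rep_ae_class:
  assumes "h \<in> borel_measurable M"
  shows "rep (ae_class M h) \<in> borel_measurable M" "AE w in M. rep (ae_class M h) w = h w"
proof -
  have "h \<in> ae_class M h" using assms by (simp add: ae_class_def)
  then have "rep (ae_class M h) \<in> ae_class M h" 
    unfolding rep_def by (rule someI[where P = "\<lambda>k. k \<in> ae_class M h"])
  then show "rep (ae_class M h) \<in> borel_measurable M" "AE w in M. rep (ae_class M h) w = h w"
    by (simp_all add: ae_class_def)
qed

lemma rep_L2:
  assumes "A \<in> L2 M"
  shows "rep A \<in> borel_measurable M" "integrable M (\<lambda>w. (norm (rep A w))\<^sup>2)"
    "ae_class M (rep A) = A"
proof -
  obtain h where h[measurable]: "h \<in> borel_measurable M"
    and i: "integrable M (\<lambda>w. (norm (h w))\<^sup>2)" and A: "A = ae_class M h"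
    using assms by (auto simp: L2_def)
  note [measurable] = rep_ae_class(1)[OF h]
  show "rep A \<in> borel_measurable M" using A by simp
  show "integrable M (\<lambda>w. (norm (rep A w))\<^sup>2)"
    unfolding A using rep_ae_class(2)[OF h]
    by (intro integrable_cong_AE_imp[OF i]) (auto elim: eventually_mono)
  show "ae_class M (rep A) = A"
    unfolding A using ae_class_eq_iff[OF rep_ae_class(1)[OF h]] rep_ae_class(2)[OF h] by blast
qed

lemma integrable_norm_sq_add:
  fixes h k :: "'w \<Rightarrow> 'b::euclidean_space"
  assumes [measurable]: "h \<in> borel_measurable M" "k \<in> borel_measurable M"
    and i: "integrable M (\<lambda>w. (norm (h w))\<^sup>2)" "integrable M (\<lambda>w. (norm (k w))\<^sup>2)"
  shows "integrable M (\<lambda>w. (norm (h w + k w))\<^sup>2)" "integrable M (\<lambda>w. norm (h w) * norm (k w))"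
proof -
  have I: "integrable M (\<lambda>w. 2 * (norm (h w))\<^sup>2 + 2 * (norm (k w))\<^sup>2)"
    using i by simp
  have b: "2 * (norm a * norm b) \<le> (norm a)\<^sup>2 + (norm b)\<^sup>2" for a b :: 'b
    using sum_squares_bound[of "norm a" "norm b"] by (simp add: mult.assoc)
  show "integrable M (\<lambda>w. norm (h w) * norm (k w))"
  proof (rule Bochner_Integration.integrable_bound[OF I])
    have "norm (norm (h w) * norm (k w)) \<le> norm (2 * (norm (h w))\<^sup>2 + 2 * (norm (k w))\<^sup>2)" for w
      using b[of "h w" "k w"] by (simp add: abs_mult) (smt (verit) zero_le_power2 norm_ge_zero mult_nonneg_nonneg)
    then show "AE w in M. norm (norm (h w) * norm (k w)) \<le> norm (2 * (norm (h w))\<^sup>2 + 2 * (norm (k w))\<^sup>2)"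
      by simp
  qed simp
  show "integrable M (\<lambda>w. (norm (h w + k w))\<^sup>2)"
  proof (rule Bochner_Integration.integrable_bound[OF I])
    have "(norm (h w + k w))\<^sup>2 \<le> 2 * (norm (h w))\<^sup>2 + 2 * (norm (k w))\<^sup>2" for w
    proof -
      have "(norm (h w + k w))\<^sup>2 \<le> (norm (h w) + norm (k w))\<^sup>2"
        by (intro power_mono norm_triangle_ineq) simp
      also have "\<dots> \<le> 2 * (norm (h w))\<^sup>2 + 2 * (norm (k w))\<^sup>2"
        using b[of "h w" "k w"] by (simp add: power2_sum mult.assoc)
      finally show ?thesis .
    qed
    then show "AE w in M. norm ((norm (h w + k w))\<^sup>2) \<le> norm (2 * (norm (h w))\<^sup>2 + 2 * (norm (k w))\<^sup>2)"
      by simp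
  qed simp
qed

lemma l2norm_nonneg [simp]: "0 \<le> l2norm M h"
  by (simp add: l2norm_def)

lemma l2norm_square: "(l2norm M h)\<^sup>2 = (LINT w|M. (norm (h w))\<^sup>2)"
  by (simp add: l2norm_def)

lemma l2norm_cong_AE:
  assumes [measurable]: "h \<in> borel_measurable M" "k \<in> borel_measurable M"
    and "AE w in M. norm (h w) = norm (k w)"
  shows "l2norm M h = l2norm M k"
  unfolding l2norm_def using assms(3)
  by (intro arg_cong[where f = sqrt] integral_cong_AE) (auto elim: eventually_mono)

lemma l2norm_Cauchy_Schwarz:
  fixes h k :: "'w \<Rightarrow> 'b::euclidean_space"
  assumes [measurable]: "h \<in> borel_measurable M" "k \<in> borel_measurable M"
    and i: "integrable M (\<lambda>w. (norm (h w))\<^sup>2)" "integrable M (\<lambda>w. (norm (k w))\<^sup>2)"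
  shows "(LINT w|M. norm (h w) * norm (k w)) \<le> l2norm M h * l2norm M k"
proof -
  define P where "P = (LINT w|M. norm (h w) * norm (k w))"
  define a where "a = (l2norm M h)\<^sup>2"
  define b where "b = (l2norm M k)\<^sup>2"
  have P0: "0 \<le> P" by (simp add: P_def)
  have a0: "0 \<le> a" "0 \<le> b" by (simp_all add: a_def b_def)
  have q: "2 * r * P \<le> a + r\<^sup>2 * b" for r
  proof -
    have "2 * r * P = (LINT w|M. 2 * r * (norm (h w) * norm (k w)))"
      by (simp add: P_def)
    also have "\<dots> \<le> (LINT w|M. (norm (h w))\<^sup>2 + r\<^sup>2 * (norm (k w))\<^sup>2)"
    proof (rule integral_mono)
      fix w
      show "2 * r * (norm (h w) * norm (k w)) \<le> (norm (h w))\<^sup>2 + r\<^sup>2 * (norm (k w))\<^sup>2"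
        using sum_squares_bound[of "norm (h w)" "r * norm (k w)"]
        by (simp add: power_mult_distrib algebra_simps)
    qed (use i integrable_norm_sq_add(2)[OF assms] in simp_all)
    also have "\<dots> = a + r\<^sup>2 * b"
      using i by (simp add: a_def b_def l2norm_square)
    finally show ?thesis .
  qed
  have "P\<^sup>2 \<le> a * b"
  proof (cases "b = 0")
    case True
    have "P = 0"
    proof (rule ccontr)
      assume "P \<noteq> 0"
      then have "P > 0" using P0 by simp
      have "2 * ((a + 1) / P) * P \<le> a" using q[of "(a + 1) / P"] True by simp
      then show False using \<open>P > 0\<close> a0 by simp
    qed
    then show ?thesis using True by simp
  next
    case False
    then have b: "b > 0" using a0 by simp
    have "2 * (P / b) * P \<le> a + (P / b)\<^sup>2 * b" by (rule q)
    then show ?thesis using b by (simp add: field_simps power2_eq_square)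
  qed
  then have "P\<^sup>2 \<le> (l2norm M h * l2norm M k)\<^sup>2"
    by (simp add: a_def b_def power_mult_distrib)
  then show ?thesis
    unfolding P_def[symmetric] by (rule power2_le_imp_le) simp
qed

lemma l2norm_triangle:
  fixes h k :: "'w \<Rightarrow> 'b::euclidean_space"
  assumes [measurable]: "h \<in> borel_measurable M" "k \<in> borel_measurable M"
    and i: "integrable M (\<lambda>w. (norm (h w))\<^sup>2)" "integrable M (\<lambda>w. (norm (k w))\<^sup>2)"
  shows "l2norm M (\<lambda>w. h w + k w) \<le> l2norm M h + l2norm M k"
proof -
  have hk: "integrable M (\<lambda>w. norm (h w) * norm (k w))"
    by (rule integrable_norm_sq_add(2)[OF assms])
  have "(l2norm M (\<lambda>w. h w + k w))\<^sup>2 \<le>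
      (LINT w|M. (norm (h w))\<^sup>2 + 2 * (norm (h w) * norm (k w)) + (norm (k w))\<^sup>2)"
    unfolding l2norm_square
  proof (rule integral_mono)
    fix w
    have "(norm (h w + k w))\<^sup>2 \<le> (norm (h w) + norm (k w))\<^sup>2"
      by (intro power_mono norm_triangle_ineq) simp
    then show "(norm (h w + k w))\<^sup>2 \<le> (norm (h w))\<^sup>2 + 2 * (norm (h w) * norm (k w)) + (norm (k w))\<^sup>2"
      by (simp add: power2_sum mult.assoc)
  qed (use i hk integrable_norm_sq_add(1)[OF assms] in simp_all)
  also have "\<dots> = (l2norm M h)\<^sup>2 + 2 * (LINT w|M. norm (h w) * norm (k w)) + (l2norm M k)\<^sup>2"
    using i hk by (simp add: l2norm_square)
  also have "\<dots> \<le> (l2norm M h)\<^sup>2 + 2 * (l2norm M h * l2norm M k) + (l2norm M k)\<^sup>2"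
    using l2norm_Cauchy_Schwarz[OF assms] by simp
  also have "\<dots> = (l2norm M h + l2norm M k)\<^sup>2"
    by (simp add: power2_sum)
  finally show ?thesis by (rule power2_le_imp_le) simp
qed

lemma l2norm_diff_eq_0_iff:
  fixes h k :: "'w \<Rightarrow> 'b::euclidean_space"
  assumes [measurable]: "h \<in> borel_measurable M" "k \<in> borel_measurable M"
    and i: "integrable M (\<lambda>w. (norm (h w))\<^sup>2)" "integrable M (\<lambda>w. (norm (k w))\<^sup>2)"
  shows "integrable M (\<lambda>w. (norm (h w - k w))\<^sup>2)"
    "l2norm M (\<lambda>w. h w - k w) = 0 \<longleftrightarrow> (AE w in M. h w = k w)"
proof -
  show I: "integrable M (\<lambda>w. (norm (h w - k w))\<^sup>2)"
    using integrable_norm_sq_add(1)[of h M "\<lambda>w. - k w"] i by simp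
  show "l2norm M (\<lambda>w. h w - k w) = 0 \<longleftrightarrow> (AE w in M. h w = k w)"
    unfolding l2norm_def using integral_nonneg_eq_0_iff_AE[OF I] by simp
qed

lemma Metric_space_L2:
  "Metric_space (L2 M :: ('w \<Rightarrow> 'b::euclidean_space) set set) (L2_dist M)"
proof
  fix A B :: "('w \<Rightarrow> 'b) set"
  show "0 \<le> L2_dist M A B" by (simp add: L2_dist_def)
  show "L2_dist M A B = L2_dist M B A"
    by (simp add: L2_dist_def l2norm_def norm_minus_commute)
next
  fix A B :: "('w \<Rightarrow> 'b) set"
  assume A: "A \<in> L2 M" and B: "B \<in> L2 M"
  show "L2_dist M A B = 0 \<longleftrightarrow> A = B"
    unfolding L2_dist_def
    using l2norm_diff_eq_0_iff(2)[OF rep_L2(1)[OF A] rep_L2(1)[OF B] rep_L2(2)[OF A] rep_L2(2)[OF B]]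
      ae_class_eq_iff[OF rep_L2(1)[OF A], of "rep B"] rep_L2(3)[OF A] rep_L2(3)[OF B] by simp
next
  fix A B C :: "('w \<Rightarrow> 'b) set"
  assume A: "A \<in> L2 M" and B: "B \<in> L2 M" and C: "C \<in> L2 M"
  note [measurable] = rep_L2(1)[OF A] rep_L2(1)[OF B] rep_L2(1)[OF C]
  have "integrable M (\<lambda>w. (norm (rep A w - rep B w))\<^sup>2)"
    "integrable M (\<lambda>w. (norm (rep B w - rep C w))\<^sup>2)"
    using rep_L2[OF A] rep_L2[OF B] rep_L2[OF C] by (auto intro: l2norm_diff_eq_0_iff(1))
  then have "l2norm M (\<lambda>w. (rep A w - rep B w) + (rep B w - rep C w)) \<le>
      l2norm M (\<lambda>w. rep A w - rep B w) + l2norm M (\<lambda>w. rep B w - rep C w)"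
    by (intro l2norm_triangle) simp_all
  then show "L2_dist M A C \<le> L2_dist M A B + L2_dist M B C"
    by (simp add: L2_dist_def)
qed

lemma mspace_L2_metric [simp]: "mspace (L2_metric M) = L2 M"
  by (simp add: L2_metric_def Metric_space.mspace_metric[OF Metric_space_L2])

lemma mdist_L2_metric [simp]: "mdist (L2_metric M) = L2_dist M"
  by (simp add: L2_metric_def Metric_space.mdist_metric[OF Metric_space_L2])

lemma L2_dist_ae_class:
  assumes [measurable]: "h \<in> borel_measurable M" "k \<in> borel_measurable M"
  shows "L2_dist M (ae_class M h) (ae_class M k) = l2norm M (\<lambda>w. h w - k w)"
proof -
  note [measurable] = rep_ae_class(1)[OF assms(1)] rep_ae_class(1)[OF assms(2)]
  show ?thesis
    unfolding L2_dist_def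
    using rep_ae_class(2)[OF assms(1)] rep_ae_class(2)[OF assms(2)]
    by (intro l2norm_cong_AE) (auto elim: eventually_elim2)
qed


section \<open>Basic hypotheses\<close>

definition radon_measure :: "'w::metric_space measure \<Rightarrow> bool" where
  "radon_measure M \<longleftrightarrow> sets M = sets borel \<and> (\<forall>K. compact K \<longrightarrow> emeasure M K < \<infinity>) \<and>
     (\<forall>A\<in>sets M. emeasure M A = (SUP K\<in>{K. compact K \<and> K \<subseteq> A}. emeasure M K))"

definition usc_map_on :: "real set \<Rightarrow> (real \<Rightarrow> 'u::topological_space set) \<Rightarrow> bool" where
  "usc_map_on I U \<longleftrightarrow> (\<forall>C. closed C \<longrightarrow> closedin (top_of_set I) {t \<in> I. U t \<inter> C \<noteq> {}})"

definition lsc :: "('a::topological_space \<Rightarrow> real) \<Rightarrow> bool" where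
  "lsc h \<longleftrightarrow> (\<forall>x. \<forall>c < h x. \<forall>\<^sub>F y in nhds x. c < h y)"

text \<open>
  The metric space \<open>\<Omega>\<close> is the whole type \<^typ>\<open>'w\<close>.  Only the restrictions of \<open>U\<close> and \<open>f\<close>
  to times in \<open>[0, T]\<close> are constrained or used.
\<close>

definition basic_hypotheses ::
  "real \<Rightarrow> 'w::metric_space measure \<Rightarrow> (real \<Rightarrow> (real^'m) set) \<Rightarrow>
   (real \<Rightarrow> real^'n \<Rightarrow> real^'m \<Rightarrow> 'w \<Rightarrow> real^'n) \<Rightarrow> (real^'n \<Rightarrow> 'w \<Rightarrow> real) \<Rightarrow> bool" where
  "basic_hypotheses T \<mu> U f g \<longleftrightarrow>
     compact (UNIV :: 'w set) \<and> finite_measure \<mu> \<and> radon_measure \<mu> \<and>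
     usc_map_on {0..T} U \<and> (\<forall>t\<in>{0..T}. U t \<noteq> {} \<and> compact (U t)) \<and>
     (\<exists>UU. compact UU \<and> (\<forall>t\<in>{0..T}. U t \<subseteq> UU)) \<and>
     (\<forall>x u w. (\<lambda>t. f t x u w) \<in> borel_measurable (lebesgue_on {0..T})) \<and>
     (\<forall>t\<in>{0..T}. continuous_on UNIV (\<lambda>(x, u, w). f t x u w)) \<and>
     (\<exists>c>0. \<exists>k>0. AE t in lebesgue_on {0..T}. \<forall>x x' u w.
        norm (f t x u w) \<le> c * (1 + norm x) \<and>
        norm (f t x u w - f t x' u w) \<le> k * norm (x - x')) \<and>
     (\<lambda>(x, w). g x w) \<in> borel_measurable (lebesgue \<Otimes>\<^sub>M \<mu>) \<and>
     (\<forall>w. lsc (\<lambda>x. g x w)) \<and>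
     (\<exists>a b. integrable \<mu> a \<and> 0 \<le> b \<and> (\<forall>x w. a w - b * (norm x)\<^sup>2 \<le> g x w))"


section \<open>Set-valued dynamics and trajectories\<close>

text \<open>
  The growth bound on \<open>f\<close> holds only for almost every time, so at exceptional times the classes
  in \<open>F_dyn \<mu> U f t \<phi>\<close> need not be square integrable.
\<close>

definition F_dyn ::
  "'w::metric_space measure \<Rightarrow> (real \<Rightarrow> (real^'m) set) \<Rightarrow>
   (real \<Rightarrow> real^'n \<Rightarrow> real^'m \<Rightarrow> 'w \<Rightarrow> real^'n) \<Rightarrow>
   real \<Rightarrow> ('w \<Rightarrow> real^'n) set \<Rightarrow> ('w \<Rightarrow> real^'n) set set" where
  "F_dyn \<mu> U f t \<phi> = (\<lambda>u. ae_class \<mu> (\<lambda>w. f t (rep \<phi> w) u w)) ` U t"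

definition L2_abs_continuous_on ::
  "'w measure \<Rightarrow> real set \<Rightarrow> (real \<Rightarrow> ('w \<Rightarrow> 'b::euclidean_space) set) \<Rightarrow> bool" where
  "L2_abs_continuous_on M I x \<longleftrightarrow>
     (\<forall>\<epsilon>>0. \<exists>\<delta>>0. \<forall>(n::nat) a b.
        (\<forall>i<n. a i \<in> I \<and> b i \<in> I \<and> a i \<le> b i) \<longrightarrow>
        pairwise (\<lambda>i j. disjnt {a i<..<b i} {a j<..<b j}) {..<n} \<longrightarrow>
        (\<Sum>i<n. b i - a i) < \<delta> \<longrightarrow>
        (\<Sum>i<n. L2_dist M (x (a i)) (x (b i))) < \<epsilon>)"

text \<open>
  The strong derivative, i.e. the limit in \<open>L\<^sup>2\<close> of the difference quotients.  As \<open>L\<^sup>2\<close> is a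
  Hilbert space, absolutely continuous curves are exactly the \<open>W\<^sup>1\<^sup>,\<^sup>1\<close> curves, and their weak
  derivative agrees almost everywhere with the strong one.
\<close>

definition has_L2_derivative ::
  "'w measure \<Rightarrow> real set \<Rightarrow> (real \<Rightarrow> ('w \<Rightarrow> 'b::euclidean_space) set) \<Rightarrow>
   ('w \<Rightarrow> 'b) set \<Rightarrow> real \<Rightarrow> bool" where
  "has_L2_derivative M I x v t \<longleftrightarrow> v \<in> L2 M \<and>
     ((\<lambda>\<tau>. l2norm M (\<lambda>w. (rep (x \<tau>) w - rep (x t) w) /\<^sub>R (\<tau> - t) - rep v w)) \<longlongrightarrow> 0)
       (at t within I)"

text \<open>
  \<^const>\<open>cfunspace\<close> carries the supremum metric; its elements are extensional, i.e. set to
  \<^const>\<open>undefined\<close> outside \<open>[s, T]\<close>.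
\<close>

definition C_L2 :: "'w measure \<Rightarrow> real \<Rightarrow> real \<Rightarrow> (real \<Rightarrow> ('w \<Rightarrow> 'b::euclidean_space) set) metric" where
  "C_L2 M s T = cfunspace (top_of_set {s..T}) (L2_metric M)"

definition trajectories ::
  "real \<Rightarrow> 'w::metric_space measure \<Rightarrow> (real \<Rightarrow> (real^'m) set) \<Rightarrow>
   (real \<Rightarrow> real^'n \<Rightarrow> real^'m \<Rightarrow> 'w \<Rightarrow> real^'n) \<Rightarrow>
   real \<Rightarrow> ('w \<Rightarrow> real^'n) set \<Rightarrow> (real \<Rightarrow> ('w \<Rightarrow> real^'n) set) set" where
  "trajectories T \<mu> U f s \<phi> =
     {x \<in> mspace (C_L2 \<mu> s T). L2_abs_continuous_on \<mu> {s..T} x \<and> x s = \<phi> \<and>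
        (AE t in lebesgue_on {s..T}. \<exists>v \<in> F_dyn \<mu> U f t (x t). has_L2_derivative \<mu> {s..T} x v t)}"


section \<open>Additional hypotheses\<close>

definition modulus_of_continuity :: "(real \<Rightarrow> real) \<Rightarrow> bool" where
  "modulus_of_continuity \<theta> \<longleftrightarrow>
     (\<forall>r\<ge>0. 0 \<le> \<theta> r) \<and> mono_on {0..} \<theta> \<and> (\<theta> \<longlongrightarrow> 0) (at_right 0)"

text \<open>
  Under the basic hypotheses the supremum is Lebesgue measurable in \<open>t\<close>, so the nonnegative
  integral below is a genuine one and not merely a lower integral.
\<close>

definition measure_modulus_hypothesis ::
  "real \<Rightarrow> 'w::metric_space measure \<Rightarrow> (real \<Rightarrow> (real^'m) set) \<Rightarrow>
   (real \<Rightarrow> real^'n \<Rightarrow> real^'m \<Rightarrow> 'w \<Rightarrow> real^'n) \<Rightarrow> bool" where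
  "measure_modulus_hypothesis T \<mu> U f \<longleftrightarrow>
     (\<forall>r>0. 0 < (INF w. measure \<mu> (ball w r))) \<and>
     (\<exists>\<theta>. modulus_of_continuity \<theta> \<and>
        (\<forall>w1 w2. (\<integral>\<^sup>+t. (SUP u\<in>U t. SUP x. SUP y. ennreal (norm (f t x u w1 - f t y u w2)))
            \<partial>lebesgue_on {0..T}) \<le> ennreal (\<theta> (dist w1 w2))))"

definition compact_range_hypothesis ::
  "real \<Rightarrow> 'w::metric_space measure \<Rightarrow> (real \<Rightarrow> (real^'m) set) \<Rightarrow>
   (real \<Rightarrow> real^'n \<Rightarrow> real^'m \<Rightarrow> 'w \<Rightarrow> real^'n) \<Rightarrow> bool" where
  "compact_range_hypothesis T \<mu> U f \<longleftrightarrow>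
     (\<exists>K. compactin (mtopology_of (L2_metric \<mu>)) K \<and>
        (\<forall>t\<in>{0..T}. \<forall>\<phi>\<in>L2 \<mu>. F_dyn \<mu> U f t \<phi> \<subseteq> K))"

definition convexity_hypothesis ::
  "real \<Rightarrow> 'w::metric_space measure \<Rightarrow> (real \<Rightarrow> (real^'m) set) \<Rightarrow>
   (real \<Rightarrow> real^'n \<Rightarrow> real^'m \<Rightarrow> 'w \<Rightarrow> real^'n) \<Rightarrow> bool" where
  "convexity_hypothesis T \<mu> U f \<longleftrightarrow>
     (\<forall>t\<in>{0..T}. \<forall>\<phi>\<in>L2 \<mu>. L2_convex \<mu> (F_dyn \<mu> U f t \<phi>))"

end

theory Submission
  imports Defs "HOL-Library.Function_Algebras"
begin

text \<open>
  Trajectories are curves in \<open>L\<^sup>2\<close> whose velocity at almost every time is \<open>f t (x t \<cdot>) u \<cdot>\<close> for some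
  control \<open>u\<close> in \<open>U t\<close>.  The space \<open>C([s, T]; L\<^sup>2)\<close> is complete because \<open>L\<^sup>2\<close> is, so the set of
  trajectories is compact once it is totally bounded and closed.

  \<^emph>\<open>Total boundedness.\<close>  Linear growth of \<open>f\<close> bounds all trajectories by one constant and hence
  makes them Lipschitz with one constant, so it suffices that the set of all states reached is totally
  bounded in \<open>L\<^sup>2\<close>.  This is a Gronwall argument for the mesh of finite nets.  Suppose that the states
  reached during a time interval of length \<open>\<delta>\<close> have a finite net of mesh \<open>\<rho>\<close>, which after a slight
  enlargement of \<open>\<rho>\<close> consists of simple functions \<open>\<psi>\<close>.  As \<open>f\<close> is \<open>k\<close>-Lipschitz in the state, every
  velocity is within \<open>k \<rho>\<close> of some \<open>f t (\<psi> \<cdot>) u \<cdot>\<close>.  For fixed \<open>t\<close> the latter functions are uniformly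
  continuous in \<open>\<omega>\<close> on the pieces where \<open>\<psi>\<close> is constant, uniformly in \<open>u\<close>, because controls and
  \<open>\<Omega>\<close> range over compact sets.  Rounding \<open>\<omega>\<close> to finitely many sample points therefore moves
  them very little, at all times outside a set of small measure, and puts them into one bounded
  finite-dimensional convex set.  The mean value inequality now gives a net of mesh about
  \<open>k \<delta> \<rho>\<close>, and \<open>k \<delta> \<le> 1/2\<close> on short intervals (\<open>has_net_halve\<close>).  Iteration drives the mesh to
  \<open>0\<close>, and finitely many short intervals exhaust \<open>[s, T]\<close>.

  \<^emph>\<open>Closedness.\<close>  Let trajectories \<open>x\<^sub>j\<close> converge uniformly to \<open>y\<close>.  Their derivatives need not converge,
  but suitable convex combinations \<open>z\<^sub>k\<close> of the tails \<open>x\<^sub>k, x\<^bsub>k+1\<^esub>, \<dots>\<close> do: if \<open>z\<^sub>k\<close> nearly minimises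
  the Dirichlet energy among these combinations, the parallelogram law makes the energy of \<open>z\<^sub>k - y\<close>
  small.  Vitali's covering lemma turns this into a bound for all difference quotients of \<open>z\<^sub>k - y\<close>
  at once outside a set of small measure, and Borel-Cantelli yields, for almost every \<open>t\<close>, that the
  difference quotients of \<open>y\<close> at \<open>t\<close> are approximated by the derivatives of the \<open>z\<^sub>k\<close>
  (\<open>convex_combinations_approximate\<close>).  These are convex combinations of velocities
  in \<open>F(t, x\<^sub>j(t))\<close>, so they approach the convex set \<open>F(t, y(t))\<close>.  As \<open>F(t, y(t))\<close> is the continuous
  image of the compact set \<open>U t\<close>, a subsequence converges to one of its elements, which is then the
  derivative of \<open>y\<close> at \<open>t\<close> (\<open>limit_of_solutions_deriv\<close>).

  The argument is carried out with functions and the \<open>L\<^sup>2\<close> seminorm; classes modulo almost everywhere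
  equality enter only in the last section.
\<close>

section \<open>Pointwise linear structure on functions\<close>

text \<open>
  With this instance \<^const>\<open>convex\<close>, \<^const>\<open>subspace\<close> and convex hulls are available both for
  functions on \<open>\<Omega>\<close> and for curves of such functions.
\<close>

instantiation "fun" :: (type, real_vector) real_vector
begin

definition scaleR_fun_def: "r *\<^sub>R f = (\<lambda>x. r *\<^sub>R f x)"

instance
  by standard (simp_all add: scaleR_fun_def fun_eq_iff scaleR_add_right scaleR_add_left)

end

lemma scaleR_fun_apply [simp]: "(r *\<^sub>R f) x = r *\<^sub>R f x"
  by (simp add: scaleR_fun_def)

section \<open>Intervals, dyadic grids and null sets on the line\<close>

text \<open>
  A finite family of non-overlapping intervals is a list ordered from left to right, so that families
  living on adjacent intervals are joined by appending the lists.
\<close>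

definition intervals_in :: "real set \<Rightarrow> (real \<times> real) list \<Rightarrow> bool" where
  "intervals_in A ps \<longleftrightarrow> sorted_wrt (\<lambda>I J. snd I \<le> fst J) ps \<and>
     (\<forall>I\<in>set ps. fst I \<le> snd I \<and> {fst I..snd I} \<subseteq> A)"

lemma intervals_in_Nil [simp]: "intervals_in A []"
  by (simp add: intervals_in_def)

lemma intervals_in_append:
  assumes ps: "intervals_in (A \<inter> {p..q}) ps" and qs: "intervals_in (A \<inter> {q..r}) qs"
    and "p \<le> q" "q \<le> r"
  shows "intervals_in (A \<inter> {p..r}) (ps @ qs)"
proof -
  have *: "snd I \<le> q \<and> fst I \<le> snd I \<and> {fst I..snd I} \<subseteq> A \<inter> {p..r}" if "I \<in> set ps" for I
  proof -
    have "fst I \<le> snd I" "{fst I..snd I} \<subseteq> A \<inter> {p..q}"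
      using ps that by (simp_all add: intervals_in_def)
    then show ?thesis using \<open>q \<le> r\<close> by (auto simp: subset_iff)
  qed
  have **: "q \<le> fst J \<and> fst J \<le> snd J \<and> {fst J..snd J} \<subseteq> A \<inter> {p..r}" if "J \<in> set qs" for J
  proof -
    have "fst J \<le> snd J" "{fst J..snd J} \<subseteq> A \<inter> {q..r}"
      using qs that by (simp_all add: intervals_in_def)
    then show ?thesis using \<open>p \<le> q\<close> by (auto simp: subset_iff)
  qed
  have "sorted_wrt (\<lambda>I J. snd I \<le> fst J) (ps @ qs)"
    using ps qs * ** unfolding intervals_in_def sorted_wrt_append by (meson order_trans)
  then show ?thesis
    unfolding intervals_in_def set_append using * ** by blast
qed

lemma intervals_in_mono: "intervals_in A ps \<Longrightarrow> A \<subseteq> B \<Longrightarrow> intervals_in B ps"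
  by (auto simp: intervals_in_def)

lemma intervals_in_length:
  assumes "intervals_in A ps" "A \<in> lmeasurable"
  shows "(\<Sum>(p, q)\<leftarrow>ps. q - p) \<le> measure lebesgue A"
  using assms
proof (induction ps arbitrary: A)
  case (Cons I ps)
  obtain p q where I: "I = (p, q)" by fastforce
  have pq: "p \<le> q" "{p..q} \<subseteq> A" using Cons.prems by (auto simp: intervals_in_def I)
  have "intervals_in (A \<inter> {q..}) ps"
    using Cons.prems(1) by (fastforce simp: intervals_in_def I)
  moreover have m: "A \<inter> {q..} \<in> lmeasurable"
    using Cons.prems(2) by (intro fmeasurable_Int_fmeasurable) auto
  ultimately have IH: "(\<Sum>(p, q)\<leftarrow>ps. q - p) \<le> measure lebesgue (A \<inter> {q..})"
    by (rule Cons.IH)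
  have c: "{p..<q} \<in> lmeasurable"
    by (rule fmeasurableI) (simp_all add: emeasure_lborel_Ico pq(1))
  have "measure lebesgue {p..<q} + measure lebesgue (A \<inter> {q..}) = measure lebesgue ({p..<q} \<union> (A \<inter> {q..}))"
    using m c by (intro measure_Union[symmetric]) (auto simp: fmeasurable_def)
  also have "\<dots> \<le> measure lebesgue A"
    using m c pq Cons.prems(2) by (intro measure_mono_fmeasurable) auto
  finally show ?case using IH pq by (simp add: I)
qed simp

lemma open_cover_small:
  assumes "S \<in> sets lebesgue" "emeasure lebesgue S < ennreal \<eta>" "0 < \<eta>"
  obtains A :: "real set" where "open A" "S \<subseteq> A" "A \<in> lmeasurable" "measure lebesgue A < \<eta>"
proof -
  have S: "S \<in> lmeasurable"
    using assms by (intro fmeasurableI) (auto intro: order.strict_trans)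
  define e where "e = \<eta> - measure lebesgue S"
  have e: "e > 0" using assms S by (simp add: e_def emeasure_eq_measure2 ennreal_less_iff)
  obtain A where A: "open A" "S \<subseteq> A" "A - S \<in> lmeasurable" "emeasure lebesgue (A - S) < ennreal e"
    using sets_lebesgue_outer_open[OF assms(1) e] by blast
  have Aeq: "A = S \<union> (A - S)" using A(2) by blast
  have m: "A \<in> lmeasurable" using S A(3) by (subst Aeq) (rule fmeasurable.Un)
  have "measure lebesgue A \<le> measure lebesgue S + measure lebesgue (A - S)"
    by (subst Aeq) (rule measure_Un_le, use S A(3) in auto)
  also have "\<dots> < \<eta>"
    using A(3,4) e by (simp add: emeasure_eq_measure2 ennreal_less_iff e_def)
  finally show thesis using that A m by blast
qed

lemma open_cover_null:
  assumes "AE t in lebesgue_on {a..b}. Q t" "0 < \<eta>"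
  obtains A :: "real set" where "open A" "A \<in> lmeasurable" "measure lebesgue A < \<eta>"
    "\<And>t. t \<in> {a..b} - A \<Longrightarrow> Q t"
proof -
  have "AE t in lebesgue. t \<in> {a..b} \<longrightarrow> Q t"
    using assms(1) by (simp add: AE_restrict_space_iff)
  then obtain S where S: "S \<in> null_sets lebesgue" "{t. \<not> (t \<in> {a..b} \<longrightarrow> Q t)} \<subseteq> S"
    unfolding eventually_ae_filter by auto
  then have "emeasure lebesgue S < ennreal \<eta>" "S \<in> sets lebesgue"
    using assms(2) by (auto simp: null_sets_def)
  then obtain A where "open A" "S \<subseteq> A" "A \<in> lmeasurable" "measure lebesgue A < \<eta>"
    using open_cover_small assms(2) by blast
  then show thesis using that S by blast
qed

lemma AE_lebesgue_on_subset:
  assumes "AE t in lebesgue_on {s..T}. P t" "s \<le> a" "b \<le> T"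
  shows "AE t in lebesgue_on {a..b}. P (t :: real)"
proof -
  have "AE t in lebesgue. t \<in> {s..T} \<longrightarrow> P t" using assms(1) by (simp add: AE_restrict_space_iff)
  then have "AE t in lebesgue. t \<in> {a..b} \<longrightarrow> P t"
    by eventually_elim (use assms(2,3) in auto)
  then show ?thesis by (simp add: AE_restrict_space_iff)
qed

definition grid :: "real \<Rightarrow> real \<Rightarrow> nat \<Rightarrow> nat \<Rightarrow> real" where
  "grid s T n i = s + real i * (T - s) / 2 ^ n"

lemma grid_in:
  assumes "s \<le> T" "i \<le> 2 ^ n"
  shows "grid s T n i \<in> {s..T}"
proof -
  have "real i \<le> 2 ^ n" using assms(2) by (metis of_nat_le_iff of_nat_numeral of_nat_power)
  then have "real i * (T - s) / 2 ^ n \<le> T - s"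
    using assms(1) mult_right_mono[of "real i" "2 ^ n" "T - s"] by (simp add: divide_le_eq mult.commute)
  then show ?thesis using assms by (simp add: grid_def)
qed

lemma grid_Suc: "grid s T n (Suc i) - grid s T n i = (T - s) / 2 ^ n"
  by (simp add: grid_def field_simps)

definition grid_index :: "real \<Rightarrow> real \<Rightarrow> nat \<Rightarrow> real \<Rightarrow> nat" where
  "grid_index s T n t = nat \<lfloor>(t - s) / ((T - s) / 2 ^ n)\<rfloor>"

lemma grid_index:
  assumes sT: "s < T"
  shows "p \<le> q \<Longrightarrow> grid_index s T n p \<le> grid_index s T n q"
    and "p \<le> T \<Longrightarrow> grid_index s T n p \<le> 2 ^ n"
    and "s \<le> p \<Longrightarrow> \<bar>grid s T n (grid_index s T n p) - p\<bar> \<le> (T - s) / 2 ^ n"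
proof -
  define h where "h = (T - s) / 2 ^ n"
  have h: "h > 0" using sT by (simp add: h_def)
  define k where "k p = nat \<lfloor>(p - s) / h\<rfloor>" for p
  have k_eq: "grid_index s T n p = k p" for p by (simp add: grid_index_def k_def h_def)
  have k_mono: "k p \<le> k q" if "p \<le> q" for p q
    unfolding k_def using that h by (intro nat_mono floor_mono divide_right_mono) auto
  then show "p \<le> q \<Longrightarrow> grid_index s T n p \<le> grid_index s T n q" by (simp add: k_eq)
  show "grid_index s T n p \<le> 2 ^ n" if "p \<le> T"
  proof -
    have "(T - s) / h = of_int (2 ^ n)" using sT by (simp add: h_def)
    then have "k T = 2 ^ n" unfolding k_def by (metis floor_of_int nat_power_eq nat_numeral zero_le_numeral)
    then show ?thesis using k_mono[OF that] by (simp add: k_eq)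
  qed
  show "\<bar>grid s T n (grid_index s T n p) - p\<bar> \<le> (T - s) / 2 ^ n" if "s \<le> p"
  proof -
    have "real (k p) = of_int \<lfloor>(p - s) / h\<rfloor>" using that h by (simp add: k_def)
    then have "real (k p) \<le> (p - s) / h" "(p - s) / h \<le> real (k p) + 1" by linarith+
    then have "real (k p) * h \<le> p - s" "p - s \<le> real (k p) * h + h"
      using h by (simp_all add: field_simps)
    moreover have "grid s T n (k p) = s + real (k p) * h" by (simp add: grid_def h_def)
    ultimately show ?thesis unfolding k_eq h_def[symmetric] by linarith
  qed
qed



section \<open>Curves in a space with a quadratic seminorm\<close>

text \<open>
  A pre-Hilbert space presented by its seminorm: the parallelogram law takes the place of the inner
  product.  The seminorm may vanish on nonzero vectors, as it does for functions that vanish almost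
  everywhere.
\<close>

locale quadratic_seminorm =
  fixes V :: "'v::real_vector set" and N :: "'v \<Rightarrow> real"
  assumes subspace_V: "subspace V"
    and N_scale: "x \<in> V \<Longrightarrow> N (r *\<^sub>R x) = \<bar>r\<bar> * N x"
    and N_triangle: "x \<in> V \<Longrightarrow> y \<in> V \<Longrightarrow> N (x + y) \<le> N x + N y"
    and N_parallelogram: "x \<in> V \<Longrightarrow> y \<in> V \<Longrightarrow>
      (N (x + y))\<^sup>2 + (N (x - y))\<^sup>2 = 2 * (N x)\<^sup>2 + 2 * (N y)\<^sup>2"
begin

lemma V_add [simp, intro]: "x \<in> V \<Longrightarrow> y \<in> V \<Longrightarrow> x + y \<in> V"
  and V_diff [simp, intro]: "x \<in> V \<Longrightarrow> y \<in> V \<Longrightarrow> x - y \<in> V"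
  and V_scale [simp, intro]: "x \<in> V \<Longrightarrow> r *\<^sub>R x \<in> V"
  and V_0 [simp]: "0 \<in> V"
  using subspace_V by (auto simp: subspace_add subspace_diff subspace_scale subspace_0)

lemma V_sum [intro]: "(\<And>i. i \<in> A \<Longrightarrow> g i \<in> V) \<Longrightarrow> sum g A \<in> V"
  using subspace_V by (rule subspace_sum)

lemma N_0 [simp]: "N 0 = 0"
  using N_scale[of 0 0] by simp

lemma N_minus: "x \<in> V \<Longrightarrow> N (- x) = N x"
  using N_scale[of x "-1"] by simp

lemma N_nonneg [simp]: "x \<in> V \<Longrightarrow> 0 \<le> N x"
  using N_triangle[of x "- x"] N_minus[of x] subspace_V by (simp add: subspace_neg)

lemma N_commute: "x \<in> V \<Longrightarrow> y \<in> V \<Longrightarrow> N (x - y) = N (y - x)"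
  using N_minus[of "x - y"] by simp

lemma N_tri: "x \<in> V \<Longrightarrow> y \<in> V \<Longrightarrow> z \<in> V \<Longrightarrow> N (x - z) \<le> N (x - y) + N (y - z)"
  using N_triangle[of "x - y" "y - z"] by simp

lemma N_diff_le: "x \<in> V \<Longrightarrow> y \<in> V \<Longrightarrow> N (x - y) \<le> N x + N y"
  using N_triangle[of x "- y"] N_minus[of y] subspace_V by (simp add: subspace_neg)

lemma N_le: "x \<in> V \<Longrightarrow> y \<in> V \<Longrightarrow> N x \<le> N (x - y) + N y"
  using N_triangle[of "x - y" "y"] by simp

lemma N_sum_le: "finite A \<Longrightarrow> (\<And>i. i \<in> A \<Longrightarrow> g i \<in> V) \<Longrightarrow> N (sum g A) \<le> (\<Sum>i\<in>A. N (g i))"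
proof (induction A rule: finite_induct)
  case (insert a A)
  then show ?case using N_triangle[of "g a" "sum g A"] V_sum[of A g] by fastforce
qed simp

text \<open>
  Derivatives are determined only up to vectors of seminorm \<open>0\<close>.
\<close>

definition has_deriv :: "real set \<Rightarrow> (real \<Rightarrow> 'v) \<Rightarrow> 'v \<Rightarrow> real \<Rightarrow> bool" where
  "has_deriv I X v t \<longleftrightarrow> v \<in> V \<and>
     ((\<lambda>\<tau>. N ((X \<tau> - X t) /\<^sub>R (\<tau> - t) - v)) \<longlongrightarrow> 0) (at t within I)"

lemma has_deriv_subset: "has_deriv I X v t \<Longrightarrow> J \<subseteq> I \<Longrightarrow> has_deriv J X v t"
  by (auto simp: has_deriv_def intro: tendsto_within_subset)

lemma has_deriv_iff:
  assumes X: "\<And>\<tau>. \<tau> \<in> I \<Longrightarrow> X \<tau> \<in> V" and t: "t \<in> I"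
  shows "has_deriv I X v t \<longleftrightarrow> v \<in> V \<and>
    (\<forall>\<epsilon>>0. \<exists>d>0. \<forall>\<tau>\<in>I. \<bar>\<tau> - t\<bar> < d \<longrightarrow> N (X \<tau> - X t - (\<tau> - t) *\<^sub>R v) \<le> \<epsilon> * \<bar>\<tau> - t\<bar>)"
    (is "_ \<longleftrightarrow> _ \<and> ?R")
proof (cases "v \<in> V")
  case v: True
  have eq: "N (X \<tau> - X t - (\<tau> - t) *\<^sub>R v) = \<bar>\<tau> - t\<bar> * N ((X \<tau> - X t) /\<^sub>R (\<tau> - t) - v)"
    if "\<tau> \<in> I" "\<tau> \<noteq> t" for \<tau>
  proof -
    have "X \<tau> - X t - (\<tau> - t) *\<^sub>R v = (\<tau> - t) *\<^sub>R ((X \<tau> - X t) /\<^sub>R (\<tau> - t) - v)"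
      using that by (simp add: scaleR_diff_right)
    then show ?thesis using N_scale that X t v by simp
  qed
  have "?R" if L: "has_deriv I X v t"
  proof (intro allI impI)
    fix e :: real assume "e > 0"
    then have "eventually (\<lambda>\<tau>. dist (N ((X \<tau> - X t) /\<^sub>R (\<tau> - t) - v)) 0 < e) (at t within I)"
      using L unfolding has_deriv_def tendsto_iff by blast
    then obtain d where d: "d > 0"
      "\<And>\<tau>. \<tau> \<in> I \<Longrightarrow> \<tau> \<noteq> t \<Longrightarrow> dist \<tau> t < d \<Longrightarrow> dist (N ((X \<tau> - X t) /\<^sub>R (\<tau> - t) - v)) 0 < e"
      unfolding eventually_at by blast
    show "\<exists>d>0. \<forall>\<tau>\<in>I. \<bar>\<tau> - t\<bar> < d \<longrightarrow> N (X \<tau> - X t - (\<tau> - t) *\<^sub>R v) \<le> e * \<bar>\<tau> - t\<bar>"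
    proof (intro exI[of _ d] conjI ballI impI d)
      fix \<tau> assume "\<tau> \<in> I" "\<bar>\<tau> - t\<bar> < d"
      then show "N (X \<tau> - X t - (\<tau> - t) *\<^sub>R v) \<le> e * \<bar>\<tau> - t\<bar>"
        using d(2)[of \<tau>] eq[of \<tau>] by (cases "\<tau> = t") (auto simp: dist_real_def mult.commute mult_left_mono)
    qed
  qed
  moreover have "has_deriv I X v t" if R: ?R
    unfolding has_deriv_def tendsto_iff
  proof (intro conjI v allI impI)
    fix e :: real assume "e > 0"
    then obtain d where d: "d > 0"
      "\<And>\<tau>. \<tau> \<in> I \<Longrightarrow> \<bar>\<tau> - t\<bar> < d \<Longrightarrow> N (X \<tau> - X t - (\<tau> - t) *\<^sub>R v) \<le> e / 2 * \<bar>\<tau> - t\<bar>"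
      using R[rule_format, of "e / 2"] by auto
    have "dist (N ((X \<tau> - X t) /\<^sub>R (\<tau> - t) - v)) 0 < e"
      if "\<tau> \<in> I" "\<tau> \<noteq> t" "dist \<tau> t < d" for \<tau>
    proof -
      have "\<bar>\<tau> - t\<bar> * N ((X \<tau> - X t) /\<^sub>R (\<tau> - t) - v) \<le> \<bar>\<tau> - t\<bar> * (e / 2)"
        using d(2)[of \<tau>] eq[of \<tau>] that by (simp add: dist_real_def mult.commute)
      then have "N ((X \<tau> - X t) /\<^sub>R (\<tau> - t) - v) \<le> e / 2"
        using that by (simp only: mult_le_cancel_left_pos zero_less_abs_iff right_minus_eq not_False_eq_True)
      then show ?thesis using \<open>e > 0\<close> X[OF that(1)] X[OF t] v by simp
    qed
    then show "eventually (\<lambda>\<tau>. dist (N ((X \<tau> - X t) /\<^sub>R (\<tau> - t) - v)) 0 < e) (at t within I)"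
      unfolding eventually_at using d(1) by blast
  qed
  ultimately show ?thesis using v by blast
qed (simp add: has_deriv_def)

lemma has_deriv_combination:
  assumes X: "\<And>\<tau>. \<tau> \<in> I \<Longrightarrow> X \<tau> \<in> V" and Y: "\<And>\<tau>. \<tau> \<in> I \<Longrightarrow> Y \<tau> \<in> V" and t: "t \<in> I"
    and dX: "has_deriv I X v t" and dY: "has_deriv I Y w t"
  shows "has_deriv I (a *\<^sub>R X + b *\<^sub>R Y) (a *\<^sub>R v + b *\<^sub>R w) t"
  unfolding has_deriv_def
proof
  have vw: "v \<in> V" "w \<in> V" using dX dY by (auto simp: has_deriv_def)
  then show "a *\<^sub>R v + b *\<^sub>R w \<in> V" by auto
  define p where "p \<tau> = (X \<tau> - X t) /\<^sub>R (\<tau> - t) - v" for \<tau>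
  define q where "q \<tau> = (Y \<tau> - Y t) /\<^sub>R (\<tau> - t) - w" for \<tau>
  have eq: "((a *\<^sub>R X + b *\<^sub>R Y) \<tau> - (a *\<^sub>R X + b *\<^sub>R Y) t) /\<^sub>R (\<tau> - t) - (a *\<^sub>R v + b *\<^sub>R w) =
      a *\<^sub>R p \<tau> + b *\<^sub>R q \<tau>" for \<tau>
    by (simp add: p_def q_def algebra_simps)
  have le: "N (a *\<^sub>R p \<tau> + b *\<^sub>R q \<tau>) \<le> \<bar>a\<bar> * N (p \<tau>) + \<bar>b\<bar> * N (q \<tau>)" "0 \<le> N (a *\<^sub>R p \<tau> + b *\<^sub>R q \<tau>)"
    if "\<tau> \<in> I" for \<tau>
  proof -
    have V: "p \<tau> \<in> V" "q \<tau> \<in> V" unfolding p_def q_def using X Y t vw that by auto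
    then show "N (a *\<^sub>R p \<tau> + b *\<^sub>R q \<tau>) \<le> \<bar>a\<bar> * N (p \<tau>) + \<bar>b\<bar> * N (q \<tau>)" "0 \<le> N (a *\<^sub>R p \<tau> + b *\<^sub>R q \<tau>)"
      using N_triangle[of "a *\<^sub>R p \<tau>" "b *\<^sub>R q \<tau>"] N_scale by auto
  qed
  have "((\<lambda>\<tau>. \<bar>a\<bar> * N (p \<tau>) + \<bar>b\<bar> * N (q \<tau>)) \<longlongrightarrow> 0) (at t within I)"
    using dX dY unfolding has_deriv_def p_def q_def by (auto intro!: tendsto_eq_intros)
  then show "((\<lambda>\<tau>. N (((a *\<^sub>R X + b *\<^sub>R Y) \<tau> - (a *\<^sub>R X + b *\<^sub>R Y) t) /\<^sub>R (\<tau> - t) - (a *\<^sub>R v + b *\<^sub>R w))) \<longlongrightarrow> 0) (at t within I)"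
    unfolding eq
    by (rule Lim_null_comparison[rotated]) (use le in \<open>auto simp: eventually_at_filter\<close>)
qed


text \<open>
  By bisection it suffices to treat short intervals around each time \<open>t\<close>.  If \<open>t\<close> lies outside \<open>A\<close>,
  the increment is nearly the length times the derivative at \<open>t\<close>; if it lies in \<open>A\<close>, the whole
  interval is put into the list, with \<open>c = 0\<close>.  When adjacent intervals are joined, the vectors \<open>c\<close> are
  averaged with the lengths as weights, which keeps them in \<open>D\<close>.
\<close>

lemma mean_value:
  assumes ab: "a \<le> b" and X: "\<And>t. t \<in> {a..b} \<Longrightarrow> X t \<in> V"
    and D: "convex D" "D \<subseteq> V" "0 \<in> D" and A: "open A"
    and der: "\<And>t. t \<in> {a..b} - A \<Longrightarrow> \<exists>v\<in>D. has_deriv {a..b} X v t"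
    and \<epsilon>: "\<epsilon> > 0"
  shows "\<exists>c\<in>D. \<exists>ps. intervals_in (A \<inter> {a..b}) ps \<and>
    N (X b - X a - (b - a) *\<^sub>R c) \<le> \<epsilon> * (b - a) + (\<Sum>(p, q)\<leftarrow>ps. N (X q - X p))"
proof -
  define P where "P p q \<longleftrightarrow> (a \<le> p \<and> p \<le> q \<and> q \<le> b \<longrightarrow> (\<exists>c\<in>D. \<exists>ps. intervals_in (A \<inter> {p..q}) ps \<and>
    N (X q - X p - (q - p) *\<^sub>R c) \<le> \<epsilon> * (q - p) + (\<Sum>(p, q)\<leftarrow>ps. N (X q - X p))))" for p q
  have "P a b"
    using ab
  proof (induction a b rule: Bolzano)
    case (trans p q r)
    show ?case
      unfolding P_def
    proof (intro impI, elim conjE)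
      assume pr: "a \<le> p" "p \<le> r" "r \<le> b"
      obtain c ps where c: "c \<in> D" "intervals_in (A \<inter> {p..q}) ps"
        "N (X q - X p - (q - p) *\<^sub>R c) \<le> \<epsilon> * (q - p) + (\<Sum>(p, q)\<leftarrow>ps. N (X q - X p))"
        using trans pr unfolding P_def by (meson order_trans)
      obtain e qs where e: "e \<in> D" "intervals_in (A \<inter> {q..r}) qs"
        "N (X r - X q - (r - q) *\<^sub>R e) \<le> \<epsilon> * (r - q) + (\<Sum>(p, q)\<leftarrow>qs. N (X q - X p))"
        using trans pr unfolding P_def by (meson order_trans)
      define g where "g = ((q - p) / (r - p)) *\<^sub>R c + ((r - q) / (r - p)) *\<^sub>R e"
      have g: "(r - p) *\<^sub>R g = (q - p) *\<^sub>R c + (r - q) *\<^sub>R e"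
        using trans(3,4) by (cases "r = p") (auto simp: g_def scaleR_add_right)
      have "g \<in> D"
      proof (cases "r = p")
        case True then show ?thesis using D by (simp add: g_def)
      next
        case False
        then show ?thesis unfolding g_def using trans(3,4) c(1) e(1) D(1)
          by (intro convexD) (simp_all add: add_divide_distrib[symmetric])
      qed
      moreover have "intervals_in (A \<inter> {p..r}) (ps @ qs)"
        using intervals_in_append c(2) e(2) trans by blast
      moreover have "N (X r - X p - (r - p) *\<^sub>R g) \<le> \<epsilon> * (r - p) + (\<Sum>(p, q)\<leftarrow>ps @ qs. N (X q - X p))"
      proof -
        have "X r - X p - (r - p) *\<^sub>R g = (X r - X q - (r - q) *\<^sub>R e) + (X q - X p - (q - p) *\<^sub>R c)"
          unfolding g by simp
        moreover have "X r - X q - (r - q) *\<^sub>R e \<in> V" "X q - X p - (q - p) *\<^sub>R c \<in> V"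
          using c(1) e(1) D X pr trans(3,4) by (auto intro!: V_diff V_scale)
        ultimately have "N (X r - X p - (r - p) *\<^sub>R g) \<le>
            N (X r - X q - (r - q) *\<^sub>R e) + N (X q - X p - (q - p) *\<^sub>R c)"
          using N_triangle by metis
        moreover have "\<epsilon> * (r - q) + \<epsilon> * (q - p) = \<epsilon> * (r - p)" by (simp add: algebra_simps)
        ultimately show ?thesis using c(3) e(3) by simp
      qed
      ultimately show "\<exists>c\<in>D. \<exists>ps. intervals_in (A \<inter> {p..r}) ps \<and>
        N (X r - X p - (r - p) *\<^sub>R c) \<le> \<epsilon> * (r - p) + (\<Sum>(p, q)\<leftarrow>ps. N (X q - X p))"
        by blast
    qed
  next
    case (local t)
    show ?case
    proof (cases "t \<in> A")
      case True
      then obtain d where d: "d > 0" "ball t d \<subseteq> A" using A openE by blast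
      have "P p q" if "p \<le> t \<and> t \<le> q \<and> q - p < d" for p q
        unfolding P_def
      proof (intro impI bexI[of _ 0] exI[of _ "[(p, q)]"] conjI, elim conjE)
        assume "a \<le> p" "p \<le> q" "q \<le> b"
        then show "intervals_in (A \<inter> {p..q}) [(p, q)]"
          using that d by (auto simp: intervals_in_def subset_iff dist_real_def)
      qed (use D \<epsilon> in auto)
      then show ?thesis using d by blast
    next
      case False
      then obtain v where v: "v \<in> D" "has_deriv {a..b} X v t" using der local by auto
      then have vV: "v \<in> V" using D by blast
      obtain d where d: "d > 0" "\<And>\<tau>. \<tau> \<in> {a..b} \<Longrightarrow> \<bar>\<tau> - t\<bar> < d \<Longrightarrow>
          N (X \<tau> - X t - (\<tau> - t) *\<^sub>R v) \<le> \<epsilon> * \<bar>\<tau> - t\<bar>"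
        using v(2) \<epsilon> has_deriv_iff[of "{a..b}" X t v] X local by auto
      have "P p q" if pq: "p \<le> t \<and> t \<le> q \<and> q - p < d" for p q
        unfolding P_def
      proof (intro impI bexI[of _ v] exI[of _ "[]"] conjI)
        assume ap: "a \<le> p \<and> p \<le> q \<and> q \<le> b"
        have XV: "X p \<in> V" "X q \<in> V" "X t \<in> V" using X ap pq local by auto
        have "X q - X p - (q - p) *\<^sub>R v = (X q - X t - (q - t) *\<^sub>R v) - (X p - X t - (p - t) *\<^sub>R v)"
          by (simp add: algebra_simps)
        also have "N \<dots> \<le> N (X q - X t - (q - t) *\<^sub>R v) + N (X p - X t - (p - t) *\<^sub>R v)"
          using XV vV by (intro N_diff_le) auto
        also have "\<dots> \<le> \<epsilon> * \<bar>q - t\<bar> + \<epsilon> * \<bar>p - t\<bar>"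
          using ap pq by (intro add_mono d) auto
        also have "\<dots> = \<epsilon> * (q - p)" using pq by (simp add: algebra_simps)
        finally show "N (X q - X p - (q - p) *\<^sub>R v) \<le> \<epsilon> * (q - p) + (\<Sum>(p, q)\<leftarrow>[]. N (X q - X p))"
          by simp
      qed (use v in auto)
      then show ?thesis using d by blast
    qed
  qed
  then show ?thesis using ab by (auto simp: P_def)
qed

text \<open>
  Absolute continuity with the families of intervals given as ordered lists.
\<close>

definition abs_cont :: "real set \<Rightarrow> (real \<Rightarrow> 'v) \<Rightarrow> bool" where
  "abs_cont I X \<longleftrightarrow> (\<forall>\<epsilon>>0. \<exists>\<delta>>0. \<forall>ps. intervals_in I ps \<longrightarrow>
     (\<Sum>(p, q)\<leftarrow>ps. q - p) < \<delta> \<longrightarrow> (\<Sum>(p, q)\<leftarrow>ps. N (X q - X p)) < \<epsilon>)"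

lemma convex_N_ball: "convex {v \<in> V. N v \<le> L}"
proof (rule convexI)
  fix x y :: 'v and u v :: real
  assume *: "x \<in> {v \<in> V. N v \<le> L}" "y \<in> {v \<in> V. N v \<le> L}" "0 \<le> u" "0 \<le> v" "u + v = 1"
  have "N (u *\<^sub>R x + v *\<^sub>R y) \<le> u * N x + v * N y"
    using N_triangle[of "u *\<^sub>R x" "v *\<^sub>R y"] * N_scale by auto
  also have "\<dots> \<le> u * L + v * L" using * by (intro add_mono mult_left_mono) auto
  also have "\<dots> = L" using * by (metis distrib_right mult_1)
  finally show "u *\<^sub>R x + v *\<^sub>R y \<in> {v \<in> V. N v \<le> L}" using * by auto
qed

text \<open>
  The times without a derivative of size at most \<open>L\<close> are covered by an open set so small that, by
  absolute continuity, the increments over intervals inside it are negligible.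
\<close>

lemma speed_bound:
  assumes ab: "a \<le> b" and X: "\<And>t. t \<in> {a..b} \<Longrightarrow> X t \<in> V"
    and ac: "abs_cont {a..b} X" and L: "0 \<le> L"
    and der: "AE t in lebesgue_on {a..b}. \<exists>v. has_deriv {a..b} X v t \<and> N v \<le> L"
  shows "N (X b - X a) \<le> L * (b - a)"
proof (rule field_le_epsilon)
  fix e :: real assume e: "e > 0"
  define \<epsilon> where "\<epsilon> = e / (2 * (b - a + 1))"
  have \<epsilon>: "\<epsilon> > 0" "\<epsilon> * (b - a) \<le> e / 2"
    using e ab by (auto simp: \<epsilon>_def field_simps)
  obtain \<delta> where \<delta>: "\<delta> > 0" "\<And>ps. intervals_in {a..b} ps \<Longrightarrow> (\<Sum>(p, q)\<leftarrow>ps. q - p) < \<delta> \<Longrightarrow>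
      (\<Sum>(p, q)\<leftarrow>ps. N (X q - X p)) < e / 2"
    using ac e unfolding abs_cont_def by (metis half_gt_zero)
  obtain A where A: "open A" "A \<in> lmeasurable" "measure lebesgue A < \<delta>"
    "\<And>t. t \<in> {a..b} - A \<Longrightarrow> \<exists>v. has_deriv {a..b} X v t \<and> N v \<le> L"
    using open_cover_null[OF der \<delta>(1)] by blast
  obtain c ps where c: "c \<in> {v \<in> V. N v \<le> L}" "intervals_in (A \<inter> {a..b}) ps"
    "N (X b - X a - (b - a) *\<^sub>R c) \<le> \<epsilon> * (b - a) + (\<Sum>(p, q)\<leftarrow>ps. N (X q - X p))"
  proof -
    have D: "{v \<in> V. N v \<le> L} \<subseteq> V" "0 \<in> {v \<in> V. N v \<le> L}" using L by auto
    have der: "\<exists>v\<in>{v \<in> V. N v \<le> L}. has_deriv {a..b} X v t" if "t \<in> {a..b} - A" for t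
      using A(4)[OF that] by (auto simp: has_deriv_def)
    show thesis
      using mean_value[OF ab X convex_N_ball D A(1) der \<epsilon>(1)] that by blast
  qed
  have "(\<Sum>(p, q)\<leftarrow>ps. q - p) \<le> measure lebesgue A"
    using c(2) A(2) intervals_in_length intervals_in_mono by (metis inf_le1)
  then have "(\<Sum>(p, q)\<leftarrow>ps. N (X q - X p)) < e / 2"
    using \<delta>(2) A(3) c(2) intervals_in_mono by (metis inf_le2 order.strict_trans1)
  then have "N (X b - X a - (b - a) *\<^sub>R c) \<le> e" using c(3) \<epsilon>(2) by linarith
  moreover have "N (X b - X a) \<le> N (X b - X a - (b - a) *\<^sub>R c) + N ((b - a) *\<^sub>R c)"
    using c(1) X ab by (intro N_le) auto
  moreover have "N ((b - a) *\<^sub>R c) \<le> L * (b - a)"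
    using c(1) ab by (simp add: N_scale mult.commute mult_right_mono)
  ultimately show "N (X b - X a) \<le> L * (b - a) + e" by linarith
qed

definition lip :: "real \<Rightarrow> real \<Rightarrow> real \<Rightarrow> (real \<Rightarrow> 'v) set" where
  "lip s T L = {y. (\<forall>t\<in>{s..T}. y t \<in> V) \<and> (\<forall>t\<in>{s..T}. \<forall>\<tau>\<in>{s..T}. N (y t - y \<tau>) \<le> L * \<bar>t - \<tau>\<bar>)}"

lemma lip_V: "y \<in> lip s T L \<Longrightarrow> t \<in> {s..T} \<Longrightarrow> y t \<in> V"
  by (simp add: lip_def)

lemma lipD: "y \<in> lip s T L \<Longrightarrow> t \<in> {s..T} \<Longrightarrow> \<tau> \<in> {s..T} \<Longrightarrow> N (y t - y \<tau>) \<le> L * \<bar>t - \<tau>\<bar>"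
  by (simp add: lip_def)

lemma lip_nonneg: "y \<in> lip s T L \<Longrightarrow> s < T \<Longrightarrow> 0 \<le> L"
  using lipD[of y s T L T s] N_nonneg[of "y T - y s"] lip_V[of y s T L T] lip_V[of y s T L s]
    mult_neg_pos[of L "T - s"]
  by (auto simp: not_less[symmetric])

lemma lip_add:
  assumes "y \<in> lip s T L" "z \<in> lip s T M"
  shows "y + z \<in> lip s T (L + M)"
proof -
  have "N ((y + z) t - (y + z) \<tau>) \<le> (L + M) * \<bar>t - \<tau>\<bar>" if "t \<in> {s..T}" "\<tau> \<in> {s..T}" for t \<tau>
  proof -
    have "N ((y t - y \<tau>) + (z t - z \<tau>)) \<le> N (y t - y \<tau>) + N (z t - z \<tau>)"
      using lip_V assms that by (intro N_triangle) blast+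
    then show ?thesis using lipD[OF assms(1) that] lipD[OF assms(2) that] by (simp add: algebra_simps)
  qed
  then show ?thesis using assms by (auto simp: lip_def)
qed

lemma lip_scale:
  assumes "y \<in> lip s T L" shows "r *\<^sub>R y \<in> lip s T (\<bar>r\<bar> * L)"
proof -
  have "N ((r *\<^sub>R y) t - (r *\<^sub>R y) \<tau>) \<le> (\<bar>r\<bar> * L) * \<bar>t - \<tau>\<bar>" if "t \<in> {s..T}" "\<tau> \<in> {s..T}" for t \<tau>
  proof -
    have "(r *\<^sub>R y) t - (r *\<^sub>R y) \<tau> = r *\<^sub>R (y t - y \<tau>)" by (simp add: scaleR_diff_right)
    then show ?thesis using lip_V assms that lipD[OF assms(1) that]
      by (simp add: N_scale mult.assoc mult_left_mono)
  qed
  then show ?thesis using assms by (auto simp: lip_def)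
qed

lemma lip_diff: "y \<in> lip s T L \<Longrightarrow> z \<in> lip s T M \<Longrightarrow> y - z \<in> lip s T (L + M)"
  using lip_add[of y s T L "- 1 *\<^sub>R z" M] lip_scale[of z s T M "-1"] by simp

lemma convex_lip: "convex (lip s T L)"
proof (rule convexI)
  fix y z and u v :: real
  assume *: "y \<in> lip s T L" "z \<in> lip s T L" "0 \<le> u" "0 \<le> v" "u + v = 1"
  have "u *\<^sub>R y + v *\<^sub>R z \<in> lip s T (\<bar>u\<bar> * L + \<bar>v\<bar> * L)"
    using * by (intro lip_add lip_scale)
  moreover have "\<bar>u\<bar> * L + \<bar>v\<bar> * L = L" using * by (metis abs_of_nonneg distrib_right mult_1)
  ultimately show "u *\<^sub>R y + v *\<^sub>R z \<in> lip s T L" by simp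
qed

text \<open>
  An exceptional set of positive measure is tolerated here, at the price of the distance that a
  Lipschitz curve can travel during it.  The factor \<open>2\<close> arises from two open covers of measure below
  \<open>\<eta>\<close>: one of \<open>B\<close>, one of the null set on which the last assumption fails.
\<close>

lemma mean_value_lip:
  assumes ab: "s \<le> a" "a \<le> b" "b \<le> T" "s < T" and X: "X \<in> lip s T L"
    and D: "convex D" "D \<subseteq> V" "0 \<in> D"
    and B: "B \<in> sets lebesgue" "emeasure lebesgue B < ennreal \<eta>" "0 < \<eta>"
    and der: "AE t in lebesgue_on {a..b}. t \<notin> B \<longrightarrow> (\<exists>v\<in>D. has_deriv {a..b} X v t)" and \<epsilon>: "\<epsilon> > 0"
  shows "\<exists>c\<in>D. N (X b - X a - (b - a) *\<^sub>R c) \<le> \<epsilon> * (b - a) + L * (2 * \<eta>)"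
proof -
  obtain A1 where A1: "open A1" "B \<subseteq> A1" "A1 \<in> lmeasurable" "measure lebesgue A1 < \<eta>"
    using open_cover_small[OF B] by blast
  obtain A2 where A2: "open A2" "A2 \<in> lmeasurable" "measure lebesgue A2 < \<eta>"
    "\<And>t. t \<in> {a..b} - A2 \<Longrightarrow> t \<notin> B \<longrightarrow> (\<exists>v\<in>D. has_deriv {a..b} X v t)"
    using open_cover_null[OF der B(3)] by blast
  have XV: "X t \<in> V" if "t \<in> {a..b}" for t using lip_V[OF X] that ab by auto
  obtain c ps where c: "c \<in> D" "intervals_in ((A1 \<union> A2) \<inter> {a..b}) ps"
    "N (X b - X a - (b - a) *\<^sub>R c) \<le> \<epsilon> * (b - a) + (\<Sum>(p, q)\<leftarrow>ps. N (X q - X p))"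
  proof -
    have "\<exists>v\<in>D. has_deriv {a..b} X v t" if "t \<in> {a..b} - (A1 \<union> A2)" for t
      using A2(4)[of t] A1(2) that by blast
    then show thesis
      using mean_value[where X = X, OF ab(2) XV D open_Un[OF A1(1) A2(1)] _ \<epsilon>] that by blast
  qed
  have "(\<Sum>(p, q)\<leftarrow>ps. N (X q - X p)) \<le> (\<Sum>(p, q)\<leftarrow>ps. L * (q - p))"
  proof (rule sum_list_mono)
    fix I assume I: "I \<in> set ps"
    obtain p q where pq: "I = (p, q)" by fastforce
    have "p \<le> q" "{p..q} \<subseteq> {a..b}" using c(2) I by (auto simp: intervals_in_def pq)
    then have "p \<le> q" "p \<in> {s..T}" "q \<in> {s..T}" using ab by auto
    then show "(case I of (p, q) \<Rightarrow> N (X q - X p)) \<le> (case I of (p, q) \<Rightarrow> L * (q - p))"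
      using lipD[OF X, of q p] pq by simp
  qed
  also have "\<dots> = L * (\<Sum>(p, q)\<leftarrow>ps. q - p)"
    by (simp add: sum_list_const_mult[symmetric] case_prod_unfold)
  also have "\<dots> \<le> L * (2 * \<eta>)"
  proof (rule mult_left_mono)
    have "(\<Sum>(p, q)\<leftarrow>ps. q - p) \<le> measure lebesgue (A1 \<union> A2)"
      using intervals_in_length[OF intervals_in_mono[OF c(2)]] A1(3) A2(2) by blast
    also have "\<dots> \<le> measure lebesgue A1 + measure lebesgue A2"
      using A1(3) A2(2) by (intro measure_Un_le) auto
    finally show "(\<Sum>(p, q)\<leftarrow>ps. q - p) \<le> 2 * \<eta>" using A1(4) A2(3) by linarith
    show "0 \<le> L" using lip_nonneg[OF X ab(4)] .
  qed
  finally show ?thesis using c by force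
qed

definition has_net :: "real \<Rightarrow> 'v set \<Rightarrow> bool" where
  "has_net \<rho> A \<longleftrightarrow> (\<exists>F. finite F \<and> F \<subseteq> V \<and> (\<forall>a\<in>A. \<exists>b\<in>F. N (a - b) \<le> \<rho>))"

lemma has_net_subset: "has_net \<rho> A \<Longrightarrow> B \<subseteq> A \<Longrightarrow> has_net \<rho> B"
  unfolding has_net_def by blast

lemma has_net_mono: "has_net \<rho> A \<Longrightarrow> \<rho> \<le> \<rho>' \<Longrightarrow> has_net \<rho>' A"
  unfolding has_net_def by (meson order_trans)

lemma has_net_Un:
  assumes "has_net \<rho> A" "has_net \<rho> B" shows "has_net \<rho> (A \<union> B)"
proof -
  obtain F where F: "finite F" "F \<subseteq> V" "\<forall>a\<in>A. \<exists>b\<in>F. N (a - b) \<le> \<rho>"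
    using assms(1) unfolding has_net_def by blast
  obtain G where G: "finite G" "G \<subseteq> V" "\<forall>a\<in>B. \<exists>b\<in>G. N (a - b) \<le> \<rho>"
    using assms(2) unfolding has_net_def by blast
  have "\<exists>b\<in>F \<union> G. N (a - b) \<le> \<rho>" if "a \<in> A \<union> B" for a
    using that F(3) G(3) by blast
  then show ?thesis unfolding has_net_def using F(1,2) G(1,2) by (intro exI[of _ "F \<union> G"]) simp
qed

lemma convex_fatten:
  assumes C: "convex C" "C \<subseteq> V"
  shows "convex {v \<in> V. \<exists>c\<in>C. N (v - c) \<le> \<kappa>}"
proof (rule convexI)
  fix x y :: 'v and u v :: real
  assume *: "x \<in> {v \<in> V. \<exists>c\<in>C. N (v - c) \<le> \<kappa>}" "y \<in> {v \<in> V. \<exists>c\<in>C. N (v - c) \<le> \<kappa>}"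
    "0 \<le> u" "0 \<le> v" "u + v = 1"
  then obtain c d where cd: "c \<in> C" "N (x - c) \<le> \<kappa>" "d \<in> C" "N (y - d) \<le> \<kappa>" "x \<in> V" "y \<in> V"
    by blast
  have "x - c \<in> {v \<in> V. N v \<le> \<kappa>}" "y - d \<in> {v \<in> V. N v \<le> \<kappa>}" using cd C by auto
  then have "u *\<^sub>R (x - c) + v *\<^sub>R (y - d) \<in> {v \<in> V. N v \<le> \<kappa>}"
    using convexD[OF convex_N_ball _ _ *(3-5)] by blast
  moreover have "u *\<^sub>R (x - c) + v *\<^sub>R (y - d) = (u *\<^sub>R x + v *\<^sub>R y) - (u *\<^sub>R c + v *\<^sub>R d)"
    by (simp add: algebra_simps)
  moreover have "u *\<^sub>R c + v *\<^sub>R d \<in> C" using convexD[OF C(1) cd(1,3) *(3-5)] .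
  ultimately show "u *\<^sub>R x + v *\<^sub>R y \<in> {v \<in> V. \<exists>c\<in>C. N (v - c) \<le> \<kappa>}"
    using cd(5,6) by auto
qed

section \<open>Almost everywhere derivatives of limit curves\<close>

text \<open>
  If \<open>y\<close> moves faster than \<open>\<kappa>\<close> between \<open>t\<close> and some other time, then \<open>t\<close> lies in an interval whose
  increment exceeds \<open>\<kappa>\<close> times its length.  Vitali's lemma selects disjoint ones among these intervals
  whose fivefold enlargements still cover all such \<open>t\<close>; the total length of the selected
  intervals is at most \<open>M / \<kappa>\<close>.
\<close>

lemma maximal_estimate:
  assumes \<kappa>: "0 < \<kappa>" and M: "0 \<le> M"
    and y: "\<And>t. t \<in> {s..T} \<Longrightarrow> y t \<in> V"
    and var: "\<And>F. finite F \<Longrightarrow> (\<And>p q. (p, q) \<in> F \<Longrightarrow> s \<le> p \<and> p < q \<and> q \<le> T) \<Longrightarrow>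
      pairwise (\<lambda>I J. disjnt {fst I..snd I} {fst J..snd J}) F \<Longrightarrow> (\<Sum>(p, q)\<in>F. N (y q - y p)) \<le> M"
  obtains B :: "real set" where "B \<in> sets borel" "emeasure lborel B \<le> ennreal (5 * M / \<kappa>)"
    "\<And>t \<tau>. t \<in> {s..T} - B \<Longrightarrow> \<tau> \<in> {s..T} \<Longrightarrow> N (y \<tau> - y t) \<le> \<kappa> * \<bar>\<tau> - t\<bar>"
proof -
  define K where "K = {(p, q). s \<le> p \<and> p < q \<and> q \<le> T \<and> N (y q - y p) > \<kappa> * (q - p)}"
  define a where "a = (\<lambda>(p, q). (p + q) / 2 :: real)"
  define r where "r = (\<lambda>(p, q). (q - p) / 2 :: real)"
  have cb: "cball (a (p, q)) (r (p, q)) = {p..q}" for p q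
    by (auto simp: a_def r_def cball_eq_atLeastAtMost field_simps)
  have rK: "0 < r i \<and> r i \<le> (T - s) / 2" if "i \<in> K" for i
    using that by (auto simp: K_def r_def)
  obtain C where C: "countable C" "C \<subseteq> K"
    "pairwise (\<lambda>i j. disjnt (cball (a i) (r i)) (cball (a j) (r j))) C"
    "(\<Union>i\<in>K. cball (a i) (r i)) \<subseteq> (\<Union>i\<in>C. cball (a i) (5 * r i))"
    by (rule Vitali_covering_lemma_cballs[where S = "\<Union>i\<in>K. cball (a i) (r i)" and K = K and a = a
          and r = r and B = "(T - s) / 2"])
      (use rK in simp_all)
  define B where "B = (\<Union>i\<in>C. cball (a i) (5 * r i))"
  have fin: "emeasure lborel (\<Union>i\<in>F. cball (a i) (5 * r i)) \<le> ennreal (5 * M / \<kappa>)"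
    if F: "finite F" "F \<subseteq> C" for F
  proof -
    have FK: "(p, q) \<in> F \<Longrightarrow> s \<le> p \<and> p < q \<and> q \<le> T \<and> \<kappa> * (q - p) < N (y q - y p)" for p q
      using F C(2) by (auto simp: K_def)
    have dj: "pairwise (\<lambda>I J. disjnt {fst I..snd I} {fst J..snd J}) F"
    proof -
      have "cball (a I) (r I) = {fst I..snd I}" for I using cb[of "fst I" "snd I"] by simp
      then show ?thesis using pairwise_subset[OF C(3) F(2)] by simp
    qed
    have "(\<Sum>(p, q)\<in>F. \<kappa> * (q - p)) \<le> (\<Sum>(p, q)\<in>F. N (y q - y p))"
      using FK by (intro sum_mono) fastforce
    also have "\<dots> \<le> M" by (rule var[OF F(1) _ dj]) (use FK in blast)
    finally have "\<kappa> * (\<Sum>(p, q)\<in>F. q - p) \<le> M" by (simp add: sum_distrib_left case_prod_unfold)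
    then have *: "(\<Sum>(p, q)\<in>F. q - p) \<le> M / \<kappa>" using \<kappa> by (simp add: field_simps)
    have "emeasure lborel (\<Union>i\<in>F. cball (a i) (5 * r i)) \<le> (\<Sum>i\<in>F. emeasure lborel (cball (a i) (5 * r i)))"
      by (intro emeasure_subadditive_finite F) auto
    also have "\<dots> = (\<Sum>i\<in>F. ennreal (5 * (snd i - fst i)))"
      using FK by (intro sum.cong refl) (fastforce simp: a_def r_def cball_eq_atLeastAtMost field_simps intro!: arg_cong[where f=ennreal])
    also have "\<dots> = ennreal (\<Sum>i\<in>F. 5 * (snd i - fst i))"
      using FK by (intro sum_ennreal) fastforce
    also have "\<dots> \<le> ennreal (5 * M / \<kappa>)"
      unfolding sum_distrib_left[symmetric]
      using * by (intro ennreal_leI) (simp add: case_prod_unfold)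
    finally show ?thesis .
  qed
  have "emeasure lborel B \<le> ennreal (5 * M / \<kappa>)"
  proof (cases "C = {}")
    case False
    define G where "G n = (\<Union>i\<in>from_nat_into C ` {..<n}. cball (a i) (5 * r i))" for n :: nat
    have "B = (\<Union>n. G n)"
    proof -
      have "C = (\<Union>n. from_nat_into C ` {..<n})"
        using range_from_nat_into[OF False C(1)] by (metis UN_lessThan_UNIV image_UN)
      then show ?thesis
        unfolding B_def G_def by blast
    qed
    moreover have "incseq G" unfolding incseq_def G_def by (intro allI impI UN_mono image_mono) auto
    moreover have "range G \<subseteq> sets lborel" by (auto simp: G_def)
    ultimately have "emeasure lborel B = (SUP n. emeasure lborel (G n))"
      by (simp add: SUP_emeasure_incseq)
    also have "\<dots> \<le> ennreal (5 * M / \<kappa>)"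
      unfolding G_def by (intro SUP_least fin) (use from_nat_into[OF False] in auto)
    finally show ?thesis .
  qed (simp add: B_def)
  moreover have "B \<in> sets borel"
    unfolding B_def using C(1) by (intro sets.countable_UN'') auto
  moreover have "N (y \<tau> - y t) \<le> \<kappa> * \<bar>\<tau> - t\<bar>" if t: "t \<in> {s..T} - B" and \<tau>: "\<tau> \<in> {s..T}" for t \<tau>
  proof (rule ccontr)
    assume n: "\<not> ?thesis"
    define p q where "p = min t \<tau>" and "q = max t \<tau>"
    have pq: "N (y q - y p) = N (y \<tau> - y t)" "q - p = \<bar>\<tau> - t\<bar>"
      using N_commute y t \<tau> by (auto simp: p_def q_def min_def max_def)
    have "t \<noteq> \<tau>" using n by auto
    then have "(p, q) \<in> K" using n t \<tau> pq by (auto simp: K_def) (auto simp: p_def q_def)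
    moreover have "t \<in> {p..q}" by (simp add: p_def q_def)
    ultimately have "t \<in> B" using C(4) cb unfolding B_def by blast
    then show False using t by simp
  qed
  ultimately show thesis using that by blast
qed

text \<open>
  The Dirichlet energy, that is, the integral of the squared speed, of the piecewise affine interpolation
  of \<open>y\<close> on the dyadic grid of level \<open>n\<close>.
\<close>

definition energy :: "real \<Rightarrow> real \<Rightarrow> nat \<Rightarrow> (real \<Rightarrow> 'v) \<Rightarrow> real" where
  "energy s T n y = (\<Sum>i<2 ^ n. (N (y (grid s T n (Suc i)) - y (grid s T n i)))\<^sup>2) * (2 ^ n / (T - s))"

definition energy_lim :: "real \<Rightarrow> real \<Rightarrow> (real \<Rightarrow> 'v) \<Rightarrow> real" where
  "energy_lim s T y = lim (\<lambda>n. energy s T n y)"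

text \<open>
  When a cell is halved, its increment is a sum \<open>a + b\<close>, and \<open>N (a + b)\<^sup>2 \<le> 2 N(a)\<^sup>2 + 2 N(b)\<^sup>2\<close>
  by the parallelogram law; the factor \<open>2\<close> is absorbed by the halved mesh.
\<close>

lemma energy_mono:
  assumes sT: "s < T" and y: "\<And>t. t \<in> {s..T} \<Longrightarrow> y t \<in> V"
  shows "energy s T n y \<le> energy s T (Suc n) y"
proof -
  define g where "g i = (N (y (grid s T (Suc n) (Suc i)) - y (grid s T (Suc n) i)))\<^sup>2" for i
  have gr: "grid s T (Suc n) (2 * i) = grid s T n i" for i
    by (simp add: grid_def)
  have le: "(N (y (grid s T n (Suc i)) - y (grid s T n i)))\<^sup>2 \<le> 2 * (g (2 * i) + g (Suc (2 * i)))"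
    if i: "i < 2 ^ n" for i
  proof -
    define a where "a = y (grid s T (Suc n) (Suc (2 * i))) - y (grid s T (Suc n) (2 * i))"
    define b where "b = y (grid s T (Suc n) (Suc (Suc (2 * i)))) - y (grid s T (Suc n) (Suc (2 * i)))"
    have V: "a \<in> V" "b \<in> V"
      unfolding a_def b_def using i sT by (auto intro!: V_diff y grid_in simp del: atLeastAtMost_iff)
    have "y (grid s T n (Suc i)) - y (grid s T n i) = a + b"
      using gr[of i] gr[of "Suc i"] by (simp add: a_def b_def)
    moreover have "(N (a + b))\<^sup>2 \<le> 2 * (N a)\<^sup>2 + 2 * (N b)\<^sup>2"
      using N_parallelogram[OF V] zero_le_power2[of "N (a - b)"] by linarith
    ultimately show ?thesis by (simp add: g_def a_def b_def)
  qed
  have "(\<Sum>i<2 ^ Suc n. g i) = (\<Sum>i<2 ^ n. g (2 * i) + g (Suc (2 * i)))"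
    using sum.nat_group[of g 2 "2 ^ n"] by (simp add: mult.commute numeral_2_eq_2)
  then have "(\<Sum>i<2 ^ n. (N (y (grid s T n (Suc i)) - y (grid s T n i)))\<^sup>2) \<le> 2 * (\<Sum>i<2 ^ Suc n. g i)"
    using le by (auto simp: sum_distrib_left intro!: sum_mono)
  then have "(\<Sum>i<2 ^ n. (N (y (grid s T n (Suc i)) - y (grid s T n i)))\<^sup>2) * (2 ^ n / (T - s))
      \<le> (2 * (\<Sum>i<2 ^ Suc n. g i)) * (2 ^ n / (T - s))"
    using sT by (intro mult_right_mono) auto
  also have "\<dots> = (\<Sum>i<2 ^ Suc n. g i) * (2 ^ Suc n / (T - s))"
    by (simp add: algebra_simps)
  finally show ?thesis unfolding energy_def g_def .
qed

lemma energy_le: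
  assumes sT: "s < T" and y: "y \<in> lip s T L"
  shows "energy s T n y \<le> L\<^sup>2 * (T - s)"
proof -
  have "(\<Sum>i<2 ^ n. (N (y (grid s T n (Suc i)) - y (grid s T n i)))\<^sup>2) \<le> (\<Sum>i<(2::nat) ^ n. (L * ((T - s) / 2 ^ n))\<^sup>2)"
  proof (intro sum_mono power_mono)
    fix i :: nat assume "i \<in> {..<2 ^ n}"
    then have g: "grid s T n (Suc i) \<in> {s..T}" "grid s T n i \<in> {s..T}"
      using sT by (auto intro!: grid_in simp del: atLeastAtMost_iff)
    show "N (y (grid s T n (Suc i)) - y (grid s T n i)) \<le> L * ((T - s) / 2 ^ n)"
      using lipD[OF y g] sT by (simp add: grid_Suc)
    show "0 \<le> N (y (grid s T n (Suc i)) - y (grid s T n i))"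
      using lip_V[OF y] g by auto
  qed
  then have "energy s T n y \<le> (\<Sum>i<(2::nat) ^ n. (L * ((T - s) / 2 ^ n))\<^sup>2) * (2 ^ n / (T - s))"
    unfolding energy_def using sT by (intro mult_right_mono) auto
  also have "\<dots> = L\<^sup>2 * (T - s)" using sT by (simp add: field_simps power2_eq_square)
  finally show ?thesis .
qed

lemma energy_nonneg: "s < T \<Longrightarrow> 0 \<le> energy s T n y"
  unfolding energy_def by (intro mult_nonneg_nonneg sum_nonneg) auto

lemma lip_grid_diff:
  assumes "s < T" "y \<in> lip s T L" "i < 2 ^ n"
  shows "y (grid s T n (Suc i)) - y (grid s T n i) \<in> V"
  using assms by (intro V_diff lip_V[OF assms(2)] grid_in) auto

lemma energy_lim:
  assumes sT: "s < T" and y: "y \<in> lip s T L"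
  shows "(\<lambda>n. energy s T n y) \<longlonglongrightarrow> energy_lim s T y" "energy s T n y \<le> energy_lim s T y"
    "0 \<le> energy_lim s T y" "energy_lim s T y \<le> L\<^sup>2 * (T - s)"
proof -
  have inc: "incseq (\<lambda>n. energy s T n y)"
    using energy_mono[OF sT] lip_V[OF y] by (intro incseq_SucI) blast
  show *: "(\<lambda>n. energy s T n y) \<longlonglongrightarrow> energy_lim s T y"
    unfolding energy_lim_def using energy_le[OF sT y]
    by (metis convergent_LIMSEQ_iff incseq_convergent inc limI)
  show le: "energy s T n y \<le> energy_lim s T y" for n
    using incseq_le[OF inc *] by simp
  show "0 \<le> energy_lim s T y" using le energy_nonneg[OF sT] order_trans by blast
  show "energy_lim s T y \<le> L\<^sup>2 * (T - s)" by (rule LIMSEQ_le_const2[OF *]) (use energy_le[OF sT y] in blast)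
qed

lemma energy_parallelogram:
  assumes sT: "s < T" and y: "y \<in> lip s T L" and z: "z \<in> lip s T M"
  shows "energy s T n (y + z) + energy s T n (y - z) = 2 * energy s T n y + 2 * energy s T n z"
proof -
  define d where "d y i = y (grid s T n (Suc i)) - y (grid s T n i)" for y :: "real \<Rightarrow> 'v" and i
  have d: "d (y + z) i = d y i + d z i" "d (y - z) i = d y i - d z i" for i
    by (simp_all add: d_def)
  have V: "d y i \<in> V" "d z i \<in> V" if "i < 2 ^ n" for i
    using that lip_grid_diff[OF sT] y z unfolding d_def by auto
  have "(\<Sum>i<2 ^ n. (N (d (y + z) i))\<^sup>2) + (\<Sum>i<2 ^ n. (N (d (y - z) i))\<^sup>2) =
      2 * (\<Sum>i<2 ^ n. (N (d y i))\<^sup>2) + 2 * (\<Sum>i<2 ^ n. (N (d z i))\<^sup>2)"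
    unfolding d using N_parallelogram V
    by (simp add: sum.distrib[symmetric] sum_distrib_left)
  then show ?thesis
    unfolding energy_def d_def[symmetric] mult.assoc[symmetric] distrib_right[symmetric] by simp
qed

lemma energy_scale:
  assumes sT: "s < T" and y: "y \<in> lip s T L"
  shows "energy s T n (r *\<^sub>R y) = r\<^sup>2 * energy s T n y"
proof -
  have "(N ((r *\<^sub>R y) (grid s T n (Suc i)) - (r *\<^sub>R y) (grid s T n i)))\<^sup>2 =
      r\<^sup>2 * (N (y (grid s T n (Suc i)) - y (grid s T n i)))\<^sup>2" if "i < 2 ^ n" for i
  proof -
    have "y (grid s T n (Suc i)) - y (grid s T n i) \<in> V"
      using lip_grid_diff[OF sT y that] .
    then show ?thesis by (simp add: scaleR_diff_right[symmetric] N_scale power_mult_distrib)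
  qed
  then show ?thesis by (simp add: energy_def sum_distrib_left mult.assoc)
qed

lemma energy_lim_parallelogram:
  assumes sT: "s < T" and y: "y \<in> lip s T L" and z: "z \<in> lip s T M"
  shows "energy_lim s T (y + z) + energy_lim s T (y - z) = 2 * energy_lim s T y + 2 * energy_lim s T z"
proof (rule LIMSEQ_unique)
  show "(\<lambda>n. energy s T n (y + z) + energy s T n (y - z)) \<longlonglongrightarrow> energy_lim s T (y + z) + energy_lim s T (y - z)"
    using energy_lim(1)[OF sT] lip_add[OF y z] lip_diff[OF y z] by (intro tendsto_add) blast+
  show "(\<lambda>n. energy s T n (y + z) + energy s T n (y - z)) \<longlonglongrightarrow> 2 * energy_lim s T y + 2 * energy_lim s T z"
    unfolding energy_parallelogram[OF sT y z]
    using energy_lim(1)[OF sT y] energy_lim(1)[OF sT z] by (intro tendsto_intros)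
qed

lemma energy_lim_half:
  assumes sT: "s < T" and y: "y \<in> lip s T L"
  shows "energy_lim s T ((1/2) *\<^sub>R y) = energy_lim s T y / 4"
proof (rule LIMSEQ_unique)
  show "(\<lambda>n. energy s T n ((1/2) *\<^sub>R y)) \<longlonglongrightarrow> energy_lim s T ((1/2) *\<^sub>R y)"
    using energy_lim(1)[OF sT lip_scale[OF y]] .
  show "(\<lambda>n. energy s T n ((1/2) *\<^sub>R y)) \<longlonglongrightarrow> energy_lim s T y / 4"
    unfolding energy_scale[OF sT y] using energy_lim(1)[OF sT y]
    by (auto intro!: tendsto_eq_intros simp: power2_eq_square)
qed

lemma N_tendsto:
  assumes "(\<lambda>l. N (a l - b)) \<longlonglongrightarrow> 0" "\<And>l. a l \<in> V" "b \<in> V"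
  shows "(\<lambda>l. N (a l)) \<longlonglongrightarrow> N b"
proof (rule Lim_transform_bound[where g = "\<lambda>l. N (a l - b)", THEN LIM_zero_cancel])
  have "\<bar>N (a l) - N b\<bar> \<le> N (a l - b)" for l
    using N_le[OF assms(2,3), of l] N_le[OF assms(3,2), of l] N_commute[OF assms(2,3), of l] by linarith
  then show "\<forall>\<^sub>F l in sequentially. norm (N (a l) - N b) \<le> norm (N (a l - b))"
    by (intro always_eventually allI) (metis abs_ge_self order_trans real_norm_def)
qed fact

lemma convex_hull_tail_lip: "(\<And>j. x j \<in> lip s T L) \<Longrightarrow> convex hull (x ` {k..}) \<subseteq> lip s T L" for x :: "nat \<Rightarrow> real \<Rightarrow> 'v"
  using convex_lip by (intro hull_minimal) auto

lemma convex_hull_tail_tendsto: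
  fixes x :: "nat \<Rightarrow> real \<Rightarrow> 'v"
  assumes lim: "(\<lambda>j. N (x j t - y)) \<longlonglongrightarrow> 0" and V: "\<And>j. x j t \<in> V" "y \<in> V"
    and z: "\<And>l. z l \<in> convex hull (x ` {l..})"
  shows "(\<lambda>l. N (z l t - y)) \<longlonglongrightarrow> 0"
proof (rule LIMSEQ_I)
  fix e :: real assume e: "e > 0"
  obtain J where J: "\<And>j. j \<ge> J \<Longrightarrow> norm (N (x j t - y) - 0) < e / 2"
    using LIMSEQ_D[OF lim, of "e/2"] e by auto
  define S where "S = {w. w t - y \<in> {v \<in> V. N v \<le> e / 2}}"
  have "convex S"
  proof (rule convexI)
    fix a b :: "real \<Rightarrow> 'v" and u v :: real
    assume *: "a \<in> S" "b \<in> S" "0 \<le> u" "0 \<le> v" "u + v = 1"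
    have "(u *\<^sub>R a + v *\<^sub>R b) t - y = u *\<^sub>R (a t - y) + v *\<^sub>R (b t - y)"
      using *(5) by (simp add: algebra_simps) (metis scaleR_add_left scaleR_one)
    then show "u *\<^sub>R a + v *\<^sub>R b \<in> S"
      using convexD[OF convex_N_ball _ _ *(3-5), of "a t - y" "e / 2" "b t - y"] *(1,2)
      by (simp add: S_def)
  qed
  moreover have "x j \<in> S" if "j \<ge> J" for j using J[OF that] V by (simp add: S_def)
  ultimately have "convex hull (x ` {l..}) \<subseteq> S" if "l \<ge> J" for l
    using that by (intro hull_minimal) auto
  then have "norm (N (z l t - y) - 0) < e" if "l \<ge> J" for l
    using that z[of l] e by (force simp: S_def)
  then show "\<exists>no. \<forall>n\<ge>no. norm (N (z n t - y) - 0) < e" by blast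
qed

text \<open>
  The least energy over the convex hull of the tail \<open>x\<^sub>l, x\<^bsub>l+1\<^esub>, \<dots>\<close> increases with \<open>l\<close> and is bounded, hence
  is nearly constant from some \<open>K\<close> on.  If \<open>z\<^sub>K\<close> and \<open>z\<^sub>l\<close> with \<open>l \<ge> K\<close> nearly attain it, their midpoint
  cannot have much smaller energy, so the parallelogram law makes the energy of \<open>z\<^sub>K - z\<^sub>l\<close> small.
  Letting \<open>l\<close> tend to infinity replaces \<open>z\<^sub>l\<close> by \<open>y\<close> on every grid.
\<close>

lemma convex_combination_small_energy:
  fixes x :: "nat \<Rightarrow> real \<Rightarrow> 'v"
  assumes sT: "s < T" and x: "\<And>j. x j \<in> lip s T L" and y: "y \<in> lip s T L"
    and lim: "\<And>t. t \<in> {s..T} \<Longrightarrow> (\<lambda>j. N (x j t - y t)) \<longlonglongrightarrow> 0" and \<epsilon>: "\<epsilon> > 0"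
  shows "\<exists>z\<in>convex hull (x ` {k..}). \<forall>n. energy s T n (z - y) \<le> \<epsilon>"
proof -
  define C where "C l = convex hull (x ` {l..})" for l
  define m where "m l = Inf (energy_lim s T ` C l)" for l
  define e where "e = \<epsilon> / 6"
  have e: "e > 0" using \<epsilon> by (simp add: e_def)
  have CL: "C l \<subseteq> lip s T L" for l unfolding C_def by (rule convex_hull_tail_lip[OF x])
  have Cne: "x l \<in> C l" for l unfolding C_def by (intro hull_inc) auto
  have Cmono: "C l \<subseteq> C k" if "k \<le> l" for k l unfolding C_def using that by (intro hull_mono) auto
  have bdd: "bdd_below (energy_lim s T ` C l)" for l
    using energy_lim(3)[OF sT] CL by (intro bdd_belowI[of _ 0]) auto
  have inc: "incseq m"
    unfolding incseq_def m_def using Cne Cmono bdd by (fastforce intro!: cInf_superset_mono)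
  have mle: "m l \<le> energy_lim s T z" if "z \<in> C l" for l z
    unfolding m_def using bdd that by (intro cInf_lower) auto
  have "m l \<le> L\<^sup>2 * (T - s)" for l
    using mle[OF Cne] energy_lim(4)[OF sT x] by (meson order_trans)
  then have "convergent m" using incseq_convergent[OF inc] convergentI by metis
  then have "Cauchy m" by (rule convergent_Cauchy)
  then obtain K0 where "\<And>i j. i \<ge> K0 \<Longrightarrow> j \<ge> K0 \<Longrightarrow> dist (m i) (m j) < e"
    unfolding Cauchy_def using e by blast
  then obtain K where K: "K \<ge> k" "\<And>l. l \<ge> K \<Longrightarrow> m l - m K \<le> e"
    by (metis abs_le_D1 dist_real_def less_imp_le max.cobounded1 max.cobounded2 order_trans)
  have "\<exists>z. z \<in> C l \<and> energy_lim s T z \<le> m l + e" for l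
  proof -
    have "Inf (energy_lim s T ` C l) < m l + e" using e by (simp add: m_def)
    then show ?thesis using Cne by (fastforce dest!: cInf_lessD[rotated])
  qed
  then obtain z where z: "\<And>l. z l \<in> C l" "\<And>l. energy_lim s T (z l) \<le> m l + e" by metis
  have zL: "z l \<in> lip s T L" for l using z CL by blast
  have diff: "energy_lim s T (z K - z l) \<le> \<epsilon>" if "l \<ge> K" for l
  proof -
    have "(1/2) *\<^sub>R (z K + z l) \<in> C K"
      using convexD[of "C K" "z K" "z l" "1/2" "1/2"] z(1) Cmono[OF that]
      by (auto simp: C_def scaleR_add_right)
    then have "m K \<le> energy_lim s T (z K + z l) / 4"
      using mle energy_lim_half[OF sT lip_add[OF zL zL]] by metis
    moreover have "a' \<le> 2 * (m K + e) + 2 * (m l + e) - 4 * m K"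
      if "m K \<le> c' / 4" "c' + a' = 2 * p' + 2 * q'" "p' \<le> m K + e" "q' \<le> m l + e" for a' c' p' q'
      using that by (simp add: field_simps)
    ultimately have "energy_lim s T (z K - z l) \<le> 2 * (m K + e) + 2 * (m l + e) - 4 * m K"
      using energy_lim_parallelogram[OF sT zL zL, of K l] z(2)[of K] z(2)[of l] by metis
    also have "\<dots> \<le> \<epsilon>" using K(2)[OF that] by (simp add: e_def)
    finally show ?thesis .
  qed
  have "energy s T n (z K - y) \<le> \<epsilon>" for n
  proof (rule LIMSEQ_le_const2)
    show "\<exists>N. \<forall>l\<ge>N. energy s T n (z K - z l) \<le> \<epsilon>"
      using diff energy_lim(2)[OF sT lip_diff[OF zL zL]] by (meson order_trans)
    have "(\<lambda>l. N ((z K - z l) (grid s T n (Suc i)) - (z K - z l) (grid s T n i)))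
      \<longlonglongrightarrow> N ((z K - y) (grid s T n (Suc i)) - (z K - y) (grid s T n i))" if i: "i < 2 ^ n" for i
    proof -
      define p where "p = grid s T n i"
      define q where "q = grid s T n (Suc i)"
      have pq: "p \<in> {s..T}" "q \<in> {s..T}"
        unfolding p_def q_def using i sT by (auto intro!: grid_in simp del: atLeastAtMost_iff)
      have V: "z l p \<in> V" "z l q \<in> V" "y p \<in> V" "y q \<in> V" for l
        using pq zL y lip_V by blast+
      have lt: "(\<lambda>l. N (z l t - y t)) \<longlonglongrightarrow> 0" if "t \<in> {s..T}" for t
        by (rule convex_hull_tail_tendsto[of x t "y t" z, OF lim[OF that]])
          (use lip_V[OF x that] lip_V[OF y that] z(1) in \<open>auto simp: C_def\<close>)
      show ?thesis
        unfolding p_def[symmetric] q_def[symmetric]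
      proof (rule N_tendsto)
        show "(\<lambda>l. N ((z K - z l) q - (z K - z l) p - ((z K - y) q - (z K - y) p))) \<longlonglongrightarrow> 0"
        proof (rule Lim_null_comparison)
          show "(\<lambda>l. N (z l p - y p) + N (z l q - y q)) \<longlonglongrightarrow> 0"
            using lt[OF pq(1)] lt[OF pq(2)] tendsto_add by fastforce
          have "(z K - z l) q - (z K - z l) p - ((z K - y) q - (z K - y) p) = (z l p - y p) - (z l q - y q)" for l
            by simp
          moreover have "N ((z l p - y p) - (z l q - y q)) \<le> N (z l p - y p) + N (z l q - y q)" for l
            using V by (intro N_diff_le) auto
          ultimately show "\<forall>\<^sub>F l in sequentially. norm (N ((z K - z l) q - (z K - z l) p - ((z K - y) q - (z K - y) p)))
              \<le> N (z l p - y p) + N (z l q - y q)"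
            using V by (intro always_eventually allI) (metis N_nonneg V_diff abs_of_nonneg real_norm_def)
        qed
      qed (use V in auto)
    qed
    then show "(\<lambda>l. energy s T n (z K - z l)) \<longlonglongrightarrow> energy s T n (z K - y)"
      unfolding energy_def by (intro tendsto_intros) auto
  qed
  moreover have "z K \<in> convex hull (x ` {k..})" using z(1) Cmono K(1) unfolding C_def by blast
  ultimately show ?thesis by blast
qed

text \<open>
  The end points of the given intervals are moved to the grid points below them, which changes
  the increments of the Lipschitz curve by \<open>O(2\<^sup>-\<^sup>n)\<close>.  The moved intervals consist of different
  cells, and Cauchy-Schwarz bounds the sum of all cell increments by the energy.
\<close>

lemma variation_le_energy:
  assumes sT: "s < T" and y: "y \<in> lip s T L" and en: "\<And>n. energy s T n y \<le> \<epsilon>"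
    and F: "finite F" "\<And>p q. (p, q) \<in> F \<Longrightarrow> s \<le> p \<and> p < q \<and> q \<le> T"
    and dj: "pairwise (\<lambda>I J. disjnt {fst I..snd I} {fst J..snd J}) F"
  shows "(\<Sum>(p, q)\<in>F. N (y q - y p)) \<le> sqrt ((T - s) * \<epsilon>)"
proof -
  have le: "(\<Sum>(p, q)\<in>F. N (y q - y p)) \<le> sqrt ((T - s) * \<epsilon>) + real (card F) * (2 * L * ((T - s) / 2 ^ n))" for n
  proof -
    define h where "h = (T - s) / 2 ^ n"
    have h: "h > 0" using sT by (simp add: h_def)
    define k where "k = grid_index s T n"
    define d where "d i = N (y (grid s T n (Suc i)) - y (grid s T n i))" for i
    have k_mono: "p \<le> q \<Longrightarrow> k p \<le> k q" and kT: "p \<le> T \<Longrightarrow> k p \<le> 2 ^ n"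
      and kp: "s \<le> p \<Longrightarrow> \<bar>grid s T n (k p) - p\<bar> \<le> h" for p q
      unfolding k_def h_def by (rule grid_index[OF sT]; assumption)+
    have dnn: "0 \<le> d i" if "i < 2 ^ n" for i
      unfolding d_def using that sT by (intro N_nonneg V_diff lip_V[OF y] grid_in) auto
    have one: "N (y q - y p) \<le> 2 * L * h + (\<Sum>i\<in>{k p..<k q}. d i)" if pq: "s \<le> p" "p < q" "q \<le> T" for p q
    proof -
      have g: "grid s T n (k p) \<in> {s..T}" "grid s T n (k q) \<in> {s..T}"
        using pq sT by (auto intro!: grid_in kT simp del: atLeastAtMost_iff)
      have V: "y p \<in> V" "y q \<in> V" "y (grid s T n (k p)) \<in> V" "y (grid s T n (k q)) \<in> V"
        using lip_V[OF y] g pq by auto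
      have L: "0 \<le> L" using lip_nonneg[OF y sT] .
      have "N (y q - y p) \<le> N (y q - y (grid s T n (k q))) + N (y (grid s T n (k q)) - y p)"
        using V by (intro N_tri)
      also have "N (y (grid s T n (k q)) - y p) \<le> N (y (grid s T n (k q)) - y (grid s T n (k p))) + N (y (grid s T n (k p)) - y p)"
        using V by (intro N_tri)
      also have "N (y q - y (grid s T n (k q))) \<le> L * h"
        using lipD[OF y _ g(2), of q] kp[of q] pq L
        by (smt (verit) atLeastAtMost_iff mult_left_mono)
      also have "N (y (grid s T n (k p)) - y p) \<le> L * h"
        using lipD[OF y g(1), of p] kp[of p] pq L
        by (smt (verit) atLeastAtMost_iff mult_left_mono)
      also have "N (y (grid s T n (k q)) - y (grid s T n (k p))) \<le> (\<Sum>i\<in>{k p..<k q}. d i)"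
      proof -
        have "y (grid s T n (k q)) - y (grid s T n (k p)) = (\<Sum>i\<in>{k p..<k q}. y (grid s T n (Suc i)) - y (grid s T n i))"
          using sum_Suc_diff'[OF k_mono, of p q "\<lambda>i. y (grid s T n i)"] pq by simp
        also have "N \<dots> \<le> (\<Sum>i\<in>{k p..<k q}. d i)"
          unfolding d_def
        proof (rule N_sum_le)
          fix i assume "i \<in> {k p..<k q}"
          then have "i < 2 ^ n" using kT[of q] pq by auto
          then show "y (grid s T n (Suc i)) - y (grid s T n i) \<in> V"
            using sT by (intro V_diff lip_V[OF y] grid_in) auto
        qed simp
        finally show ?thesis .
      qed
      finally show ?thesis by linarith
    qed
    have "(\<Sum>(p, q)\<in>F. N (y q - y p)) \<le> (\<Sum>(p, q)\<in>F. 2 * L * h + (\<Sum>i\<in>{k p..<k q}. d i))"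
      using one F(2) by (intro sum_mono) fastforce
    also have "\<dots> = real (card F) * (2 * L * h) + (\<Sum>I\<in>F. \<Sum>i\<in>{k (fst I)..<k (snd I)}. d i)"
      by (simp add: case_prod_unfold sum.distrib)
    also have "(\<Sum>I\<in>F. \<Sum>i\<in>{k (fst I)..<k (snd I)}. d i) = (\<Sum>i\<in>(\<Union>I\<in>F. {k (fst I)..<k (snd I)}). d i)"
    proof (rule sum.UNION_disjoint[symmetric, OF F(1)])
      show "\<forall>I\<in>F. \<forall>J\<in>F. I \<noteq> J \<longrightarrow> {k (fst I)..<k (snd I)} \<inter> {k (fst J)..<k (snd J)} = {}"
      proof (intro ballI impI)
        fix I J assume IJ: "I \<in> F" "J \<in> F" "I \<noteq> J"
        then have "disjnt {fst I..snd I} {fst J..snd J}" "fst I < snd I" "fst J < snd J"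
          using dj F(2) by (auto simp: pairwise_def)
        then have "snd I < fst J \<or> snd J < fst I"
          unfolding disjnt_def by (simp add: not_le)
        then have "k (snd I) \<le> k (fst J) \<or> k (snd J) \<le> k (fst I)" using k_mono by fastforce
        then show "{k (fst I)..<k (snd I)} \<inter> {k (fst J)..<k (snd J)} = {}" by auto
      qed
    qed simp
    also have "\<dots> \<le> (\<Sum>i<2 ^ n. d i)"
    proof (rule sum_mono2)
      show "(\<Union>I\<in>F. {k (fst I)..<k (snd I)}) \<subseteq> {..<2 ^ n}"
        using kT F(2) by (fastforce intro: order.strict_trans2)
    qed (use dnn in auto)
    also have "\<dots> \<le> sqrt ((T - s) * \<epsilon>)"
    proof (rule real_le_rsqrt)
      have "(\<Sum>i<2 ^ n. d i)\<^sup>2 \<le> (\<Sum>i<2 ^ n. (d i)\<^sup>2) * real (card {..<(2::nat) ^ n})"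
        by (rule sum_squared_le_sum_of_squares)
      also have "\<dots> = (T - s) * energy s T n y"
        using sT by (simp add: energy_def d_def)
      also have "\<dots> \<le> (T - s) * \<epsilon>" using en sT by (intro mult_left_mono) auto
      finally show "(\<Sum>i<2 ^ n. d i)\<^sup>2 \<le> (T - s) * \<epsilon>" .
    qed
    finally show ?thesis by (simp add: h_def)
  qed
  have "(\<lambda>n. sqrt ((T - s) * \<epsilon>) + real (card F) * (2 * L * ((T - s) / 2 ^ n))) \<longlonglongrightarrow> sqrt ((T - s) * \<epsilon>) + real (card F) * (2 * L * ((T - s) * 0))"
    unfolding divide_inverse power_inverse[symmetric]
    by (intro tendsto_intros LIMSEQ_power_zero) simp
  then show ?thesis using le by (intro LIMSEQ_le_const) auto
qed

text \<open>
  The energy of \<open>z\<^sub>k - y\<close> can be made geometrically small, hence so is its variation.  The maximal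
  estimate and the Borel-Cantelli lemma convert this into control of all difference quotients at
  almost every time.  At such a time \<open>y\<close> is differentiable as soon as the derivatives of the \<open>z\<^sub>k\<close> exist
  and converge.
\<close>

theorem convex_combinations_approximate:
  fixes x :: "nat \<Rightarrow> real \<Rightarrow> 'v"
  assumes sT: "s < T" and x: "\<And>j. x j \<in> lip s T L" and y: "y \<in> lip s T L"
    and lim: "\<And>t. t \<in> {s..T} \<Longrightarrow> (\<lambda>j. N (x j t - y t)) \<longlonglongrightarrow> 0"
  shows "\<exists>z. (\<forall>k. z k \<in> convex hull (x ` {k..})) \<and>
    (AE t in lebesgue_on {s..T}. \<forall>\<^sub>F k in sequentially. \<forall>\<tau>\<in>{s..T}.
       N ((z k \<tau> - y \<tau>) - (z k t - y t)) \<le> (1/2) ^ k * \<bar>\<tau> - t\<bar>)"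
proof -
  \<comment> \<open>Chosen so that the variation bound \<open>sqrt ((T - s) * \<epsilon> k)\<close> is \<open>(1/4) ^ k\<close>; with speed threshold \<open>(1/2) ^ k\<close> the exceptional sets are then summable.\<close>
  define \<epsilon> where "\<epsilon> k = (1/16) ^ k / (T - s)" for k :: nat
  have "\<epsilon> k > 0" for k using sT by (simp add: \<epsilon>_def)
  then have "\<exists>z. z \<in> convex hull (x ` {k..}) \<and> (\<forall>n. energy s T n (z - y) \<le> \<epsilon> k)" for k
    using convex_combination_small_energy[OF sT x y lim] by (metis (no_types))
  then obtain z where z: "\<And>k. z k \<in> convex hull (x ` {k..})" "\<And>k n. energy s T n (z k - y) \<le> \<epsilon> k"
    by metis
  have zy: "z k - y \<in> lip s T (L + L)" for k
    using z(1) convex_hull_tail_lip[of x s T L] x y by (intro lip_diff) blast+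
  have sq: "sqrt ((T - s) * \<epsilon> k) = (1/4) ^ k" for k
  proof -
    have "(T - s) * \<epsilon> k = ((1/4) ^ k)\<^sup>2"
      using sT by (simp add: \<epsilon>_def power_mult[symmetric] mult.commute[of k]) (simp add: power_mult power2_eq_square)
    then show ?thesis by simp
  qed
  have *: "\<exists>B. B \<in> sets borel \<and> emeasure lborel B \<le> ennreal (5 * (1/2) ^ k) \<and>
      (\<forall>t\<in>{s..T} - B. \<forall>\<tau>\<in>{s..T}. N ((z k - y) \<tau> - (z k - y) t) \<le> (1/2) ^ k * \<bar>\<tau> - t\<bar>)" for k
  proof -
    obtain B where "B \<in> sets borel" "emeasure lborel B \<le> ennreal (5 * (1/4) ^ k / (1/2) ^ k)"
      "\<And>t \<tau>. t \<in> {s..T} - B \<Longrightarrow> \<tau> \<in> {s..T} \<Longrightarrow> N ((z k - y) \<tau> - (z k - y) t) \<le> (1/2) ^ k * \<bar>\<tau> - t\<bar>"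
    proof (rule maximal_estimate[of "(1/2) ^ k" "(1/4) ^ k" s T "z k - y"])
      show "\<And>t. t \<in> {s..T} \<Longrightarrow> (z k - y) t \<in> V" using lip_V[OF zy] .
      show "(\<Sum>(p, q)\<in>F. N ((z k - y) q - (z k - y) p)) \<le> (1/4) ^ k"
        if "finite F" "\<And>p q. (p, q) \<in> F \<Longrightarrow> s \<le> p \<and> p < q \<and> q \<le> T"
          "pairwise (\<lambda>I J. disjnt {fst I..snd I} {fst J..snd J}) F" for F
        using variation_le_energy[OF sT zy z(2) that] unfolding sq .
    qed auto
    moreover have "5 * (1/4::real) ^ k / (1/2) ^ k = 5 * (1/2) ^ k"
      using power_divide[of "1/4::real" "1/2" k] by simp
    ultimately show ?thesis by metis
  qed
  obtain B where B: "\<And>k. B k \<in> sets lborel" "\<And>k. emeasure lborel (B k) \<le> ennreal (5 * (1/2) ^ k)"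
    "\<And>k t \<tau>. t \<in> {s..T} - B k \<Longrightarrow> \<tau> \<in> {s..T} \<Longrightarrow> N ((z k - y) \<tau> - (z k - y) t) \<le> (1/2) ^ k * \<bar>\<tau> - t\<bar>"
  proof -
    have "\<forall>k. \<exists>B. B \<in> sets borel \<and> emeasure lborel B \<le> ennreal (5 * (1/2) ^ k) \<and>
      (\<forall>t\<in>{s..T} - B. \<forall>\<tau>\<in>{s..T}. N ((z k - y) \<tau> - (z k - y) t) \<le> (1/2) ^ k * \<bar>\<tau> - t\<bar>)"
      using * by blast
    then obtain B where "\<forall>k. B k \<in> sets borel \<and> emeasure lborel (B k) \<le> ennreal (5 * (1/2) ^ k) \<and>
      (\<forall>t\<in>{s..T} - B k. \<forall>\<tau>\<in>{s..T}. N ((z k - y) \<tau> - (z k - y) t) \<le> (1/2) ^ k * \<bar>\<tau> - t\<bar>)"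
      by (rule choice[THEN exE])
    then show thesis by (intro that[of B]) simp_all
  qed
  have "AE t in lborel. \<forall>\<^sub>F k in sequentially. t \<in> space lborel - B k"
  proof (rule borel_cantelli_AE1[OF B(1)])
    show f: "emeasure lborel (B k) < \<infinity>" for k
      using B(2)[of k] by (simp add: order.strict_trans1)
    have le: "norm (measure lborel (B k)) \<le> 5 * (1/2) ^ k" for k
      unfolding measure_def using B(2)[of k] by (simp add: enn2real_leI)
    have "summable (\<lambda>k. 5 * (1/2::real) ^ k)"
      by (rule summable_mult) (rule summable_geometric, simp)
    then show "summable (\<lambda>k. measure lborel (B k))"
      by (rule summable_comparison_test') (rule le)
  qed
  then have "AE t in lebesgue. \<forall>\<^sub>F k in sequentially. t \<in> space lborel - B k"
    by (rule AE_completion)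
  then have "AE t in lebesgue_on {s..T}. \<forall>\<^sub>F k in sequentially. \<forall>\<tau>\<in>{s..T}.
      N ((z k \<tau> - y \<tau>) - (z k t - y t)) \<le> (1/2) ^ k * \<bar>\<tau> - t\<bar>"
  proof (subst AE_restrict_space_iff)
    assume "AE t in lebesgue. \<forall>\<^sub>F k in sequentially. t \<in> space lborel - B k"
    then show "AE t in lebesgue. t \<in> {s..T} \<longrightarrow> (\<forall>\<^sub>F k in sequentially. \<forall>\<tau>\<in>{s..T}.
        N ((z k \<tau> - y \<tau>) - (z k t - y t)) \<le> (1/2) ^ k * \<bar>\<tau> - t\<bar>)"
    proof (rule eventually_mono, intro impI)
      fix t assume t: "\<forall>\<^sub>F k in sequentially. t \<in> space lborel - B k" "t \<in> {s..T}"
      show "\<forall>\<^sub>F k in sequentially. \<forall>\<tau>\<in>{s..T}. N ((z k \<tau> - y \<tau>) - (z k t - y t)) \<le> (1/2) ^ k * \<bar>\<tau> - t\<bar>"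
        using t(1) by (rule eventually_mono) (use B(3) t(2) in auto)
    qed
  qed simp
  then show ?thesis using z(1) by blast
qed

end

section \<open>Square-integrable functions\<close>

definition square_integrable :: "'w measure \<Rightarrow> ('w \<Rightarrow> 'b::euclidean_space) set" where
  "square_integrable M = {h \<in> borel_measurable M. integrable M (\<lambda>w. (norm (h w))\<^sup>2)}"

lemma square_integrableD [measurable_dest]: "h \<in> square_integrable M \<Longrightarrow> h \<in> borel_measurable M"
  by (simp add: square_integrable_def)

lemma l2norm_scaleR: "l2norm M (\<lambda>w. r *\<^sub>R h w) = \<bar>r\<bar> * l2norm M h"
  by (simp add: l2norm_def power_mult_distrib real_sqrt_mult)

lemma quadratic_seminorm_L2:
  "quadratic_seminorm (square_integrable M :: ('w \<Rightarrow> 'b::euclidean_space) set) (l2norm M)"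
proof
  show "subspace (square_integrable M :: ('w \<Rightarrow> 'b) set)"
  proof (rule subspaceI)
    show "0 \<in> (square_integrable M :: ('w \<Rightarrow> 'b) set)"
      unfolding zero_fun_def square_integrable_def by simp
  next
    fix h k :: "'w \<Rightarrow> 'b" assume "h \<in> square_integrable M" "k \<in> square_integrable M"
    then show "h + k \<in> square_integrable M"
      unfolding plus_fun_def square_integrable_def by (auto intro: integrable_norm_sq_add(1))
  next
    fix h :: "'w \<Rightarrow> 'b" and r :: real assume "h \<in> square_integrable M"
    then show "r *\<^sub>R h \<in> square_integrable M"
      unfolding scaleR_fun_def square_integrable_def by (auto simp: power_mult_distrib)
  qed
next
  fix h :: "'w \<Rightarrow> 'b" and r :: real
  show "l2norm M (r *\<^sub>R h) = \<bar>r\<bar> * l2norm M h"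
    unfolding scaleR_fun_def by (rule l2norm_scaleR)
next
  fix h k :: "'w \<Rightarrow> 'b" assume *: "h \<in> square_integrable M" "k \<in> square_integrable M"
  then show "l2norm M (h + k) \<le> l2norm M h + l2norm M k"
    unfolding plus_fun_def square_integrable_def by (auto intro: l2norm_triangle)
  have i: "integrable M (\<lambda>w. (norm (h w + k w))\<^sup>2)" "integrable M (\<lambda>w. (norm (h w - k w))\<^sup>2)"
    "integrable M (\<lambda>w. (norm (h w))\<^sup>2)" "integrable M (\<lambda>w. (norm (k w))\<^sup>2)"
    using * by (auto simp: square_integrable_def intro: integrable_norm_sq_add(1) l2norm_diff_eq_0_iff(1))
  have "(LINT w|M. (norm (h w + k w))\<^sup>2) + (LINT w|M. (norm (h w - k w))\<^sup>2) =
      (LINT w|M. (norm (h w + k w))\<^sup>2 + (norm (h w - k w))\<^sup>2)"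
    using i by simp
  also have "\<dots> = (LINT w|M. 2 * (norm (h w))\<^sup>2 + 2 * (norm (k w))\<^sup>2)"
    by (intro Bochner_Integration.integral_cong refl)
      (simp add: power2_norm_eq_inner inner_add inner_diff inner_commute)
  also have "\<dots> = 2 * (LINT w|M. (norm (h w))\<^sup>2) + 2 * (LINT w|M. (norm (k w))\<^sup>2)"
    using i by simp
  finally show "(l2norm M (h + k))\<^sup>2 + (l2norm M (h - k))\<^sup>2 = 2 * (l2norm M h)\<^sup>2 + 2 * (l2norm M k)\<^sup>2"
    by (simp add: l2norm_square)
qed

lemma l2norm_mono:
  assumes "h \<in> borel_measurable M" "integrable M (\<lambda>w. (G w)\<^sup>2)" "AE w in M. norm (h w) \<le> G w"
  shows "h \<in> square_integrable M" "l2norm M h \<le> sqrt (LINT w|M. (G w)\<^sup>2)"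
proof -
  note [measurable] = assms(1)
  have sq: "AE w in M. (norm (h w))\<^sup>2 \<le> (G w)\<^sup>2"
    using assms(3) by eventually_elim (simp add: power_mono)
  have i: "integrable M (\<lambda>w. (norm (h w))\<^sup>2)"
    by (rule Bochner_Integration.integrable_bound[OF assms(2)]) (use sq in auto)
  then show "h \<in> square_integrable M" by (simp add: square_integrable_def)
  show "l2norm M h \<le> sqrt (LINT w|M. (G w)\<^sup>2)"
    unfolding l2norm_def using i assms(2) sq by (intro real_sqrt_le_mono integral_mono_AE)
qed

lemma l2norm_tendsto_0:
  fixes h :: "nat \<Rightarrow> 'w \<Rightarrow> 'b::euclidean_space"
  assumes [measurable]: "\<And>n. h n \<in> borel_measurable M" and G: "integrable M (\<lambda>w. (G w)\<^sup>2)"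
    and bound: "\<And>n. AE w in M. norm (h n w) \<le> G w"
    and lim: "AE w in M. (\<lambda>n. h n w) \<longlonglongrightarrow> 0"
  shows "(\<lambda>n. l2norm M (h n)) \<longlonglongrightarrow> 0"
proof -
  have "(\<lambda>n. LINT w|M. (norm (h n w))\<^sup>2) \<longlonglongrightarrow> (LINT w|M. 0)"
  proof (rule integral_dominated_convergence[OF _ _ G])
    show "AE w in M. (\<lambda>n. (norm (h n w))\<^sup>2) \<longlonglongrightarrow> 0"
      using lim by eventually_elim (auto intro!: tendsto_eq_intros)
    show "AE w in M. norm ((norm (h n w))\<^sup>2) \<le> (G w)\<^sup>2" for n
      using bound[of n] by eventually_elim (simp add: power_mono)
  qed auto
  then show ?thesis unfolding l2norm_def using tendsto_real_sqrt by fastforce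
qed

lemma simple_function_dense_L2:
  fixes h :: "'w \<Rightarrow> 'b::euclidean_space"
  assumes h: "h \<in> square_integrable M" and \<epsilon>: "\<epsilon> > 0"
  shows "\<exists>\<psi>. simple_function M \<psi> \<and> \<psi> \<in> square_integrable M \<and> l2norm M (h - \<psi>) \<le> \<epsilon>"
proof -
  note [measurable] = square_integrableD[OF h]
  have "\<exists>F. (\<forall>i. simple_function M (F i)) \<and> (\<forall>x\<in>space M. (\<lambda>i. F i x) \<longlonglongrightarrow> h x) \<and>
      (\<forall>i. \<forall>x\<in>space M. dist (F i x) 0 \<le> 2 * dist (h x) 0)"
    by (rule borel_measurable_implies_sequence_metric) measurable
  then obtain F where F: "\<And>i. simple_function M (F i)" "\<And>x. x \<in> space M \<Longrightarrow> (\<lambda>i. F i x) \<longlonglongrightarrow> h x"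
    "\<And>i x. x \<in> space M \<Longrightarrow> dist (F i x) 0 \<le> 2 * dist (h x) 0"
    by blast
  have Fm [measurable]: "F i \<in> borel_measurable M" for i
    using F(1) by (rule borel_measurable_simple_function)
  have G: "integrable M (\<lambda>w. (c * norm (h w))\<^sup>2)" for c :: real
    using h by (simp add: square_integrable_def power_mult_distrib)
  have "(\<lambda>n. l2norm M (\<lambda>w. h w - F n w)) \<longlonglongrightarrow> 0"
  proof (rule l2norm_tendsto_0[OF _ G[of 3]])
    have "norm (h w - F n w) \<le> 3 * norm (h w)" if "w \<in> space M" for n w
      using F(3)[OF that, of n] norm_triangle_ineq4[of "h w" "F n w"] by simp
    then show "AE w in M. norm (h w - F n w) \<le> 3 * norm (h w)" for n by simp
    show "AE w in M. (\<lambda>n. h w - F n w) \<longlonglongrightarrow> 0"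
      using F(2) by (auto intro!: AE_I2 tendsto_eq_intros)
  qed simp
  from LIMSEQ_D[OF this \<epsilon>] obtain n where "l2norm M (\<lambda>w. h w - F n w) < \<epsilon>"
    by auto
  then have "l2norm M (h - F n) \<le> \<epsilon>" by (simp add: fun_diff_def)
  moreover have "F n \<in> square_integrable M"
    by (rule l2norm_mono(1)[OF _ G[of 2]]) (use F(3) in auto)
  ultimately show ?thesis using F(1) by blast
qed

text \<open>
  The Riesz-Fischer theorem.  On a finite measure space an \<open>L\<^sup>2\<close> Cauchy sequence is Cauchy in \<open>L\<^sup>1\<close>, so a
  subsequence converges almost everywhere; Fatou's lemma shows that its limit is also the limit
  in \<open>L\<^sup>2\<close>.
\<close>

lemma (in finite_measure) L2_mcomplete:
  "Metric_space.mcomplete (L2 M :: ('a \<Rightarrow> 'b::euclidean_space) set set) (L2_dist M)"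
proof -
  interpret ms: Metric_space "L2 M :: ('a \<Rightarrow> 'b) set set" "L2_dist M" by (rule Metric_space_L2)
  interpret sn: quadratic_seminorm "square_integrable M :: ('a \<Rightarrow> 'b) set" "l2norm M" by (rule quadratic_seminorm_L2)
  show ?thesis
    unfolding ms.mcomplete_def
  proof (intro allI impI)
    fix \<sigma> :: "nat \<Rightarrow> ('a \<Rightarrow> 'b) set" assume \<sigma>: "ms.MCauchy \<sigma>"
    define h where "h n = rep (\<sigma> n)" for n
    have \<sigma>L: "\<sigma> n \<in> L2 M" for n using \<sigma> by (auto simp: ms.MCauchy_def)
    have hV: "h n \<in> square_integrable M" for n
      using rep_L2[OF \<sigma>L] by (simp add: h_def square_integrable_def)
    note [measurable] = square_integrableD[OF hV]
    have hd: "l2norm M (h i - h j) = L2_dist M (\<sigma> i) (\<sigma> j)" for i j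
      by (simp add: L2_dist_def h_def fun_diff_def)
    have C: "\<exists>N. \<forall>i\<ge>N. \<forall>j\<ge>N. l2norm M (h i - h j) < e" if "e > 0" for e
    proof -
      have "\<exists>N. \<forall>n n'. N \<le> n \<longrightarrow> N \<le> n' \<longrightarrow> L2_dist M (\<sigma> n) (\<sigma> n') < e"
        using \<sigma> that unfolding ms.MCauchy_def by simp
      then show ?thesis unfolding hd by auto
    qed
    \<comment> \<open>A constant of norm \<open>1\<close>, used as second factor in the Cauchy-Schwarz inequality.\<close>
    obtain b :: 'b where b: "b \<in> Basis" using nonempty_Basis by blast
    have L1: "(LINT w|M. norm (h i w - h j w)) \<le> l2norm M (h i - h j) * l2norm M (\<lambda>w. b)" for i j
    proof -
      have "h i - h j \<in> square_integrable M" using hV by blast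
      then have "(LINT w|M. norm ((h i - h j) w) * norm b) \<le> l2norm M (h i - h j) * l2norm M (\<lambda>w. b)"
        unfolding square_integrable_def by (intro l2norm_Cauchy_Schwarz) auto
      then show ?thesis using b by simp
    qed
    obtain r where r: "strict_mono r" "AE x in M. Cauchy (\<lambda>i. h (r i) x)"
    proof (rule cauchy_L1_AE_cauchy_subseq[of M h])
      show "integrable M (h n)" for n
      proof -
        have "integrable M (\<lambda>w. norm (h n w) * norm b)"
          using hV[of n] by (intro integrable_norm_sq_add(2)) (auto simp: square_integrable_def)
        then show ?thesis using b by (simp add: integrable_norm_iff)
      qed
      fix e :: real assume e: "e > 0"
      define m where "m = l2norm M (\<lambda>w. b)"
      have m: "m \<ge> 0" by (simp add: m_def)
      obtain N where N: "\<And>i j. i \<ge> N \<Longrightarrow> j \<ge> N \<Longrightarrow> l2norm M (h i - h j) < e / (m + 1)"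
        using C[of "e / (m + 1)"] e m by auto
      have "(LINT w|M. norm (h i w - h j w)) < e" if "i \<ge> N" "j \<ge> N" for i j
      proof -
        have "(LINT w|M. norm (h i w - h j w)) \<le> e / (m + 1) * m"
          using L1[of i j] N[OF that] m unfolding m_def[symmetric]
          by (meson less_imp_le mult_right_mono order_trans)
        also have "\<dots> < e" using e m by (simp add: field_simps)
        finally show ?thesis .
      qed
      then show "\<exists>N. \<forall>i\<ge>N. \<forall>j\<ge>N. (LINT w|M. norm (h i w - h j w)) < e" by blast
    qed blast
    define g where "g w = lim (\<lambda>i. h (r i) w)" for w
    have [measurable]: "g \<in> borel_measurable M" unfolding g_def by measurable
    have lim: "AE w in M. (\<lambda>i. h (r i) w) \<longlonglongrightarrow> g w"
      using r(2) by eventually_elim (simp add: g_def Cauchy_convergent_iff convergent_LIMSEQ_iff)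
    have close: "h n - g \<in> square_integrable M \<and> l2norm M (h n - g) \<le> e"
      if e: "e > 0" and N: "\<And>i j. i \<ge> N \<Longrightarrow> j \<ge> N \<Longrightarrow> l2norm M (h i - h j) < e" and n: "n \<ge> N" for n N e
    proof -
      have le: "(\<integral>\<^sup>+w. ennreal ((norm (h n w - h (r i) w))\<^sup>2) \<partial>M) \<le> ennreal (e\<^sup>2)" if "i \<ge> N" for i
      proof -
        have V: "h n - h (r i) \<in> square_integrable M" using hV by blast
        have "l2norm M (h n - h (r i)) < e" using N n seq_suble[OF r(1), of i] that by simp
        then have "(l2norm M (h n - h (r i)))\<^sup>2 \<le> e\<^sup>2" by (intro power_mono) auto
        then show ?thesis
          using V unfolding l2norm_square square_integrable_def
          by (subst nn_integral_eq_integral) (auto intro: ennreal_leI)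
      qed
      have "(\<integral>\<^sup>+w. ennreal ((norm (h n w - g w))\<^sup>2) \<partial>M) =
          (\<integral>\<^sup>+w. liminf (\<lambda>i. ennreal ((norm (h n w - h (r i) w))\<^sup>2)) \<partial>M)"
      proof (rule nn_integral_cong_AE)
        show "AE w in M. ennreal ((norm (h n w - g w))\<^sup>2) = liminf (\<lambda>i. ennreal ((norm (h n w - h (r i) w))\<^sup>2))"
          using lim
        proof eventually_elim
          fix w assume "(\<lambda>i. h (r i) w) \<longlonglongrightarrow> g w"
          then have "(\<lambda>i. ennreal ((norm (h n w - h (r i) w))\<^sup>2)) \<longlonglongrightarrow> ennreal ((norm (h n w - g w))\<^sup>2)"
            by (intro tendsto_intros)
          then show "ennreal ((norm (h n w - g w))\<^sup>2) = liminf (\<lambda>i. ennreal ((norm (h n w - h (r i) w))\<^sup>2))"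
            by (intro lim_imp_Liminf[symmetric]) simp_all
        qed
      qed
      also have "\<dots> \<le> liminf (\<lambda>i. \<integral>\<^sup>+w. ennreal ((norm (h n w - h (r i) w))\<^sup>2) \<partial>M)"
        by (rule nn_integral_liminf) measurable
      also have "\<dots> \<le> ennreal (e\<^sup>2)"
        using le by (intro order_trans[OF Liminf_le_Limsup Limsup_bounded]) (auto simp: eventually_sequentially)
      finally have fin: "(\<integral>\<^sup>+w. ennreal ((norm (h n w - g w))\<^sup>2) \<partial>M) \<le> ennreal (e\<^sup>2)" .
      then have i: "integrable M (\<lambda>w. (norm (h n w - g w))\<^sup>2)"
        by (intro integrableI_bounded) (auto intro: order.strict_trans1)
      then have "(LINT w|M. (norm (h n w - g w))\<^sup>2) \<le> e\<^sup>2"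
        using fin by (subst (asm) nn_integral_eq_integral) auto
      then have "l2norm M (h n - g) \<le> e"
        unfolding l2norm_def using e by (simp add: real_le_lsqrt)
      moreover have "h n - g \<in> square_integrable M"
        using i by (simp add: square_integrable_def fun_diff_def)
      ultimately show ?thesis by blast
    qed
    have gV: "g \<in> square_integrable M"
    proof -
      obtain N where "\<And>i j. i \<ge> N \<Longrightarrow> j \<ge> N \<Longrightarrow> l2norm M (h i - h j) < 1" using C[of 1] by auto
      then have "h N - g \<in> square_integrable M" using close[of 1 N N] by simp
      then have "h N - (h N - g) \<in> square_integrable M" using hV by blast
      then show ?thesis by simp
    qed
    have "limitin ms.mtopology \<sigma> (ae_class M g) sequentially"
      unfolding ms.limitin_metric
    proof (intro conjI allI impI)
      show "ae_class M g \<in> L2 M" using gV by (auto simp: L2_def square_integrable_def)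
      fix e :: real assume e: "e > 0"
      obtain N where N: "\<And>i j. i \<ge> N \<Longrightarrow> j \<ge> N \<Longrightarrow> l2norm M (h i - h j) < e / 2"
        using C[of "e / 2"] e by auto
      have "L2_dist M (\<sigma> n) (ae_class M g) < e" if "n \<ge> N" for n
      proof -
        have "L2_dist M (\<sigma> n) (ae_class M g) = L2_dist M (ae_class M (h n)) (ae_class M g)"
          using rep_L2(3)[OF \<sigma>L] by (simp add: h_def)
        also have "\<dots> = l2norm M (h n - g)"
          by (simp add: L2_dist_ae_class fun_diff_def)
        also have "\<dots> < e" using close[of "e / 2" N n] N that e by simp
        finally show ?thesis .
      qed
      then show "\<forall>\<^sub>F n in sequentially. \<sigma> n \<in> L2 M \<and> L2_dist M (\<sigma> n) (ae_class M g) < e"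
        using \<sigma>L by (auto simp: eventually_sequentially)
    qed
    then show "\<exists>x. limitin ms.mtopology \<sigma> x sequentially" by blast
  qed
qed

section \<open>The controlled velocity field on square-integrable functions\<close>

text \<open>
  The hypotheses on the dynamics, with their constants and the compact set containing all controls
  fixed.
\<close>

locale control_dynamics = finite_measure \<mu> for \<mu> :: "'w::metric_space measure" +
  fixes T :: real and U :: "real \<Rightarrow> (real^'m) set" and UU :: "(real^'m) set"
    and f :: "real \<Rightarrow> real^'n \<Rightarrow> real^'m \<Rightarrow> 'w \<Rightarrow> real^'n" and c k :: real
  assumes compact_UNIV: "compact (UNIV :: 'w set)"
    and sets_\<mu>: "sets \<mu> = sets borel"
    and compact_UU: "compact UU"
    and compact_U: "t \<in> {0..T} \<Longrightarrow> compact (U t)"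
    and U_subset: "t \<in> {0..T} \<Longrightarrow> U t \<subseteq> UU"
    and f_measurable: "(\<lambda>t. f t x u w) \<in> borel_measurable (lebesgue_on {0..T})"
    and f_continuous: "t \<in> {0..T} \<Longrightarrow> continuous_on UNIV (\<lambda>(x, u, w). f t x u w)"
    and c_pos: "0 < c" and k_pos: "0 < k"
    and f_growth_lipschitz: "AE t in lebesgue_on {0..T}. \<forall>x x' u w.
        norm (f t x u w) \<le> c * (1 + norm x) \<and>
        norm (f t x u w - f t x' u w) \<le> k * norm (x - x')"
    and F_convex: "\<lbrakk>t \<in> {0..T}; \<phi> \<in> L2 \<mu>\<rbrakk> \<Longrightarrow> L2_convex \<mu> (F_dyn \<mu> U f t \<phi>)"
begin

sublocale sn: quadratic_seminorm "square_integrable \<mu> :: ('w \<Rightarrow> real^'n) set" "l2norm \<mu>"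
  by (rule quadratic_seminorm_L2)

abbreviation V :: "('w \<Rightarrow> real^'n) set" where "V \<equiv> square_integrable \<mu>"
abbreviation N :: "('w \<Rightarrow> real^'n) \<Rightarrow> real" where "N \<equiv> l2norm \<mu>"

text \<open>
  The seminorm of every constant function whose value has norm \<open>1\<close>.
\<close>

definition m :: real where "m = sqrt (measure \<mu> UNIV)"

text \<open>
  The superposition (Nemytskii) operator of \<open>f t\<close>.
\<close>

definition dyn :: "real \<Rightarrow> ('w \<Rightarrow> real^'n) \<Rightarrow> real^'m \<Rightarrow> 'w \<Rightarrow> real^'n" where
  "dyn t h u = (\<lambda>w. f t (h w) u w)"

definition regular_time :: "real \<Rightarrow> bool" where
  "regular_time t \<longleftrightarrow> t \<in> {0..T} \<and> (\<forall>x x' u w. norm (f t x u w) \<le> c * (1 + norm x) \<and>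
        norm (f t x u w - f t x' u w) \<le> k * norm (x - x'))"

lemma m_nonneg: "0 \<le> m"
  by (simp add: m_def)

lemma space_\<mu> [simp]: "space \<mu> = UNIV"
  using sets_eq_imp_space_eq[OF sets_\<mu>] by simp

lemma AE_regular_time: "0 \<le> s \<Longrightarrow> AE t in lebesgue_on {s..T}. regular_time t"
proof -
  assume s: "0 \<le> s"
  have "AE t in lebesgue. t \<in> {0..T} \<longrightarrow> (\<forall>x x' u w. norm (f t x u w) \<le> c * (1 + norm x) \<and>
        norm (f t x u w - f t x' u w) \<le> k * norm (x - x'))"
    using f_growth_lipschitz by (simp add: AE_restrict_space_iff)
  then have "AE t in lebesgue. t \<in> {s..T} \<longrightarrow> regular_time t"
    by eventually_elim (use s in \<open>auto simp: regular_time_def\<close>)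
  then show ?thesis by (simp add: AE_restrict_space_iff)
qed

text \<open>
  Rounding \<open>\<omega>\<close> to sample points makes functions of \<open>\<omega>\<close> finitely valued.  It serves for
  measurability, where the mesh tends to \<open>0\<close>, and for finite-dimensional approximation, where it
  is fixed.
\<close>

lemma finite_sample:
  assumes r: "0 < r"
  shows "\<exists>\<sigma>. simple_function \<mu> \<sigma> \<and> (\<forall>w. dist w (\<sigma> w) < r)"
proof -
  obtain F where F: "finite F" "(UNIV :: 'w set) \<subseteq> (\<Union>x\<in>F. ball x r)"
    using compact_UNIV r unfolding compact_eq_totally_bounded by blast
  obtain xs where xs: "set xs = F" using finite_list[OF F(1)] by blast
  define j where "j w = (LEAST i. i < length xs \<and> dist (xs ! i) w < r)" for w
  have ex: "\<exists>i. i < length xs \<and> dist (xs ! i) w < r" for w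
    using F(2) xs by (metis UN_E UNIV_I in_set_conv_nth mem_ball subsetD)
  have j: "j w < length xs \<and> dist (xs ! j w) w < r" for w
    unfolding j_def by (rule LeastI_ex[OF ex])
  have jm: "j \<in> measurable \<mu> (count_space UNIV)"
    unfolding j_def
  proof (rule measurable_Least)
    fix i
    have "{w. i < length xs \<and> dist (xs ! i) w < r} = (if i < length xs then ball (xs ! i) r else {})"
      by auto
    then have "{w. i < length xs \<and> dist (xs ! i) w < r} \<in> sets \<mu>" using sets_\<mu> by simp
    then show "Measurable.pred \<mu> (\<lambda>w. i < length xs \<and> dist (xs ! i) w < r)"
      by (simp add: pred_def)
  qed
  have "simple_function \<mu> j"
    unfolding simple_function_def
  proof
    have "j ` space \<mu> \<subseteq> {..<length xs}" using j by blast
    then show "finite (j ` space \<mu>)" by (rule finite_subset) simp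
    show "\<forall>x\<in>j ` space \<mu>. j -` {x} \<inter> space \<mu> \<in> sets \<mu>"
      using measurable_sets[OF jm] by (intro ballI) simp
  qed
  then have "simple_function \<mu> (\<lambda>w. xs ! j w)" by (rule simple_function_compose1)
  then show ?thesis using j by (metis dist_commute)
qed

lemma sample_sequence:
  obtains \<sigma> where "\<And>n. simple_function \<mu> (\<sigma> n)" "\<And>w. (\<lambda>n. \<sigma> n w) \<longlonglongrightarrow> w"
proof -
  have "\<exists>\<sigma>. simple_function \<mu> \<sigma> \<and> (\<forall>w. dist w (\<sigma> w) < inverse (real (Suc n)))" for n
    by (rule finite_sample) simp
  then obtain \<sigma> where \<sigma>: "\<And>n. simple_function \<mu> (\<sigma> n)" "\<And>n w. dist w (\<sigma> n w) < inverse (real (Suc n))"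
    by metis
  have "(\<lambda>n. \<sigma> n w) \<longlonglongrightarrow> w" for w
  proof -
    have "norm (dist (\<sigma> n w) w) \<le> inverse (real (Suc n))" for n
      using \<sigma>(2)[of w n] by (simp add: dist_commute)
    then have "(\<lambda>n. dist (\<sigma> n w) w) \<longlonglongrightarrow> 0"
      by (intro Lim_null_comparison[OF _ LIMSEQ_inverse_real_of_nat] always_eventually allI)
    then show ?thesis by (rule tendsto_dist_iff[THEN iffD2])
  qed
  then show thesis using that \<sigma>(1) by blast
qed

lemma f_tendsto:
  assumes "t \<in> {0..T}" "(x \<longlongrightarrow> x0) F" "(u \<longlongrightarrow> u0) F" "(w \<longlongrightarrow> w0) F"
  shows "((\<lambda>n. f t (x n) (u n) (w n)) \<longlongrightarrow> f t x0 u0 w0) F"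
proof -
  have "((\<lambda>n. (x n, u n, w n)) \<longlongrightarrow> (x0, u0, w0)) F"
    using assms by (intro tendsto_Pair)
  from continuous_on_tendsto_compose[OF f_continuous[OF assms(1)] this] show ?thesis by simp
qed

text \<open>
  After rounding \<open>\<omega>\<close> in the last argument only, measurability is clear on each of the finitely many
  pieces; continuity of \<open>f\<close> in that argument passes to the limit.
\<close>

lemma dyn_measurable:
  assumes t: "t \<in> {0..T}" and h: "h \<in> borel_measurable \<mu>"
  shows "dyn t h u \<in> borel_measurable \<mu>"
proof -
  obtain \<sigma> where \<sigma>: "\<And>n. simple_function \<mu> (\<sigma> n)" and Dseq: "\<And>w. (\<lambda>n. \<sigma> n w) \<longlonglongrightarrow> w"
    using sample_sequence by blast
  have "(\<lambda>w. f t (h w) u (\<sigma> n w)) \<in> borel_measurable \<mu>" for n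
  proof (rule measurable_compose_countable'[where I = "range (\<sigma> n)"])
    show "(\<lambda>w. f t (h w) u i) \<in> borel_measurable \<mu>" for i
    proof -
      have "continuous_on UNIV (\<lambda>x. f t x u i)"
        unfolding continuous_on_def by (intro ballI f_tendsto[OF t] tendsto_ident_at tendsto_const)
      then show ?thesis using h by (rule borel_measurable_continuous_on)
    qed
    show "\<sigma> n \<in> \<mu> \<rightarrow>\<^sub>M count_space (range (\<sigma> n))"
      using measurable_sets[OF measurable_simple_function[OF \<sigma>]] by (auto simp: measurable_def)
    show "countable (range (\<sigma> n))"
      using \<sigma>[of n] by (simp add: simple_function_def countable_finite)
  qed
  moreover have "(\<lambda>n. f t (h w) u (\<sigma> n w)) \<longlonglongrightarrow> f t (h w) u w" for w
    by (intro f_tendsto[OF t] tendsto_const Dseq)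
  ultimately show ?thesis
    unfolding dyn_def by (rule borel_measurable_LIMSEQ_metric)
qed

lemma bounded_square_integrable:
  fixes h :: "'w \<Rightarrow> real^'n"
  assumes "h \<in> borel_measurable \<mu>" "\<And>w. norm (h w) \<le> e" "0 \<le> e"
  shows "h \<in> V" "N h \<le> e * m"
proof -
  have i: "integrable \<mu> (\<lambda>w. e\<^sup>2)" by simp
  show "h \<in> V" using l2norm_mono(1)[OF assms(1) i] assms(2) by simp
  have "N h \<le> sqrt (LINT w|\<mu>. e\<^sup>2)" using l2norm_mono(2)[OF assms(1) i] assms(2) by simp
  also have "\<dots> = e * m" using assms(3) by (simp add: m_def real_sqrt_mult mult.commute)
  finally show "N h \<le> e * m" .
qed

lemma growth_square_integrable:
  fixes h :: "'w \<Rightarrow> real^'n"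
  assumes h: "h \<in> V" and e: "0 \<le> e"
  shows "integrable \<mu> (\<lambda>w. (e * (1 + norm (h w)))\<^sup>2)"
    "sqrt (LINT w|\<mu>. (e * (1 + norm (h w)))\<^sup>2) \<le> e * (m + N h)"
proof -
  note [measurable] = square_integrableD[OF h]
  have i: "integrable \<mu> (\<lambda>w. (norm (1::real))\<^sup>2)" "integrable \<mu> (\<lambda>w. (norm (norm (h w)))\<^sup>2)"
    using h by (simp_all add: square_integrable_def)
  have "integrable \<mu> (\<lambda>w. (norm (1 + norm (h w)))\<^sup>2)"
    using i by (intro integrable_norm_sq_add(1)) auto
  then show "integrable \<mu> (\<lambda>w. (e * (1 + norm (h w)))\<^sup>2)"
    by (simp add: power_mult_distrib)
  have "l2norm \<mu> (\<lambda>w. 1 + norm (h w)) \<le> l2norm \<mu> (\<lambda>w. 1::real) + l2norm \<mu> (\<lambda>w. norm (h w))"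
    using i by (intro l2norm_triangle) auto
  moreover have "l2norm \<mu> (\<lambda>w. 1::real) = m" "l2norm \<mu> (\<lambda>w. norm (h w)) = N h"
    by (simp_all add: l2norm_def m_def)
  ultimately have "e * l2norm \<mu> (\<lambda>w. 1 + norm (h w)) \<le> e * (m + N h)"
    using e by (simp add: mult_left_mono)
  moreover have "sqrt (LINT w|\<mu>. (e * (1 + norm (h w)))\<^sup>2) = e * l2norm \<mu> (\<lambda>w. 1 + norm (h w))"
    using e by (simp add: l2norm_def power_mult_distrib real_sqrt_mult)
  ultimately show "sqrt (LINT w|\<mu>. (e * (1 + norm (h w)))\<^sup>2) \<le> e * (m + N h)" by simp
qed

lemma dyn_growth:
  assumes t: "regular_time t" and h: "h \<in> V"
  shows "dyn t h u \<in> V" "N (dyn t h u) \<le> c * (m + N h)"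
proof -
  have dm: "dyn t h u \<in> borel_measurable \<mu>"
    using dyn_measurable t square_integrableD[OF h] by (auto simp: regular_time_def)
  have b: "AE w in \<mu>. norm (dyn t h u w) \<le> c * (1 + norm (h w))"
    using t by (simp add: regular_time_def dyn_def)
  note g = growth_square_integrable[OF h less_imp_le[OF c_pos]]
  show "dyn t h u \<in> V" using l2norm_mono(1)[OF dm g(1) b] .
  show "N (dyn t h u) \<le> c * (m + N h)" using l2norm_mono(2)[OF dm g(1) b] g(2) by linarith
qed

lemma dyn_lipschitz:
  assumes t: "regular_time t" and h: "h \<in> V" "h' \<in> V"
  shows "N (dyn t h u - dyn t h' u) \<le> k * N (h - h')"
proof -
  have V: "dyn t h u - dyn t h' u \<in> V" "h - h' \<in> V" using dyn_growth(1)[OF t] h by auto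
  have i: "integrable \<mu> (\<lambda>w. (k * norm ((h - h') w))\<^sup>2)"
    using V(2) by (simp add: square_integrable_def power_mult_distrib)
  have "N (dyn t h u - dyn t h' u) \<le> sqrt (LINT w|\<mu>. (k * norm ((h - h') w))\<^sup>2)"
    using t by (intro l2norm_mono(2)[OF square_integrableD[OF V(1)] i])
      (simp add: regular_time_def dyn_def)
  also have "\<dots> = k * N (h - h')"
    using k_pos by (simp add: l2norm_def power_mult_distrib real_sqrt_mult)
  finally show ?thesis .
qed

lemma dyn_continuous_control:
  assumes t: "regular_time t" and h: "h \<in> V" and u: "u \<longlonglongrightarrow> u0"
  shows "(\<lambda>n. N (dyn t h (u n) - dyn t h u0)) \<longlonglongrightarrow> 0"
proof (rule l2norm_tendsto_0)
  have t0: "t \<in> {0..T}" using t by (simp add: regular_time_def)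
  show "integrable \<mu> (\<lambda>w. (2 * c * (1 + norm (h w)))\<^sup>2)"
    using growth_square_integrable(1)[OF h, of "2 * c"] c_pos by simp
  show "dyn t h (u n) - dyn t h u0 \<in> borel_measurable \<mu>" for n
    using dyn_growth(1)[OF t h] square_integrableD sn.V_diff by blast
  have "norm ((dyn t h (u n) - dyn t h u0) w) \<le> 2 * c * (1 + norm (h w))" for n w
  proof -
    have b: "norm (f t (h w) v w) \<le> c * (1 + norm (h w))" for v using t by (simp add: regular_time_def)
    then show ?thesis
      using norm_triangle_ineq4[of "f t (h w) (u n) w" "f t (h w) u0 w"] b[of "u n"] b[of u0]
      unfolding dyn_def fun_diff_def mult.assoc by linarith
  qed
  then show "AE w in \<mu>. norm ((dyn t h (u n) - dyn t h u0) w) \<le> 2 * c * (1 + norm (h w))" for n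
    by simp
  have "(\<lambda>n. f t (h w) (u n) w) \<longlonglongrightarrow> f t (h w) u0 w" for w
    using f_tendsto[OF t0 tendsto_const u tendsto_const] .
  then show "AE w in \<mu>. (\<lambda>n. (dyn t h (u n) - dyn t h u0) w) \<longlonglongrightarrow> 0"
    by (simp add: dyn_def LIM_zero)
qed

text \<open>
  For each \<open>t\<close> the function \<open>f t\<close> is uniformly continuous on the compact set \<open>Z \<times> UU \<times> \<Omega>\<close>, so the set
  of times at which it oscillates by more than \<open>e\<close> at scale \<open>1/(n+1)\<close> decreases to the empty set as
  \<open>n\<close> grows.  By continuity these sets may be described with countably many controls and points, and
  are thus measurable; so their measures tend to \<open>0\<close>.
\<close>

lemma uniformly_small_oscillation:
  assumes Z: "finite Z" and e: "0 < e" and \<eta>: "0 < \<eta>"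
  obtains r B where "0 < r" "B \<in> sets lebesgue" "emeasure lebesgue B < ennreal \<eta>"
    "\<And>t x u w w'. t \<in> {0..T} - B \<Longrightarrow> x \<in> Z \<Longrightarrow> u \<in> UU \<Longrightarrow> dist w w' < r \<Longrightarrow>
       norm (f t x u w - f t x u w') \<le> e"
proof -
  define B where "B n = {t \<in> {0..T}. \<exists>x\<in>Z. \<exists>u\<in>UU. \<exists>w w'. dist w w' < 1 / (real n + 1) \<and>
      e < norm (f t x u w - f t x u w')}" for n :: nat
  obtain \<sigma> where \<sigma>: "\<And>n. simple_function \<mu> (\<sigma> n)" and Dseq: "\<And>w. (\<lambda>n. \<sigma> n w) \<longlonglongrightarrow> w"
    using sample_sequence by blast
  define D where "D = (\<Union>n. range (\<sigma> n))"
  have D: "countable D" using \<sigma> unfolding D_def by (auto simp: simple_function_def countable_finite)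
  obtain E where E: "countable E" "E \<subseteq> UU" "UU \<subseteq> closure E" using separable[of UU] by blast
  have Beq: "B n = (\<Union>x\<in>Z. \<Union>u\<in>E. \<Union>w\<in>D. \<Union>w'\<in>{w' \<in> D. dist w w' < 1 / (real n + 1)}.
      {t \<in> {0..T}. e < norm (f t x u w - f t x u w')})" (is "_ = ?R") for n
  proof
    show "?R \<subseteq> B n" using E(2) unfolding B_def by blast
    show "B n \<subseteq> ?R"
    proof
      fix t assume "t \<in> B n"
      then obtain x u w w' where *: "t \<in> {0..T}" "x \<in> Z" "u \<in> UU" "dist w w' < 1 / (real n + 1)"
        "e < norm (f t x u w - f t x u w')" unfolding B_def by blast
      obtain v where v: "\<And>i. v i \<in> E" "v \<longlonglongrightarrow> u" using E(3) *(3) closure_sequential by blast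
      have "(\<lambda>i. dist (\<sigma> i w) (\<sigma> i w')) \<longlonglongrightarrow> dist w w'" by (intro tendsto_dist Dseq)
      then have 1: "\<forall>\<^sub>F i in sequentially. dist (\<sigma> i w) (\<sigma> i w') < 1 / (real n + 1)"
        using *(4) order_tendstoD(2) by blast
      have "(\<lambda>i. norm (f t x (v i) (\<sigma> i w) - f t x (v i) (\<sigma> i w'))) \<longlonglongrightarrow> norm (f t x u w - f t x u w')"
        by (intro tendsto_norm tendsto_diff f_tendsto[OF *(1)] tendsto_const v Dseq)
      then have 2: "\<forall>\<^sub>F i in sequentially. e < norm (f t x (v i) (\<sigma> i w) - f t x (v i) (\<sigma> i w'))"
        using *(5) order_tendstoD(1) by blast
      obtain i where i: "dist (\<sigma> i w) (\<sigma> i w') < 1 / (real n + 1)"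
        "e < norm (f t x (v i) (\<sigma> i w) - f t x (v i) (\<sigma> i w'))"
        using eventually_happens[OF eventually_conj[OF 1 2]] by auto
      have "\<sigma> i w \<in> D" "\<sigma> i w' \<in> D" by (auto simp: D_def)
      then show "t \<in> ?R"
        by (intro UN_I[OF *(2)] UN_I[OF v(1)[of i]] UN_I[of "\<sigma> i w"] UN_I[of "\<sigma> i w'"] CollectI conjI i *(1))
    qed
  qed
  have Bm: "B n \<in> sets lebesgue" for n
    unfolding Beq
  proof (intro sets.countable_UN'' countable_finite[OF Z] E(1) D)
    fix x u w
    show "countable {w' \<in> D. dist w w' < 1 / (real n + 1)}" using D by (rule countable_subset[rotated]) auto
    fix w'
    have "{t \<in> space (lebesgue_on {0..T}). e < norm (f t x u w - f t x u w')} \<in> sets (lebesgue_on {0..T})"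
      using f_measurable by measurable
    then show "{t \<in> {0..T}. e < norm (f t x u w - f t x u w')} \<in> sets lebesgue"
      by (simp add: sets_restrict_space_iff)
  qed
  have BT: "emeasure lebesgue (B n) \<noteq> \<infinity>" for n
  proof -
    have "emeasure lebesgue (B n) \<le> emeasure lebesgue {0..T}"
      by (intro emeasure_mono) (auto simp: B_def)
    also have "\<dots> < \<infinity>" by (simp add: emeasure_lborel_Icc_eq)
    finally show ?thesis by simp
  qed
  have dec: "decseq B"
    unfolding decseq_def
  proof (intro allI impI subsetI)
    fix n l t assume "n \<le> l" "t \<in> B l"
    moreover have "1 / (real l + 1) \<le> 1 / (real n + 1)" using \<open>n \<le> l\<close> by (simp add: frac_le)
    ultimately show "t \<in> B n" unfolding B_def using order.strict_trans2 by blast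
  qed
  have "(\<Inter>n. B n) = {}"
  proof (rule ccontr)
    assume "(\<Inter>n. B n) \<noteq> {}"
    then obtain t where t: "\<And>n. t \<in> B n" by blast
    then have t0: "t \<in> {0..T}" by (auto simp: B_def)
    have "uniformly_continuous_on (Z \<times> UU \<times> UNIV) (\<lambda>(x, u, w). f t x u w)"
      by (intro compact_uniformly_continuous compact_Times finite_imp_compact[OF Z] compact_UU compact_UNIV
          continuous_on_subset[OF f_continuous[OF t0]]) simp
    then obtain d where d: "d > 0" "\<And>p q. p \<in> Z \<times> UU \<times> UNIV \<Longrightarrow> q \<in> Z \<times> UU \<times> UNIV \<Longrightarrow> dist q p < d \<Longrightarrow>
        dist (case q of (x, u, w) \<Rightarrow> f t x u w) (case p of (x, u, w) \<Rightarrow> f t x u w) < e"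
      using e unfolding uniformly_continuous_on_def by meson
    obtain n where n: "1 / (real n + 1) < d"
      using reals_Archimedean[OF d(1)] by (auto simp: inverse_eq_divide add.commute)
    obtain x u w w' where *: "x \<in> Z" "u \<in> UU" "dist w w' < 1 / (real n + 1)" "e < norm (f t x u w - f t x u w')"
      using t[of n] unfolding B_def by blast
    have "dist (f t x u w) (f t x u w') < e"
      using d(2)[of "(x, u, w')" "(x, u, w)"] * n by (auto simp: dist_Pair_Pair)
    then show False using *(4) by (simp add: dist_norm)
  qed
  then have "(\<lambda>n. emeasure lebesgue (B n)) \<longlonglongrightarrow> 0"
    using Lim_emeasure_decseq[of B lebesgue, OF _ dec BT] Bm by auto
  then have "\<forall>\<^sub>F n in sequentially. emeasure lebesgue (B n) < ennreal \<eta>"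
    using \<eta> by (intro order_tendstoD) auto
  then obtain n where n: "emeasure lebesgue (B n) < ennreal \<eta>"
    using eventually_happens by fastforce
  show thesis
  proof (rule that[of "1 / (real n + 1)" "B n"])
    show "norm (f t x u w - f t x u w') \<le> e"
      if "t \<in> {0..T} - B n" "x \<in> Z" "u \<in> UU" "dist w w' < 1 / (real n + 1)" for t x u w w'
      using that unfolding B_def by (auto simp: not_less[symmetric])
  qed (use Bm n in auto)
qed

section \<open>Speed and growth of solutions\<close>

definition is_solution :: "real \<Rightarrow> (real \<Rightarrow> 'w \<Rightarrow> real^'n) \<Rightarrow> bool" where
  "is_solution s X \<longleftrightarrow> (\<forall>t\<in>{s..T}. X t \<in> V) \<and> sn.abs_cont {s..T} X \<and>
     (AE t in lebesgue_on {s..T}. \<exists>u\<in>U t. sn.has_deriv {s..T} X (dyn t (X t) u) t)"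

lemma abs_cont_subset: "sn.abs_cont I X \<Longrightarrow> J \<subseteq> I \<Longrightarrow> sn.abs_cont J X"
  unfolding sn.abs_cont_def using intervals_in_mono by meson

lemma abs_cont_continuous:
  assumes ac: "sn.abs_cont {a..b} X" and X: "\<And>t. t \<in> {a..b} \<Longrightarrow> X t \<in> V"
  shows "continuous_on {a..b} (\<lambda>t. N (X t))"
  unfolding continuous_on_iff
proof (intro ballI allI impI)
  fix t and e :: real assume t: "t \<in> {a..b}" and e: "e > 0"
  obtain d where d: "d > 0" "\<And>ps. intervals_in {a..b} ps \<Longrightarrow> (\<Sum>(p, q)\<leftarrow>ps. q - p) < d \<Longrightarrow>
      (\<Sum>(p, q)\<leftarrow>ps. N (X q - X p)) < e"
    using ac e unfolding sn.abs_cont_def by blast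
  have *: "N (X q - X p) < e" if "p \<in> {a..b}" "q \<in> {a..b}" "p \<le> q" "q - p < d" for p q
    using d(2)[of "[(p, q)]"] that by (auto simp: intervals_in_def)
  show "\<exists>d>0. \<forall>t'\<in>{a..b}. dist t' t < d \<longrightarrow> dist (N (X t')) (N (X t)) < e"
  proof (intro exI[of _ d] conjI d(1) ballI impI)
    fix t' assume t': "t' \<in> {a..b}" "dist t' t < d"
    have "N (X t' - X t) < e"
    proof (cases "t \<le> t'")
      case True then show ?thesis using *[of t t'] t t' by (simp add: dist_real_def)
    next
      case False then show ?thesis
        using *[of t' t] t t' sn.N_commute[OF X[OF t] X[OF t'(1)]] by (simp add: dist_real_def)
    qed
    moreover have "\<bar>N (X t') - N (X t)\<bar> \<le> N (X t' - X t)"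
      using sn.N_le[OF X[OF t] X[OF t'(1)]] sn.N_le[OF X[OF t'(1)] X[OF t]]
        sn.N_commute[OF X[OF t] X[OF t'(1)]] by linarith
    ultimately show "dist (N (X t')) (N (X t)) < e" by (simp add: dist_real_def)
  qed
qed

lemma solution_speed:
  assumes s: "0 \<le> s" and X: "is_solution s X" and ab: "s \<le> a" "a \<le> b" "b \<le> T"
    and M: "\<And>t. t \<in> {a..b} \<Longrightarrow> N (X t) \<le> M"
  shows "N (X b - X a) \<le> c * (m + M) * (b - a)"
proof (rule sn.speed_bound[OF ab(2)])
  have sub: "{a..b} \<subseteq> {s..T}" using ab by auto
  show XV: "X t \<in> V" if "t \<in> {a..b}" for t using X that sub by (auto simp: is_solution_def)
  show "sn.abs_cont {a..b} X" using X sub abs_cont_subset by (auto simp: is_solution_def)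
  have "a \<in> {a..b}" using ab by simp
  then have "0 \<le> M" using M[of a] sn.N_nonneg[OF XV[of a]] by linarith
  then show "0 \<le> c * (m + M)" using c_pos m_nonneg by simp
  have "AE t in lebesgue_on {a..b}. regular_time t"
    using AE_lebesgue_on_subset[OF AE_regular_time[OF s] ab(1,3)] .
  moreover have "AE t in lebesgue_on {a..b}. \<exists>u\<in>U t. sn.has_deriv {s..T} X (dyn t (X t) u) t"
    by (rule AE_lebesgue_on_subset[OF _ ab(1,3)]) (use X in \<open>simp add: is_solution_def\<close>)
  moreover have "AE t in lebesgue_on {a..b}. t \<in> {a..b}" by (rule AE_I2) simp
  ultimately show "AE t in lebesgue_on {a..b}. \<exists>v. sn.has_deriv {a..b} X v t \<and> N v \<le> c * (m + M)"
  proof eventually_elim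
    fix t assume t: "regular_time t" "\<exists>u\<in>U t. sn.has_deriv {s..T} X (dyn t (X t) u) t" "t \<in> {a..b}"
    then obtain u where u: "sn.has_deriv {s..T} X (dyn t (X t) u) t" by blast
    have "N (dyn t (X t) u) \<le> c * (m + N (X t))" using dyn_growth(2)[OF t(1) XV[OF t(3)]] .
    also have "\<dots> \<le> c * (m + M)" using M[OF t(3)] c_pos by simp
    finally show "\<exists>v. sn.has_deriv {a..b} X v t \<and> N v \<le> c * (m + M)"
      using sn.has_deriv_subset[OF u sub] by blast
  qed
qed

text \<open>
  Let the norm of \<open>X\<close> on \<open>[a, t]\<close> be largest at \<open>\<tau>\<close>.  The speed is at most \<open>c (m + N (X \<tau>))\<close> and the
  duration at most \<open>1 / (2 c)\<close>, so the increment is at most half of \<open>m + N (X \<tau>)\<close> and is absorbed.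
\<close>

lemma solution_local_growth:
  assumes s: "0 \<le> s" and X: "is_solution s X" and ab: "s \<le> a" "a \<le> t" "t \<le> T" "c * (t - a) \<le> 1 / 2"
  shows "N (X t) + m \<le> 2 * (N (X a) + m)"
proof -
  have sub: "{a..t} \<subseteq> {s..T}" using ab by auto
  have XV: "X t' \<in> V" if "t' \<in> {a..t}" for t' using X that sub by (auto simp: is_solution_def)
  have "continuous_on {a..t} (\<lambda>t. N (X t))"
    using X sub XV abs_cont_subset by (intro abs_cont_continuous) (auto simp: is_solution_def)
  then obtain \<tau> where \<tau>: "\<tau> \<in> {a..t}" "\<And>t'. t' \<in> {a..t} \<Longrightarrow> N (X t') \<le> N (X \<tau>)"
    using continuous_attains_sup[of "{a..t}" "\<lambda>t. N (X t)"] ab by auto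
  have N0: "0 \<le> N (X \<tau>)" using sn.N_nonneg[OF XV[OF \<tau>(1)]] .
  have "N (X \<tau>) \<le> N (X \<tau> - X a) + N (X a)" using XV \<tau>(1) ab by (intro sn.N_le) auto
  also have "N (X \<tau> - X a) \<le> c * (m + N (X \<tau>)) * (\<tau> - a)"
    using \<tau> ab by (intro solution_speed[OF s X]) auto
  also have "\<dots> = (m + N (X \<tau>)) * (c * (\<tau> - a))" by simp
  also have "\<dots> \<le> (m + N (X \<tau>)) * (1 / 2)"
  proof (rule mult_left_mono)
    have "c * (\<tau> - a) \<le> c * (t - a)" using \<tau>(1) c_pos by simp
    then show "c * (\<tau> - a) \<le> 1 / 2" using ab(4) by linarith
  qed (use N0 m_nonneg in simp)
  finally have "N (X \<tau>) + m \<le> 2 * (N (X a) + m)" by (simp add: field_simps)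
  then show ?thesis using \<tau>(2)[of t] ab by simp
qed

text \<open>
  Gronwall's bound in discrete form: the local estimate is iterated over steps of length \<open>1 / (2 c)\<close>.
\<close>

lemma solution_bound:
  assumes s: "0 \<le> s"
  shows "\<exists>K\<ge>0. \<forall>X. is_solution s X \<longrightarrow> (\<forall>t\<in>{s..T}. N (X t) \<le> K * (N (X s) + m))"
proof -
  have step: "N (X t) + m \<le> 2 ^ n * (N (X s) + m)"
    if X: "is_solution s X" and t: "t \<in> {s..T}" "c * (t - s) \<le> real n / 2" for X n t
    using t
  proof (induction n arbitrary: t)
    case 0
    then have "c * (t - s) \<le> 0" by simp
    then have "t \<le> s" using c_pos by (simp add: mult_le_0_iff)
    then show ?case using 0 by simp
  next
    case (Suc n)
    define q where "q = 1 / (2 * c)"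
    have q: "0 < q" "c * q = 1 / 2" using c_pos by (simp_all add: q_def)
    define a where "a = max s (t - q)"
    have a: "s \<le> a" "a \<le> t" "a \<in> {s..T}" using Suc.prems(1) q(1) by (auto simp: a_def)
    have "c * (t - a) \<le> c * q" using c_pos by (intro mult_left_mono) (auto simp: a_def)
    then have ct: "c * (t - a) \<le> 1 / 2" using q(2) by simp
    have "c * (a - s) \<le> real n / 2"
    proof (cases "a = s")
      case False
      then have aq: "a = t - q" by (auto simp: a_def max_def split: if_splits)
      have "c * (a - s) = c * (t - s) - c * q" unfolding aq by (simp add: algebra_simps)
      then have "c * (a - s) = c * (t - s) - 1 / 2" unfolding q(2) .
      then show ?thesis using Suc.prems(2) by (simp add: add_divide_distrib)
    qed simp
    from Suc.IH[OF a(3) this] have "N (X a) + m \<le> 2 ^ n * (N (X s) + m)" .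
    moreover have "N (X t) + m \<le> 2 * (N (X a) + m)"
      using solution_local_growth[OF s X a(1,2) _ ct] Suc.prems by simp
    ultimately show ?case by simp
  qed
  obtain n :: nat where n: "2 * (c * (T - s)) \<le> real n" using real_arch_simple by blast
  show ?thesis
  proof (intro exI[of _ "2 ^ n"] conjI allI impI ballI)
    fix X t assume X: "is_solution s X" and t: "t \<in> {s..T}"
    have "c * (t - s) \<le> c * (T - s)" using t c_pos by simp
    then have "c * (t - s) \<le> real n / 2" using n by simp
    from step[OF X t this] show "N (X t) \<le> 2 ^ n * (N (X s) + m)" using m_nonneg by simp
  qed simp
qed

lemma solutions_lipschitz:
  assumes s: "0 \<le> s" "s < T"
  shows "\<exists>R>0. \<exists>L\<ge>0. \<forall>X. is_solution s X \<longrightarrow> N (X s) = r \<longrightarrow>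
    X \<in> sn.lip s T L \<and> (\<forall>t\<in>{s..T}. N (X t) \<le> R)"
proof -
  obtain K where K: "K \<ge> 0" "\<And>X t. is_solution s X \<Longrightarrow> t \<in> {s..T} \<Longrightarrow> N (X t) \<le> K * (N (X s) + m)"
    using solution_bound[OF s(1)] by blast
  define R where "R = K * (\<bar>r\<bar> + m) + 1"
  have R: "R > 0" using K(1) m_nonneg by (simp add: R_def add_nonneg_pos)
  have bound: "N (X t) \<le> R" if "is_solution s X" "N (X s) = r" "t \<in> {s..T}" for X t
  proof -
    have "N (X t) \<le> K * (r + m)" using K(2)[OF that(1,3)] that(2) by simp
    also have "\<dots> \<le> K * (\<bar>r\<bar> + m)" using K(1) by (intro mult_left_mono) auto
    finally show ?thesis by (simp add: R_def)
  qed
  have "X \<in> sn.lip s T (c * (m + R))" if X: "is_solution s X" "N (X s) = r" for X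
    unfolding sn.lip_def
  proof (intro CollectI conjI ballI)
    show XV: "X t \<in> V" if "t \<in> {s..T}" for t using X that by (simp add: is_solution_def)
    have *: "N (X b - X a) \<le> c * (m + R) * (b - a)" if "s \<le> a" "a \<le> b" "b \<le> T" for a b
      using that by (intro solution_speed[OF s(1) X(1)] bound[OF X]) auto
    fix t \<tau> assume t: "t \<in> {s..T}" "\<tau> \<in> {s..T}"
    show "N (X t - X \<tau>) \<le> c * (m + R) * \<bar>t - \<tau>\<bar>"
    proof (cases "\<tau> \<le> t")
      case True then show ?thesis using *[of \<tau> t] t by simp
    next
      case False then show ?thesis using *[of t \<tau>] t sn.N_commute[OF XV XV, of t \<tau>] by simp
    qed
  qed
  moreover have "0 \<le> c * (m + R)" using c_pos m_nonneg R by simp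
  ultimately show ?thesis using R bound by blast
qed

section \<open>Total boundedness of the states reached\<close>

text \<open>
  Bounded functions that factor through \<open>\<Gamma>\<close>.  For finitely valued \<open>\<Gamma>\<close> they form a ball in a
  finite-dimensional space.
\<close>

definition step_functions :: "('w \<Rightarrow> 'p) \<Rightarrow> real \<Rightarrow> ('w \<Rightarrow> real^'n) set" where
  "step_functions \<Gamma> r = {h. (\<exists>H. h = (\<lambda>w. H (\<Gamma> w))) \<and> (\<forall>w. norm (h w) \<le> r)}"

lemma convex_step_functions: "convex (step_functions \<Gamma> r)"
proof (rule convexI)
  fix h g and u v :: real
  assume *: "h \<in> step_functions \<Gamma> r" "g \<in> step_functions \<Gamma> r" "0 \<le> u" "0 \<le> v" "u + v = 1"
  obtain H G where HG: "h = (\<lambda>w. H (\<Gamma> w))" "g = (\<lambda>w. G (\<Gamma> w))"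
    using * unfolding step_functions_def by blast
  have "u *\<^sub>R h + v *\<^sub>R g = (\<lambda>w. (\<lambda>p. u *\<^sub>R H p + v *\<^sub>R G p) (\<Gamma> w))"
    by (simp add: HG fun_eq_iff)
  moreover have "norm ((u *\<^sub>R h + v *\<^sub>R g) w) \<le> r" for w
  proof -
    have "h w \<in> cball 0 r" "g w \<in> cball 0 r" using * by (auto simp: step_functions_def)
    from convexD[OF convex_cball this *(3-5)] show ?thesis by simp
  qed
  ultimately show "u *\<^sub>R h + v *\<^sub>R g \<in> step_functions \<Gamma> r"
    unfolding step_functions_def by (intro CollectI conjI allI exI)
qed

lemma step_functions_V:
  assumes \<Gamma>: "simple_function \<mu> \<Gamma>" and r: "0 \<le> r"
  shows "step_functions \<Gamma> r \<subseteq> V"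
proof
  fix h assume h: "h \<in> step_functions \<Gamma> r"
  then obtain H where H: "h = (\<lambda>w. H (\<Gamma> w))" by (auto simp: step_functions_def)
  have "simple_function \<mu> h" unfolding H by (rule simple_function_compose1[OF \<Gamma>])
  then show "h \<in> V"
    using h r by (intro bounded_square_integrable[of h r] borel_measurable_simple_function) (auto simp: step_functions_def)
qed

lemma has_net_step_functions:
  assumes \<Gamma>: "simple_function \<mu> \<Gamma>" and r: "0 \<le> r" and \<epsilon>: "0 < \<epsilon>"
  shows "sn.has_net \<epsilon> (step_functions \<Gamma> r)"
proof -
  define e where "e = \<epsilon> / (m + 1)"
  have e: "e > 0" "e * m \<le> \<epsilon>" using \<epsilon> m_nonneg by (auto simp: e_def field_simps)
  have "cball (0::real^'n) r \<subseteq> (\<Union>y\<in>cball 0 r. ball y e)"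
    using e(1) by (auto intro: centre_in_ball[THEN iffD2])
  then obtain Y where Y: "Y \<subseteq> cball 0 r" "finite Y" "cball (0::real^'n) r \<subseteq> (\<Union>y\<in>Y. ball y e)"
    by (rule compactE_image[OF compact_cball, rotated]) auto
  define P where "P = range \<Gamma>"
  have P: "finite P" using \<Gamma> by (simp add: P_def simple_function_def)
  define F where "F = (\<lambda>H w. H (\<Gamma> w)) ` (P \<rightarrow>\<^sub>E Y)"
  have "finite F" unfolding F_def by (intro finite_imageI finite_PiE P Y(2))
  moreover have FC: "F \<subseteq> step_functions \<Gamma> r"
  proof
    fix h assume "h \<in> F"
    then obtain H where H: "H \<in> P \<rightarrow>\<^sub>E Y" "h = (\<lambda>w. H (\<Gamma> w))" by (auto simp: F_def)
    have "H (\<Gamma> w) \<in> Y" for w using H(1) by (auto simp: P_def)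
    then have "norm (h w) \<le> r" for w using Y(1) H(2) by (auto simp: subset_iff)
    then show "h \<in> step_functions \<Gamma> r" using H(2) by (auto simp: step_functions_def)
  qed
  moreover have "\<exists>g\<in>F. N (h - g) \<le> \<epsilon>" if h: "h \<in> step_functions \<Gamma> r" for h
  proof -
    obtain H where H: "h = (\<lambda>w. H (\<Gamma> w))" using h by (auto simp: step_functions_def)
    have "\<exists>y. y \<in> Y \<and> dist (H p) y < e" if "p \<in> P" for p
    proof -
      have "H p \<in> cball 0 r" using that h H by (auto simp: P_def step_functions_def)
      then obtain y where "y \<in> Y" "H p \<in> ball y e" using Y(3) by blast
      then show ?thesis by (auto simp: dist_commute)
    qed
    then obtain y where y: "\<And>p. p \<in> P \<Longrightarrow> y p \<in> Y" "\<And>p. p \<in> P \<Longrightarrow> dist (H p) (y p) < e" by metis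
    define g where "g = (\<lambda>w. restrict y P (\<Gamma> w))"
    have "restrict y P \<in> P \<rightarrow>\<^sub>E Y" using y(1) by simp
    then have g: "g \<in> F" unfolding F_def g_def by (rule image_eqI[OF refl])
    have V: "h - g \<in> V" using h g FC step_functions_V[OF \<Gamma> r] by blast
    have "norm ((h - g) w) \<le> e" for w
      using y(2)[of "\<Gamma> w"] by (simp add: H g_def P_def dist_norm less_imp_le)
    then have "N (h - g) \<le> e * m"
      using e(1) square_integrableD[OF V] by (intro bounded_square_integrable(2)) auto
    then show ?thesis using g e(2) by (meson order_trans)
  qed
  ultimately show ?thesis unfolding sn.has_net_def using step_functions_V[OF \<Gamma> r] by blast
qed

definition reached :: "(real \<Rightarrow> 'w \<Rightarrow> real^'n) set \<Rightarrow> real \<Rightarrow> real \<Rightarrow> ('w \<Rightarrow> real^'n) set" where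
  "reached S a b = {X t |X t. X \<in> S \<and> t \<in> {a..b}}"

lemma reachedI: "X \<in> S \<Longrightarrow> t \<in> {a..b} \<Longrightarrow> X t \<in> reached S a b"
  unfolding reached_def by blast

lemma simple_function_map:
  assumes "\<And>\<psi>. \<psi> \<in> set \<psi>s \<Longrightarrow> simple_function \<mu> \<psi>"
  shows "simple_function \<mu> (\<lambda>w. map (\<lambda>\<psi>. \<psi> w) \<psi>s)"
  using assms
proof (induction \<psi>s)
  case (Cons \<psi> \<psi>s)
  then have "simple_function \<mu> (\<lambda>w. \<psi> w # map (\<lambda>\<psi>. \<psi> w) \<psi>s)"
    by (intro simple_function_compose2[where h = "(#)"]) auto
  then show ?case by simp
qed simp

text \<open>
  The map \<open>\<Gamma>\<close> records the values of all the given functions \<open>\<psi>\<close> together with the rounded \<open>\<omega>\<close>.  Replacing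
  \<open>\<omega>\<close> by its rounding in the last argument of \<open>f t (\<psi> \<omega>) u \<omega>\<close> makes the velocity a function of \<open>\<Gamma>\<close>,
  and small oscillation bounds the error uniformly in \<open>u\<close>.
\<close>

lemma velocities_near_step_functions:
  assumes \<psi>s: "\<And>\<psi>. \<psi> \<in> set \<psi>s \<Longrightarrow> simple_function \<mu> \<psi>" and e: "0 < e" and \<eta>: "0 < \<eta>"
  obtains \<Gamma> :: "'w \<Rightarrow> (real^'n) list \<times> 'w" and r B where "simple_function \<mu> \<Gamma>" "0 \<le> r" "B \<in> sets lebesgue"
    "emeasure lebesgue B < ennreal \<eta>"
    "\<And>t u \<psi>. regular_time t \<Longrightarrow> t \<notin> B \<Longrightarrow> u \<in> U t \<Longrightarrow> \<psi> \<in> set \<psi>s \<Longrightarrow>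
       \<exists>h\<in>step_functions \<Gamma> r. N (dyn t \<psi> u - h) \<le> e * m"
proof -
  define Z where "Z = (\<Union>\<psi>\<in>set \<psi>s. range \<psi>)"
  have Z: "finite Z" using \<psi>s by (auto simp: Z_def simple_function_def)
  obtain q B where q: "0 < q" and B: "B \<in> sets lebesgue" "emeasure lebesgue B < ennreal \<eta>"
    and osc: "\<And>t x u w w'. t \<in> {0..T} - B \<Longrightarrow> x \<in> Z \<Longrightarrow> u \<in> UU \<Longrightarrow> dist w w' < q \<Longrightarrow>
       norm (f t x u w - f t x u w') \<le> e"
    using uniformly_small_oscillation[OF Z e \<eta>] by metis
  obtain \<sigma> where \<sigma>: "simple_function \<mu> \<sigma>" "\<And>w. dist w (\<sigma> w) < q" using finite_sample[OF q] by blast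
  define \<Gamma> where "\<Gamma> w = (map (\<lambda>\<psi>. \<psi> w) \<psi>s, \<sigma> w)" for w
  have \<Gamma>: "simple_function \<mu> \<Gamma>"
    unfolding \<Gamma>_def using simple_function_map[OF \<psi>s] \<sigma>(1) by (intro simple_function_Pair)
  define r where "r = Max (insert 0 ((\<lambda>x. c * (1 + norm x)) ` Z))"
  have r: "0 \<le> r" "\<And>x. x \<in> Z \<Longrightarrow> c * (1 + norm x) \<le> r"
    unfolding r_def using Z by (auto intro!: Max_ge)
  show thesis
  proof (rule that[OF \<Gamma> r(1) B])
    fix t u \<psi> assume t: "regular_time t" "t \<notin> B" and u: "u \<in> U t" and \<psi>: "\<psi> \<in> set \<psi>s"
    have t0: "t \<in> {0..T}" using t(1) by (simp add: regular_time_def)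
    obtain i where i: "i < length \<psi>s" "\<psi> = \<psi>s ! i" using \<psi> by (metis in_set_conv_nth)
    \<comment> \<open>Only the last argument is rounded; \<open>\<psi>\<close> is finitely valued already.\<close>
    define h where "h w = f t (\<psi> w) u (\<sigma> w)" for w
    have \<psi>Z: "\<psi> w \<in> Z" for w using \<psi> by (auto simp: Z_def)
    have h: "h \<in> step_functions \<Gamma> r"
      unfolding step_functions_def
    proof (intro CollectI conjI allI exI)
      show "h = (\<lambda>w. (\<lambda>p. f t (fst p ! i) u (snd p)) (\<Gamma> w))"
        using i by (simp add: h_def \<Gamma>_def fun_eq_iff)
      fix w
      have "norm (h w) \<le> c * (1 + norm (\<psi> w))" using t(1) by (simp add: h_def regular_time_def)
      then show "norm (h w) \<le> r" using r(2)[OF \<psi>Z[of w]] by linarith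
    qed
    have \<psi>m: "\<psi> \<in> borel_measurable \<mu>" by (rule borel_measurable_simple_function[OF \<psi>s[OF \<psi>]])
    have hm: "h \<in> borel_measurable \<mu>" using step_functions_V[OF \<Gamma> r(1)] h square_integrableD by blast
    have "(\<lambda>w. dyn t \<psi> u w - h w) \<in> borel_measurable \<mu>"
      using dyn_measurable[OF t0 \<psi>m] hm by measurable
    then have dm: "dyn t \<psi> u - h \<in> borel_measurable \<mu>" by (simp add: fun_diff_def)
    have "norm ((dyn t \<psi> u - h) w) \<le> e" for w
      using osc[of t "\<psi> w" u w "\<sigma> w"] t0 t(2) \<psi>Z u U_subset[OF t0] \<sigma>(2)
      by (auto simp: dyn_def h_def)
    then have "N (dyn t \<psi> u - h) \<le> e * m" using bounded_square_integrable(2)[OF dm] e by simp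
    then show "\<exists>h\<in>step_functions \<Gamma> r. N (dyn t \<psi> u - h) \<le> e * m" using h by blast
  qed
qed

text \<open>
  The contraction behind total boundedness.  Outside a small set of times all velocities lie within
  \<open>k \<rho>\<close>, up to small errors, of a fixed set of step functions.  By the mean value inequality the increments
  over an interval of length at most \<open>1 / (2 k)\<close> are within \<open>\<rho> / 2\<close>, up to small errors, of a totally
  bounded set, and the initial states are totally bounded by assumption.
\<close>

lemma has_net_halve:
  assumes s: "0 \<le> s" "s < T" and ab: "s \<le> a" "a \<le> b" "b \<le> T" and kab: "k * (b - a) \<le> 1 / 2"
    and S: "\<And>X. X \<in> S \<Longrightarrow> is_solution s X" and SL: "S \<subseteq> sn.lip s T L" and L: "0 \<le> L"
    and start: "\<And>\<epsilon>. 0 < \<epsilon> \<Longrightarrow> sn.has_net \<epsilon> (reached S a a)"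
    and net: "sn.has_net \<rho> (reached S a b)" and \<rho>: "0 \<le> \<rho>" and \<epsilon>: "0 < \<epsilon>"
  shows "sn.has_net (\<rho> / 2 + \<epsilon>) (reached S a b)"
proof -
  define \<delta> where "\<delta> = b - a"
  have \<delta>: "0 \<le> \<delta>" "k * \<delta> \<le> 1 / 2" using ab kab by (simp_all add: \<delta>_def)
  \<comment> \<open>Tolerances: \<open>\<epsilon>1\<close> for simple functions, \<open>\<epsilon>2\<close> for rounding, \<open>\<epsilon>3\<close> for the mean value inequality, \<open>\<eta>\<close> for the measure of bad times; each contributes at most \<open>\<epsilon> / 8\<close> to an increment.\<close>
  define \<epsilon>1 where "\<epsilon>1 = \<epsilon> / 4"
  define \<epsilon>2 where "\<epsilon>2 = \<epsilon> / (8 * (\<delta> * m + 1))"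
  define \<epsilon>3 where "\<epsilon>3 = \<epsilon> / (8 * (\<delta> + 1))"
  define \<eta> where "\<eta> = \<epsilon> / (16 * (L + 1))"
  have dm: "0 \<le> \<delta> * m" using \<delta>(1) m_nonneg by simp
  have pos: "0 < \<epsilon>1" "0 < \<epsilon>2" "0 < \<epsilon>3" "0 < \<eta>"
    using \<epsilon> \<delta>(1) L dm by (simp_all add: \<epsilon>1_def \<epsilon>2_def \<epsilon>3_def \<eta>_def)
  have frac: "x * (\<epsilon> / (y * (x + 1))) \<le> \<epsilon> / y" if "0 \<le> x" "0 < y" for x y :: real
  proof -
    have "x * (\<epsilon> / (y * (x + 1))) = (x / (x + 1)) * (\<epsilon> / y)" by simp
    also have "\<dots> \<le> 1 * (\<epsilon> / y)" using that \<epsilon> by (intro mult_right_mono) simp_all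
    finally show ?thesis by simp
  qed
  have small: "(\<delta> * m) * \<epsilon>2 \<le> \<epsilon> / 8" "\<delta> * \<epsilon>3 \<le> \<epsilon> / 8" "L * \<eta> \<le> \<epsilon> / 16"
    unfolding \<epsilon>2_def \<epsilon>3_def \<eta>_def by (intro frac dm \<delta>(1) L; simp)+
  obtain F where F: "finite F" "F \<subseteq> V" "\<And>x. x \<in> reached S a b \<Longrightarrow> \<exists>\<phi>\<in>F. N (x - \<phi>) \<le> \<rho>"
    using net unfolding sn.has_net_def by blast
  have "\<exists>\<psi>. simple_function \<mu> \<psi> \<and> \<psi> \<in> V \<and> N (\<phi> - \<psi>) \<le> \<epsilon>1" if "\<phi> \<in> F" for \<phi>
    using simple_function_dense_L2[OF _ pos(1)] F(2) that by blast
  then obtain \<Psi> where \<Psi>: "\<And>\<phi>. \<phi> \<in> F \<Longrightarrow> simple_function \<mu> (\<Psi> \<phi>) \<and> \<Psi> \<phi> \<in> V \<and> N (\<phi> - \<Psi> \<phi>) \<le> \<epsilon>1"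
    by metis
  have "\<exists>\<psi>s. set \<psi>s = \<Psi> ` F" by (intro finite_list finite_imageI F(1))
  then obtain \<psi>s where \<psi>s: "set \<psi>s = \<Psi> ` F" ..
  have \<psi>simple: "simple_function \<mu> \<psi>" if "\<psi> \<in> set \<psi>s" for \<psi> using that \<Psi> \<psi>s by auto
  obtain \<Gamma> :: "'w \<Rightarrow> (real^'n) list \<times> 'w" and r B where \<Gamma>: "simple_function \<mu> \<Gamma>" "0 \<le> r"
    and B: "B \<in> sets lebesgue" "emeasure lebesgue B < ennreal \<eta>"
    and near: "\<And>t u \<psi>. regular_time t \<Longrightarrow> t \<notin> B \<Longrightarrow> u \<in> U t \<Longrightarrow> \<psi> \<in> set \<psi>s \<Longrightarrow>
       \<exists>h\<in>step_functions \<Gamma> r. N (dyn t \<psi> u - h) \<le> \<epsilon>2 * m"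
    using velocities_near_step_functions[OF \<psi>simple pos(2) pos(4)] by metis
  define C where "C = step_functions \<Gamma> r"
  have CV: "C \<subseteq> V" unfolding C_def by (rule step_functions_V[OF \<Gamma>])
  define \<kappa> where "\<kappa> = k * (\<rho> + \<epsilon>1) + \<epsilon>2 * m"
  define D where "D = {v \<in> V. \<exists>h\<in>C. N (v - h) \<le> \<kappa>}"
  have \<kappa>0: "0 \<le> \<kappa>" using k_pos \<rho> pos m_nonneg by (simp add: \<kappa>_def)
  have D: "convex D" "D \<subseteq> V" "0 \<in> D"
  proof -
    show "convex D" unfolding D_def using convex_step_functions CV by (intro sn.convex_fatten) (auto simp: C_def)
    show "D \<subseteq> V" by (auto simp: D_def)
    have "0 \<in> C" using \<Gamma>(2) unfolding C_def step_functions_def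
      by (intro CollectI conjI exI[of _ "\<lambda>_. 0"]) (auto simp: zero_fun_def)
    then show "0 \<in> D" using \<kappa>0 by (auto simp: D_def intro!: bexI[of _ 0])
  qed
  have velocity: "dyn t (X t) u \<in> D"
    if "X \<in> S" "t \<in> {a..b}" "regular_time t" "t \<notin> B" "u \<in> U t" for X t u
  proof -
    have XV: "X t \<in> V" using S[OF that(1)] that(2) ab by (auto simp: is_solution_def)
    have "X t \<in> reached S a b" using that(1,2) by (rule reachedI)
    then obtain \<phi> where \<phi>: "\<phi> \<in> F" "N (X t - \<phi>) \<le> \<rho>" using F(3) by blast
    have V: "\<Psi> \<phi> \<in> V" "\<phi> \<in> V" using \<Psi> F(2) \<phi>(1) by auto
    have "N (X t - \<Psi> \<phi>) \<le> \<rho> + \<epsilon>1"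
      using sn.N_tri[OF XV V(2,1)] \<phi>(2) \<Psi>[OF \<phi>(1)] by linarith
    then have 1: "N (dyn t (X t) u - dyn t (\<Psi> \<phi>) u) \<le> k * (\<rho> + \<epsilon>1)"
      using dyn_lipschitz[OF that(3) XV V(1), of u] k_pos by (smt (verit) mult_left_mono)
    have "\<Psi> \<phi> \<in> set \<psi>s" using \<psi>s \<phi>(1) by simp
    then have "\<exists>h\<in>C. N (dyn t (\<Psi> \<phi>) u - h) \<le> \<epsilon>2 * m"
      unfolding C_def by (rule near[OF that(3,4,5)])
    then obtain h where h: "h \<in> C" "N (dyn t (\<Psi> \<phi>) u - h) \<le> \<epsilon>2 * m" by blast
    have "N (dyn t (X t) u - h) \<le> N (dyn t (X t) u - dyn t (\<Psi> \<phi>) u) + N (dyn t (\<Psi> \<phi>) u - h)"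
      using dyn_growth(1)[OF that(3)] XV V h(1) CV by (intro sn.N_tri) auto
    then have "N (dyn t (X t) u - h) \<le> \<kappa>" using 1 h(2) by (simp add: \<kappa>_def)
    then show ?thesis unfolding D_def using dyn_growth(1)[OF that(3) XV] h(1) by blast
  qed
  have increment: "\<exists>h\<in>step_functions \<Gamma> (\<delta> * r). N (X t - X a - h) \<le> \<rho> / 2 + \<epsilon> / 2"
    if X: "X \<in> S" and t: "t \<in> {a..b}" for X t
  proof -
    have XV: "X \<tau> \<in> V" if "\<tau> \<in> {a..b}" for \<tau> using S[OF X] that ab by (auto simp: is_solution_def)
    have at: "a \<le> t" "t \<le> T" "t - a \<le> \<delta>" using t ab by (auto simp: \<delta>_def)
    have "AE \<tau> in lebesgue_on {a..t}. regular_time \<tau>"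
      by (rule AE_lebesgue_on_subset[OF AE_regular_time[OF s(1)] ab(1) at(2)])
    moreover have "AE \<tau> in lebesgue_on {a..t}. \<exists>u\<in>U \<tau>. sn.has_deriv {s..T} X (dyn \<tau> (X \<tau>) u) \<tau>"
      by (rule AE_lebesgue_on_subset[OF _ ab(1) at(2)]) (use S[OF X] in \<open>simp add: is_solution_def\<close>)
    moreover have "AE \<tau> in lebesgue_on {a..t}. \<tau> \<in> {a..t}" by (rule AE_I2) simp
    ultimately have der: "AE \<tau> in lebesgue_on {a..t}. \<tau> \<notin> B \<longrightarrow> (\<exists>v\<in>D. sn.has_deriv {a..t} X v \<tau>)"
    proof eventually_elim
      fix \<tau> assume \<tau>: "regular_time \<tau>" "\<exists>u\<in>U \<tau>. sn.has_deriv {s..T} X (dyn \<tau> (X \<tau>) u) \<tau>" "\<tau> \<in> {a..t}"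
      then obtain u where u: "u \<in> U \<tau>" "sn.has_deriv {s..T} X (dyn \<tau> (X \<tau>) u) \<tau>" by blast
      have "{a..t} \<subseteq> {s..T}" "\<tau> \<in> {a..b}" using ab at \<tau>(3) t by auto
      then show "\<tau> \<notin> B \<longrightarrow> (\<exists>v\<in>D. sn.has_deriv {a..t} X v \<tau>)"
        using velocity[OF X _ \<tau>(1) _ u(1)] sn.has_deriv_subset[OF u(2)] by blast
    qed
    have XL: "X \<in> sn.lip s T L" using SL X by blast
    obtain d where d: "d \<in> D" "N (X t - X a - (t - a) *\<^sub>R d) \<le> \<epsilon>3 * (t - a) + L * (2 * \<eta>)"
      using sn.mean_value_lip[OF ab(1) at(1,2) s(2) XL D B pos(4) der pos(3)] by blast
    obtain h where h: "h \<in> C" "N (d - h) \<le> \<kappa>" "d \<in> V" using d(1) by (auto simp: D_def)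
    have hV: "h \<in> V" using h(1) CV by blast
    obtain H where H: "h = (\<lambda>w. H (\<Gamma> w))" "\<And>w. norm (h w) \<le> r" using h(1) by (auto simp: C_def step_functions_def)
    have "(t - a) *\<^sub>R h \<in> step_functions \<Gamma> (\<delta> * r)"
      unfolding step_functions_def
    proof (intro CollectI conjI exI allI)
      show "(t - a) *\<^sub>R h = (\<lambda>w. (\<lambda>p. (t - a) *\<^sub>R H p) (\<Gamma> w))" using H(1) by (simp add: fun_eq_iff)
      show "norm (((t - a) *\<^sub>R h) w) \<le> \<delta> * r" for w
        using H(2)[of w] at \<Gamma>(2) by (simp add: mult_mono)
    qed
    moreover have "N (X t - X a - (t - a) *\<^sub>R h) \<le> \<rho> / 2 + \<epsilon> / 2"
    proof -
      have 1: "N (X t - X a - (t - a) *\<^sub>R h) \<le> N (X t - X a - (t - a) *\<^sub>R d) + N ((t - a) *\<^sub>R d - (t - a) *\<^sub>R h)"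
        using XV t ab(2) h(3) hV by (intro sn.N_tri) auto
      have 2: "N ((t - a) *\<^sub>R d - (t - a) *\<^sub>R h) = (t - a) * N (d - h)"
        using sn.N_scale[of "d - h" "t - a"] h(3) hV at by (simp add: scaleR_diff_right)
      have 3: "(t - a) * N (d - h) \<le> \<delta> * \<kappa>"
        using at h(2) \<delta>(1) h(3) hV by (intro mult_mono) auto
      have 4: "\<delta> * \<kappa> = (k * \<delta>) * \<rho> + (k * \<delta>) * \<epsilon>1 + (\<delta> * m) * \<epsilon>2" by (simp add: \<kappa>_def algebra_simps)
      have 5: "(k * \<delta>) * \<rho> \<le> (1 / 2) * \<rho>" using \<delta>(2) \<rho> by (rule mult_right_mono)
      have 6: "(k * \<delta>) * \<epsilon>1 \<le> (1 / 2) * \<epsilon>1" using \<delta>(2) pos(1) by (intro mult_right_mono) auto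
      have 7: "\<epsilon>3 * (t - a) \<le> \<epsilon>3 * \<delta>" using at pos(3) by simp
      have "N (X t - X a - (t - a) *\<^sub>R h) \<le>
          \<epsilon>3 * \<delta> + L * (2 * \<eta>) + ((1 / 2) * \<rho> + (1 / 2) * \<epsilon>1 + (\<delta> * m) * \<epsilon>2)"
        using 1 2 3 4 5 6 7 d(2) by linarith
      moreover have "\<epsilon>3 * \<delta> \<le> \<epsilon> / 8" "L * (2 * \<eta>) \<le> \<epsilon> / 8" using small(2,3) by (simp_all add: mult.commute)
      moreover have "(1 / 2) * \<epsilon>1 = \<epsilon> / 8" by (simp add: \<epsilon>1_def)
      ultimately show ?thesis using small(1) by (simp add: field_simps)
    qed
    ultimately show ?thesis by blast
  qed
  have "0 < \<epsilon> / 4" "0 \<le> \<delta> * r" using \<epsilon> \<delta>(1) \<Gamma>(2) by simp_all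
  then have nets: "sn.has_net (\<epsilon> / 4) (reached S a a)" "sn.has_net (\<epsilon> / 4) (step_functions \<Gamma> (\<delta> * r))"
    using start has_net_step_functions[OF \<Gamma>(1)] by blast+
  obtain P where P: "finite P" "P \<subseteq> V" "\<And>x. x \<in> reached S a a \<Longrightarrow> \<exists>p\<in>P. N (x - p) \<le> \<epsilon> / 4"
    using nets(1) unfolding sn.has_net_def by blast
  obtain Q where Q: "finite Q" "Q \<subseteq> V" "\<And>h. h \<in> step_functions \<Gamma> (\<delta> * r) \<Longrightarrow> \<exists>q\<in>Q. N (h - q) \<le> \<epsilon> / 4"
    using nets(2) unfolding sn.has_net_def by blast
  have "\<exists>z\<in>(\<lambda>(p, q). p + q) ` (P \<times> Q). N (x - z) \<le> \<rho> / 2 + \<epsilon>" if x: "x \<in> reached S a b" for x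
  proof -
    obtain X t where X: "X \<in> S" "t \<in> {a..b}" "x = X t" using x by (auto simp: reached_def)
    have XV: "X \<tau> \<in> V" if "\<tau> \<in> {a..b}" for \<tau> using S[OF X(1)] that ab by (auto simp: is_solution_def)
    obtain h where h: "h \<in> step_functions \<Gamma> (\<delta> * r)" "N (X t - X a - h) \<le> \<rho> / 2 + \<epsilon> / 2"
      using increment[OF X(1,2)] by blast
    have hV: "h \<in> V" using h(1) step_functions_V[OF \<Gamma>(1) \<open>0 \<le> \<delta> * r\<close>] by blast
    obtain p where p: "p \<in> P" "N (X a - p) \<le> \<epsilon> / 4" using P(3)[OF reachedI[OF X(1)], of a] by auto
    obtain q where q: "q \<in> Q" "N (h - q) \<le> \<epsilon> / 4" using Q(3)[OF h(1)] by blast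
    have V: "X t \<in> V" "X a \<in> V" "p \<in> V" "q \<in> V" using XV X(2) ab(2) p(1) q(1) P(2) Q(2) by auto
    have 1: "X t - (p + q) = (X t - X a - h) + ((X a - p) + (h - q))" by simp
    have 2: "N ((X t - X a - h) + ((X a - p) + (h - q))) \<le> N (X t - X a - h) + N ((X a - p) + (h - q))"
      using V hV by (intro sn.N_triangle) auto
    have 3: "N ((X a - p) + (h - q)) \<le> N (X a - p) + N (h - q)" using V hV by (intro sn.N_triangle) auto
    have "N (X t - (p + q)) \<le> \<rho> / 2 + \<epsilon>"
      unfolding 1 using 2 3 h(2) p(2) q(2) by linarith
    then show ?thesis using p(1) q(1) X(3) by force
  qed
  moreover have "finite ((\<lambda>(p, q). p + q) ` (P \<times> Q))" using P(1) Q(1) by simp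
  moreover have "(\<lambda>(p, q). p + q) ` (P \<times> Q) \<subseteq> V" using P(2) Q(2) by auto
  ultimately show ?thesis unfolding sn.has_net_def by blast
qed

text \<open>
  With \<open>\<epsilon> = \<rho> / 4\<close> each application of the contraction multiplies the mesh by \<open>3 / 4\<close>.
\<close>

lemma has_net_short_time:
  assumes s: "0 \<le> s" "s < T" and ab: "s \<le> a" "a \<le> b" "b \<le> T" and kab: "k * (b - a) \<le> 1 / 2"
    and S: "\<And>X. X \<in> S \<Longrightarrow> is_solution s X" and SL: "S \<subseteq> sn.lip s T L" and L: "0 \<le> L"
    and R: "0 < R" "\<And>X t. X \<in> S \<Longrightarrow> t \<in> {s..T} \<Longrightarrow> N (X t) \<le> R"
    and start: "\<And>\<epsilon>. 0 < \<epsilon> \<Longrightarrow> sn.has_net \<epsilon> (reached S a a)" and \<epsilon>: "0 < \<epsilon>"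
  shows "sn.has_net \<epsilon> (reached S a b)"
proof -
  have net: "sn.has_net (R * (3 / 4) ^ n) (reached S a b)" for n
  proof (induction n)
    case 0
    have "\<forall>x\<in>reached S a b. N (x - 0) \<le> R" using R(2) ab by (auto simp: reached_def)
    then show ?case unfolding sn.has_net_def by (intro exI[of _ "{0}"]) auto
  next
    case (Suc n)
    have "sn.has_net (R * (3 / 4) ^ n / 2 + R * (3 / 4) ^ n / 4) (reached S a b)"
      by (rule has_net_halve[OF s ab kab S SL L start Suc.IH]) (use R(1) in auto)
    moreover have "R * (3 / 4) ^ n / 2 + R * (3 / 4) ^ n / 4 = R * (3 / 4) ^ Suc n" by simp
    ultimately show ?case by metis
  qed
  obtain n where "(3 / 4 :: real) ^ n < \<epsilon> / R"
    using real_arch_pow_inv[of "\<epsilon> / R" "3 / 4"] \<epsilon> R(1) by auto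
  then have "R * (3 / 4) ^ n \<le> \<epsilon>" using R(1) by (simp add: field_simps)
  then show ?thesis using sn.has_net_mono[OF net] by blast
qed

lemma reached_totally_bounded:
  assumes s: "0 \<le> s" "s < T"
    and S: "\<And>X. X \<in> S \<Longrightarrow> is_solution s X" and SL: "S \<subseteq> sn.lip s T L" and L: "0 \<le> L"
    and R: "0 < R" "\<And>X t. X \<in> S \<Longrightarrow> t \<in> {s..T} \<Longrightarrow> N (X t) \<le> R"
    and start: "\<And>\<epsilon>. 0 < \<epsilon> \<Longrightarrow> sn.has_net \<epsilon> (reached S s s)" and \<epsilon>: "0 < \<epsilon>"
  shows "sn.has_net \<epsilon> (reached S s T)"
proof -
  define \<delta> where "\<delta> = 1 / (2 * k)"
  have \<delta>: "0 < \<delta>" "k * \<delta> = 1 / 2" using k_pos by (simp_all add: \<delta>_def)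
  define b where "b n = min T (s + real n * \<delta>)" for n
  have b: "s \<le> b n" "b n \<le> b (Suc n)" "b n \<le> T" "b (Suc n) - b n \<le> \<delta>" for n
    using s \<delta>(1) by (auto simp: b_def min_def algebra_simps)
  have "\<forall>\<epsilon>>0. sn.has_net \<epsilon> (reached S s (b n))" for n
  proof (induction n)
    case 0
    have "b 0 = s" using s by (simp add: b_def)
    then show ?case using start by simp
  next
    case (Suc n)
    have "reached S (b n) (b n) \<subseteq> reached S s (b n)" using b(1)[of n] by (auto simp: reached_def)
    then have st: "sn.has_net e (reached S (b n) (b n))" if "0 < e" for e
      using Suc that sn.has_net_subset by blast
    have kb: "k * (b (Suc n) - b n) \<le> 1 / 2"
      using b(4)[of n] k_pos \<delta>(2) by (metis less_imp_le mult_left_mono)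
    have "sn.has_net e (reached S (b n) (b (Suc n)))" if "0 < e" for e
      by (rule has_net_short_time[OF s b(1)[of n] b(2)[of n] b(3)[of "Suc n"] kb S SL L R(1) _ st that])
        (assumption | rule R(2))+
    then have "sn.has_net e (reached S s (b n) \<union> reached S (b n) (b (Suc n)))" if "0 < e" for e
      using Suc that sn.has_net_Un by blast
    moreover have "reached S s (b (Suc n)) \<subseteq> reached S s (b n) \<union> reached S (b n) (b (Suc n))"
    proof
      fix x assume "x \<in> reached S s (b (Suc n))"
      then obtain X t where X: "X \<in> S" "t \<in> {s..b (Suc n)}" "x = X t" by (auto simp: reached_def)
      then have "t \<in> {s..b n} \<or> t \<in> {b n..b (Suc n)}" by auto
      then show "x \<in> reached S s (b n) \<union> reached S (b n) (b (Suc n))"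
        using reachedI[OF X(1)] X(3) by blast
    qed
    ultimately show ?case using sn.has_net_subset by blast
  qed
  moreover obtain n where "(T - s) / \<delta> \<le> real n" using real_arch_simple by blast
  then have "b n = T" using \<delta>(1) by (simp add: b_def field_simps)
  ultimately show ?thesis using \<epsilon> by metis
qed

section \<open>Limits of solutions are solutions\<close>

text \<open>
  The union of the classes in \<^const>\<open>F_dyn\<close>: membership allows for modification on null sets, so that
  the set is convex as a set of functions.
\<close>

definition velocity_set :: "real \<Rightarrow> ('w \<Rightarrow> real^'n) \<Rightarrow> ('w \<Rightarrow> real^'n) set" where
  "velocity_set t h = {v \<in> V. \<exists>u\<in>U t. N (v - dyn t h u) = 0}"

lemma N_eq_0_iff:
  assumes "h \<in> V" "g \<in> V"
  shows "N (h - g) = 0 \<longleftrightarrow> (AE w in \<mu>. h w = g w)"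
  using assms l2norm_diff_eq_0_iff(2)[of h \<mu> g] by (simp add: square_integrable_def fun_diff_def)

lemma convex_velocity_set:
  assumes t: "regular_time t" and h: "h \<in> V"
  shows "convex (velocity_set t h)"
proof (rule convexI)
  fix x y and p q :: real
  assume *: "x \<in> velocity_set t h" "y \<in> velocity_set t h" "0 \<le> p" "0 \<le> q" "p + q = 1"
  have t0: "t \<in> {0..T}" using t by (simp add: regular_time_def)
  define \<phi> where "\<phi> = ae_class \<mu> h"
  have hm: "h \<in> borel_measurable \<mu>" using h by (rule square_integrableD)
  have \<phi>: "\<phi> \<in> L2 \<mu>" using h by (auto simp: \<phi>_def L2_def square_integrable_def)
  have dynV: "dyn t h u \<in> V" for u by (rule dyn_growth(1)[OF t h])
  have class_eq: "ae_class \<mu> (\<lambda>w. f t (rep \<phi> w) u w) = ae_class \<mu> (dyn t h u)" for u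
  proof -
    have "(\<lambda>w. f t (rep \<phi> w) u w) \<in> borel_measurable \<mu>"
      using dyn_measurable[OF t0 rep_L2(1)[OF \<phi>]] by (simp add: dyn_def)
    moreover have "AE w in \<mu>. f t (rep \<phi> w) u w = dyn t h u w"
      using rep_ae_class(2)[OF hm] by (auto simp: \<phi>_def dyn_def elim!: eventually_mono)
    ultimately show ?thesis using ae_class_eq_iff by blast
  qed
  obtain u1 u2 where u: "u1 \<in> U t" "N (x - dyn t h u1) = 0" "u2 \<in> U t" "N (y - dyn t h u2) = 0"
    and V: "x \<in> V" "y \<in> V"
    using * by (auto simp: velocity_set_def)
  define A where "A = ae_class \<mu> (dyn t h u1)"
  define B where "B = ae_class \<mu> (dyn t h u2)"
  have AB: "A \<in> F_dyn \<mu> U f t \<phi>" "B \<in> F_dyn \<mu> U f t \<phi>"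
    using u(1,3) class_eq by (auto simp: F_dyn_def A_def B_def)
  then have "ae_class \<mu> (\<lambda>w. (1 - q) *\<^sub>R rep A w + q *\<^sub>R rep B w) \<in> F_dyn \<mu> U f t \<phi>"
    using F_convex[OF t0 \<phi>] * unfolding L2_convex_def by auto
  then obtain u3 where u3: "u3 \<in> U t"
    "ae_class \<mu> (\<lambda>w. (1 - q) *\<^sub>R rep A w + q *\<^sub>R rep B w) = ae_class \<mu> (dyn t h u3)"
    using class_eq by (auto simp: F_dyn_def)
  note [measurable] = square_integrableD[OF dynV]
  note rm [measurable] = rep_ae_class(1)[OF square_integrableD[OF dynV]]
  have "(\<lambda>w. (1 - q) *\<^sub>R rep A w + q *\<^sub>R rep B w) \<in> borel_measurable \<mu>"
    unfolding A_def B_def by measurable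
  then have "AE w in \<mu>. (1 - q) *\<^sub>R rep A w + q *\<^sub>R rep B w = dyn t h u3 w"
    using u3(2) ae_class_eq_iff by blast
  moreover have "AE w in \<mu>. rep A w = dyn t h u1 w" "AE w in \<mu>. rep B w = dyn t h u2 w"
    unfolding A_def B_def by (rule rep_ae_class(2)[OF square_integrableD[OF dynV]])+
  moreover have "AE w in \<mu>. x w = dyn t h u1 w" "AE w in \<mu>. y w = dyn t h u2 w"
    using u N_eq_0_iff V dynV by blast+
  ultimately have "AE w in \<mu>. (p *\<^sub>R x + q *\<^sub>R y) w = dyn t h u3 w"
  proof eventually_elim
    case (elim w)
    have "p = 1 - q" using *(5) by simp
    then show ?case using elim by simp
  qed
  moreover have pq: "p *\<^sub>R x + q *\<^sub>R y \<in> V" using V by auto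
  ultimately have "N (p *\<^sub>R x + q *\<^sub>R y - dyn t h u3) = 0" using N_eq_0_iff dynV by blast
  then show "p *\<^sub>R x + q *\<^sub>R y \<in> velocity_set t h"
    using pq u3(1) by (auto simp: velocity_set_def)
qed

text \<open>
  At almost every \<open>t\<close> the convex combinations \<open>z\<^sub>j\<close> have derivatives close to the convex set of velocities at
  \<open>Y t\<close>, because the velocities of \<open>X\<^sub>j\<close> at \<open>t\<close> are within \<open>k N (X\<^sub>j t - Y t)\<close> of it.  Compactness of \<open>U t\<close>
  selects a convergent subsequence of the controls involved, and the corresponding limit velocity is the
  derivative of \<open>Y\<close>.
\<close>

lemma limit_of_solutions_deriv:
  assumes s: "0 \<le> s" "s < T"
    and X: "\<And>j::nat. is_solution s (X j)" "\<And>j. X j \<in> sn.lip s T L" and Y: "Y \<in> sn.lip s T L"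
    and lim: "\<And>t. t \<in> {s..T} \<Longrightarrow> (\<lambda>j. N (X j t - Y t)) \<longlonglongrightarrow> 0"
  shows "AE t in lebesgue_on {s..T}. \<exists>u\<in>U t. sn.has_deriv {s..T} Y (dyn t (Y t) u) t"
proof -
  obtain z where z: "\<And>j. z j \<in> convex hull (X ` {j..})"
    and zY: "AE t in lebesgue_on {s..T}. \<forall>\<^sub>F j in sequentially. \<forall>\<tau>\<in>{s..T}.
       N ((z j \<tau> - Y \<tau>) - (z j t - Y t)) \<le> (1/2) ^ j * \<bar>\<tau> - t\<bar>"
    using sn.convex_combinations_approximate[OF s(2) X(2) Y lim] by blast
  have "AE t in lebesgue_on {s..T}. regular_time t" by (rule AE_regular_time[OF s(1)])
  moreover have "AE t in lebesgue_on {s..T}. t \<in> {s..T}" by (rule AE_I2) simp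
  moreover have "AE t in lebesgue_on {s..T}. \<forall>j. \<exists>u\<in>U t. sn.has_deriv {s..T} (X j) (dyn t (X j t) u) t"
    using X(1) by (intro AE_all_countable[THEN iffD2]) (simp add: is_solution_def)
  ultimately show ?thesis
    using zY
  proof eventually_elim
    fix t assume t: "regular_time t" "t \<in> {s..T}"
      and dX: "\<forall>j. \<exists>u\<in>U t. sn.has_deriv {s..T} (X j) (dyn t (X j t) u) t"
      and zYt: "\<forall>\<^sub>F j in sequentially. \<forall>\<tau>\<in>{s..T}. N ((z j \<tau> - Y \<tau>) - (z j t - Y t)) \<le> (1/2) ^ j * \<bar>\<tau> - t\<bar>"
    have t0: "t \<in> {0..T}" using t(1) by (simp add: regular_time_def)
    have XV: "X j \<tau> \<in> V" if "\<tau> \<in> {s..T}" for j \<tau> using sn.lip_V[OF X(2) that] .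
    have YV: "Y \<tau> \<in> V" if "\<tau> \<in> {s..T}" for \<tau> using sn.lip_V[OF Y that] .
    have zV: "z j \<tau> \<in> V" if "\<tau> \<in> {s..T}" for j \<tau>
      using sn.lip_V that z sn.convex_hull_tail_lip[of X s T L] X(2) by blast
    define W where "W e = {v \<in> V. \<exists>g\<in>velocity_set t (Y t). N (v - g) \<le> e}" for e
    have W: "convex (W e)" for e
      unfolding W_def using convex_velocity_set[OF t(1) YV[OF t(2)]]
      by (intro sn.convex_fatten) (auto simp: velocity_set_def)
    have near: "\<exists>J. \<forall>j\<ge>J. \<exists>w\<in>W e. sn.has_deriv {s..T} (z j) w t" if e: "e > 0" for e
    proof -
      obtain J where J: "\<And>j. j \<ge> J \<Longrightarrow> norm (N (X j t - Y t) - 0) < e / k"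
        using LIMSEQ_D[OF lim[OF t(2)], of "e / k"] e k_pos by auto
      define Q where "Q = {x. (\<forall>\<tau>\<in>{s..T}. x \<tau> \<in> V) \<and> (\<exists>w\<in>W e. sn.has_deriv {s..T} x w t)}"
      have "convex Q"
      proof (rule convexI)
        fix x y and p q :: real
        assume *: "x \<in> Q" "y \<in> Q" "0 \<le> p" "0 \<le> q" "p + q = 1"
        then obtain v w where vw: "v \<in> W e" "sn.has_deriv {s..T} x v t" "w \<in> W e" "sn.has_deriv {s..T} y w t"
          by (auto simp: Q_def)
        have "sn.has_deriv {s..T} (p *\<^sub>R x + q *\<^sub>R y) (p *\<^sub>R v + q *\<^sub>R w) t"
          using * t(2) vw by (intro sn.has_deriv_combination) (auto simp: Q_def)
        moreover have "p *\<^sub>R v + q *\<^sub>R w \<in> W e" using convexD[OF W vw(1,3) *(3-5)] .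
        ultimately show "p *\<^sub>R x + q *\<^sub>R y \<in> Q" using * by (auto simp: Q_def)
      qed
      moreover have "X j \<in> Q" if "j \<ge> J" for j
      proof -
        obtain u where u: "u \<in> U t" "sn.has_deriv {s..T} (X j) (dyn t (X j t) u) t" using dX by blast
        have dV: "dyn t (Y t) u \<in> V" "dyn t (X j t) u \<in> V"
          using dyn_growth(1)[OF t(1)] XV YV t(2) by blast+
        have "N (dyn t (X j t) u - dyn t (Y t) u) \<le> k * N (X j t - Y t)"
          using dyn_lipschitz[OF t(1) XV YV] t(2) by blast
        also have "\<dots> \<le> k * (e / k)" using J[OF that] k_pos by (intro mult_left_mono) auto
        also have "\<dots> = e" using k_pos by simp
        finally have le: "N (dyn t (X j t) u - dyn t (Y t) u) \<le> e" .
        have "dyn t (Y t) u \<in> velocity_set t (Y t)"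
          unfolding velocity_set_def using u(1) dV(1) by (intro CollectI conjI bexI[of _ u]) simp_all
        then have "dyn t (X j t) u \<in> W e" using le dV(2) by (auto simp: W_def)
        then show ?thesis unfolding Q_def using u(2) XV by blast
      qed
      ultimately have "convex hull (X ` {j..}) \<subseteq> Q" if "j \<ge> J" for j
        using that by (intro hull_minimal) auto
      then show ?thesis using z by (fastforce simp: Q_def)
    qed
    define e where "e n = inverse (real (Suc n))" for n
    have e: "e n > 0" for n by (simp add: e_def)
    have "\<exists>j w u. w \<in> V \<and> u \<in> U t \<and> N (w - dyn t (Y t) u) \<le> e n \<and> sn.has_deriv {s..T} (z j) w t \<and>
        (\<forall>\<tau>\<in>{s..T}. N ((z j \<tau> - Y \<tau>) - (z j t - Y t)) \<le> e n * \<bar>\<tau> - t\<bar>)" for n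
    proof -
      obtain J1 where J1: "\<And>j. j \<ge> J1 \<Longrightarrow> \<exists>w\<in>W (e n). sn.has_deriv {s..T} (z j) w t"
        using near[OF e] by blast
      obtain J2 where J2: "\<And>j \<tau>. j \<ge> J2 \<Longrightarrow> \<tau> \<in> {s..T} \<Longrightarrow>
          N ((z j \<tau> - Y \<tau>) - (z j t - Y t)) \<le> (1/2) ^ j * \<bar>\<tau> - t\<bar>"
        using zYt unfolding eventually_sequentially by blast
      obtain J3 where J3: "(1/2 :: real) ^ J3 < e n"
        using real_arch_pow_inv[OF e[of n], of "1/2"] by auto
      define j where "j = max J1 (max J2 J3)"
      have "(1/2 :: real) ^ j \<le> (1/2) ^ J3" by (intro power_decreasing) (auto simp: j_def)
      then have small: "(1/2 :: real) ^ j \<le> e n" using J3 by linarith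
      obtain w where w: "w \<in> W (e n)" "sn.has_deriv {s..T} (z j) w t" using J1[of j] by (auto simp: j_def)
      obtain g u where g: "w \<in> V" "N (w - g) \<le> e n" "u \<in> U t" "N (g - dyn t (Y t) u) = 0" "g \<in> V"
        using w(1) by (auto simp: W_def velocity_set_def)
      have "N (w - dyn t (Y t) u) \<le> N (w - g) + N (g - dyn t (Y t) u)"
        using g dyn_growth(1)[OF t(1) YV[OF t(2)]] by (intro sn.N_tri) auto
      then have "N (w - dyn t (Y t) u) \<le> e n" using g by simp
      moreover have "N ((z j \<tau> - Y \<tau>) - (z j t - Y t)) \<le> e n * \<bar>\<tau> - t\<bar>" if "\<tau> \<in> {s..T}" for \<tau>
      proof -
        have "N ((z j \<tau> - Y \<tau>) - (z j t - Y t)) \<le> (1/2) ^ j * \<bar>\<tau> - t\<bar>"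
          by (rule J2[OF _ that]) (simp add: j_def)
        also have "\<dots> \<le> e n * \<bar>\<tau> - t\<bar>" using small by (rule mult_right_mono) simp
        finally show ?thesis .
      qed
      ultimately show ?thesis using w(2) g(1,3) by blast
    qed
    then obtain j w u where jwu: "\<And>n. w n \<in> V" "\<And>n. u n \<in> U t" "\<And>n. N (w n - dyn t (Y t) (u n)) \<le> e n"
      "\<And>n. sn.has_deriv {s..T} (z (j n)) (w n) t"
      "\<And>n \<tau>. \<tau> \<in> {s..T} \<Longrightarrow> N ((z (j n) \<tau> - Y \<tau>) - (z (j n) t - Y t)) \<le> e n * \<bar>\<tau> - t\<bar>"
      by metis
    obtain u0 r where r: "u0 \<in> U t" "strict_mono r" "(u \<circ> r) \<longlonglongrightarrow> u0"
      using compact_U[OF t0] jwu(2) unfolding compact_def by metis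
    define v where "v = dyn t (Y t) u0"
    have dV: "dyn t (Y t) u' \<in> V" for u' using dyn_growth(1)[OF t(1) YV[OF t(2)]] .
    have dlim: "(\<lambda>n. N (dyn t (Y t) ((u \<circ> r) n) - v)) \<longlonglongrightarrow> 0"
      unfolding v_def by (rule dyn_continuous_control[OF t(1) YV[OF t(2)] r(3)])
    have elim: "(\<lambda>n. e (r n)) \<longlonglongrightarrow> 0"
      using LIMSEQ_subseq_LIMSEQ[OF LIMSEQ_inverse_real_of_nat r(2)] by (simp add: e_def comp_def)
    have "sn.has_deriv {s..T} Y v t"
    proof (subst sn.has_deriv_iff[OF YV t(2)], assumption, intro conjI allI impI)
      show "v \<in> V" unfolding v_def by (rule dV)
      fix \<epsilon> :: real assume \<epsilon>: "\<epsilon> > 0"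
      then have \<epsilon>4: "\<epsilon> / 4 > 0" by simp
      have "\<forall>\<^sub>F n in sequentially. N (dyn t (Y t) ((u \<circ> r) n) - v) < \<epsilon> / 4"
        by (rule order_tendstoD(2)[OF dlim \<epsilon>4])
      moreover have "\<forall>\<^sub>F n in sequentially. e (r n) < \<epsilon> / 4" by (rule order_tendstoD(2)[OF elim \<epsilon>4])
      ultimately have "\<forall>\<^sub>F n in sequentially. N (dyn t (Y t) ((u \<circ> r) n) - v) < \<epsilon> / 4 \<and> e (r n) < \<epsilon> / 4"
        by (rule eventually_conj)
      then obtain n where n: "N (dyn t (Y t) (u (r n)) - v) < \<epsilon> / 4" "e (r n) < \<epsilon> / 4"
        unfolding eventually_sequentially by auto
      define i where "i = r n"
      have wv: "N (w i - v) \<le> \<epsilon> / 4 + \<epsilon> / 4"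
        using sn.N_tri[OF jwu(1)[of i] dV[of "u i"], of v] jwu(3)[of i] n dV[of u0]
        unfolding i_def v_def by simp
      obtain d where d: "d > 0" "\<And>\<tau>. \<tau> \<in> {s..T} \<Longrightarrow> \<bar>\<tau> - t\<bar> < d \<Longrightarrow>
          N (z (j i) \<tau> - z (j i) t - (\<tau> - t) *\<^sub>R w i) \<le> \<epsilon> / 4 * \<bar>\<tau> - t\<bar>"
        using jwu(4)[of i] \<epsilon>4 sn.has_deriv_iff[of "{s..T}" "z (j i)" t "w i"] zV t(2) by blast
      show "\<exists>d>0. \<forall>\<tau>\<in>{s..T}. \<bar>\<tau> - t\<bar> < d \<longrightarrow> N (Y \<tau> - Y t - (\<tau> - t) *\<^sub>R v) \<le> \<epsilon> * \<bar>\<tau> - t\<bar>"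
      proof (intro exI[of _ d] conjI d(1) ballI impI)
        fix \<tau> assume \<tau>: "\<tau> \<in> {s..T}" "\<bar>\<tau> - t\<bar> < d"
        define a where "a = (z (j i) \<tau> - Y \<tau>) - (z (j i) t - Y t)"
        define b where "b = z (j i) \<tau> - z (j i) t - (\<tau> - t) *\<^sub>R w i"
        define g where "g = (\<tau> - t) *\<^sub>R (w i - v)"
        have V: "a \<in> V" "b \<in> V" "g \<in> V"
          unfolding a_def b_def g_def v_def using zV YV \<tau>(1) t(2) jwu(1) dV by auto
        have eq: "Y \<tau> - Y t - (\<tau> - t) *\<^sub>R v = (b - a) + g"
          by (simp add: a_def b_def g_def algebra_simps)
        have 1: "N ((b - a) + g) \<le> N b + N a + N g"
          using sn.N_triangle[of "b - a" g] sn.N_diff_le[of b a] V by auto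
        have 2: "N b \<le> \<epsilon> / 4 * \<bar>\<tau> - t\<bar>" unfolding b_def by (rule d(2)[OF \<tau>])
        have 3: "N a \<le> e i * \<bar>\<tau> - t\<bar>" unfolding a_def by (rule jwu(5)[OF \<tau>(1)])
        have 4: "e i * \<bar>\<tau> - t\<bar> \<le> \<epsilon> / 4 * \<bar>\<tau> - t\<bar>" using n(2) by (intro mult_right_mono) (auto simp: i_def)
        have 5: "N g = \<bar>\<tau> - t\<bar> * N (w i - v)"
          unfolding g_def using jwu(1) dV by (intro sn.N_scale) (auto simp: v_def)
        have 6: "\<bar>\<tau> - t\<bar> * N (w i - v) \<le> \<bar>\<tau> - t\<bar> * (\<epsilon> / 4 + \<epsilon> / 4)" using wv by (intro mult_left_mono) auto
        have 7: "\<epsilon> / 4 * \<bar>\<tau> - t\<bar> + \<epsilon> / 4 * \<bar>\<tau> - t\<bar> + \<bar>\<tau> - t\<bar> * (\<epsilon> / 4 + \<epsilon> / 4) = \<epsilon> * \<bar>\<tau> - t\<bar>"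
          by (simp add: field_simps)
        show "N (Y \<tau> - Y t - (\<tau> - t) *\<^sub>R v) \<le> \<epsilon> * \<bar>\<tau> - t\<bar>"
          unfolding eq using 1 2 3 4 5 6 7 by linarith
      qed
    qed
    then show "\<exists>u\<in>U t. sn.has_deriv {s..T} Y (dyn t (Y t) u) t"
      using r(1) unfolding v_def by blast
  qed
qed

section \<open>Compactness of the set of trajectories\<close>

lemma rep_in_V: "A \<in> L2 \<mu> \<Longrightarrow> rep A \<in> V"
  using rep_L2[of A \<mu>] by (simp add: square_integrable_def)

lemma L2_dist_eq: "L2_dist \<mu> A B = N (rep A - rep B)"
  by (simp add: L2_dist_def fun_diff_def)

lemma has_L2_derivative_iff:
  assumes t: "regular_time t" "t \<in> I" and x: "\<And>\<tau>. \<tau> \<in> I \<Longrightarrow> x \<tau> \<in> L2 \<mu>"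
  shows "has_L2_derivative \<mu> I x (ae_class \<mu> (dyn t (rep (x t)) u)) t \<longleftrightarrow>
    sn.has_deriv I (\<lambda>\<tau>. rep (x \<tau>)) (dyn t (rep (x t)) u) t"
proof -
  define v where "v = dyn t (rep (x t)) u"
  have v: "v \<in> V" unfolding v_def by (rule dyn_growth(1)[OF t(1) rep_in_V[OF x[OF t(2)]]])
  note vm [measurable] = square_integrableD[OF v]
  note [measurable] = rep_ae_class(1)[OF vm]
  have "ae_class \<mu> v \<in> L2 \<mu>" using v by (auto simp: L2_def square_integrable_def)
  moreover have "l2norm \<mu> (\<lambda>w. (rep (x \<tau>) w - rep (x t) w) /\<^sub>R (\<tau> - t) - rep (ae_class \<mu> v) w) =
      N ((rep (x \<tau>) - rep (x t)) /\<^sub>R (\<tau> - t) - v)" if "\<tau> \<in> I" for \<tau>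
  proof -
    note [measurable] = rep_L2(1)[OF x[OF that]] rep_L2(1)[OF x[OF t(2)]]
    have "l2norm \<mu> (\<lambda>w. (rep (x \<tau>) w - rep (x t) w) /\<^sub>R (\<tau> - t) - rep (ae_class \<mu> v) w) =
        l2norm \<mu> (\<lambda>w. (rep (x \<tau>) w - rep (x t) w) /\<^sub>R (\<tau> - t) - v w)"
      by (rule l2norm_cong_AE) (use rep_ae_class(2)[OF vm] in \<open>auto elim: eventually_mono\<close>)
    also have "(\<lambda>w. (rep (x \<tau>) w - rep (x t) w) /\<^sub>R (\<tau> - t) - v w) = (rep (x \<tau>) - rep (x t)) /\<^sub>R (\<tau> - t) - v"
      by (simp add: fun_eq_iff)
    finally show ?thesis .
  qed
  then have "((\<lambda>\<tau>. l2norm \<mu> (\<lambda>w. (rep (x \<tau>) w - rep (x t) w) /\<^sub>R (\<tau> - t) - rep (ae_class \<mu> v) w)) \<longlongrightarrow> 0) (at t within I)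
      \<longleftrightarrow> ((\<lambda>\<tau>. N ((rep (x \<tau>) - rep (x t)) /\<^sub>R (\<tau> - t) - v)) \<longlongrightarrow> 0) (at t within I)"
    by (intro tendsto_cong) (auto simp: eventually_at_filter)
  ultimately show ?thesis
    unfolding has_L2_derivative_def sn.has_deriv_def v_def[symmetric] using v by simp
qed

lemma F_dyn_eq: "F_dyn \<mu> U f t \<phi> = (\<lambda>u. ae_class \<mu> (dyn t (rep \<phi>) u)) ` U t"
  by (simp add: F_dyn_def dyn_def)

lemma derivative_inclusion_iff:
  assumes s: "0 \<le> s" and x: "\<And>t. t \<in> {s..T} \<Longrightarrow> x t \<in> L2 \<mu>"
  shows "(AE t in lebesgue_on {s..T}. \<exists>v\<in>F_dyn \<mu> U f t (x t). has_L2_derivative \<mu> {s..T} x v t) \<longleftrightarrow>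
    (AE t in lebesgue_on {s..T}. \<exists>u\<in>U t. sn.has_deriv {s..T} (\<lambda>\<tau>. rep (x \<tau>)) (dyn t (rep (x t)) u) t)"
proof -
  have "AE t in lebesgue_on {s..T}. t \<in> {s..T}" by (rule AE_I2) simp
  with AE_regular_time[OF s]
  have "AE t in lebesgue_on {s..T}. (\<exists>v\<in>F_dyn \<mu> U f t (x t). has_L2_derivative \<mu> {s..T} x v t) \<longleftrightarrow>
      (\<exists>u\<in>U t. sn.has_deriv {s..T} (\<lambda>\<tau>. rep (x \<tau>)) (dyn t (rep (x t)) u) t)"
  proof eventually_elim
    fix t assume t: "regular_time t" "t \<in> {s..T}"
    show "(\<exists>v\<in>F_dyn \<mu> U f t (x t). has_L2_derivative \<mu> {s..T} x v t) \<longleftrightarrow>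
      (\<exists>u\<in>U t. sn.has_deriv {s..T} (\<lambda>\<tau>. rep (x \<tau>)) (dyn t (rep (x t)) u) t)"
      unfolding F_dyn_eq bex_simps(7) using has_L2_derivative_iff[where x = x, OF t x] by auto
  qed
  then show ?thesis by (rule eventually_subst)
qed

lemma abs_cont_of_L2_abs_continuous:
  assumes ac: "L2_abs_continuous_on \<mu> I x" and x: "\<And>t. t \<in> I \<Longrightarrow> x t \<in> L2 \<mu>"
  shows "sn.abs_cont I (\<lambda>t. rep (x t))"
  unfolding sn.abs_cont_def
proof (intro allI impI)
  fix \<epsilon> :: real assume "\<epsilon> > 0"
  then obtain \<delta> where \<delta>: "\<delta> > 0" and ac': "\<And>(n::nat) a b.
        (\<forall>i<n. a i \<in> I \<and> b i \<in> I \<and> a i \<le> b i) \<Longrightarrow>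
        pairwise (\<lambda>i j. disjnt {a i<..<b i} {a j<..<b j}) {..<n} \<Longrightarrow>
        (\<Sum>i<n. b i - a i) < \<delta> \<Longrightarrow>
        (\<Sum>i<n. L2_dist \<mu> (x (a i)) (x (b i))) < \<epsilon>"
    using ac unfolding L2_abs_continuous_on_def by meson
  have "(\<Sum>(p, q)\<leftarrow>ps. N (rep (x q) - rep (x p))) < \<epsilon>"
    if ps: "intervals_in I ps" "(\<Sum>(p, q)\<leftarrow>ps. q - p) < \<delta>" for ps
  proof -
    define a where "a i = fst (ps ! i)" for i
    define b where "b i = snd (ps ! i)" for i
    have ab: "a i \<in> I \<and> b i \<in> I \<and> a i \<le> b i" if "i < length ps" for i
    proof -
      have "fst (ps ! i) \<le> snd (ps ! i) \<and> {fst (ps ! i)..snd (ps ! i)} \<subseteq> I"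
        using ps(1) nth_mem[OF that] unfolding intervals_in_def by blast
      then show ?thesis by (auto simp: a_def b_def)
    qed
    have ord: "b i \<le> a j" if "i < j" "j < length ps" for i j
      using ps(1) that unfolding intervals_in_def a_def b_def by (simp add: sorted_wrt_iff_nth_less)
    have dj: "pairwise (\<lambda>i j. disjnt {a i<..<b i} {a j<..<b j}) {..<length ps}"
    proof (rule pairwiseI)
      fix i j assume "i \<in> {..<length ps}" "j \<in> {..<length ps}" "i \<noteq> j"
      then have "b i \<le> a j \<or> b j \<le> a i" using ord[of i j] ord[of j i] by (cases "i < j") auto
      then show "disjnt {a i<..<b i} {a j<..<b j}" by (auto simp: disjnt_iff)
    qed
    have "(\<Sum>(p, q)\<leftarrow>ps. q - p) = (\<Sum>i<length ps. b i - a i)"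
      by (simp add: sum_list_sum_nth case_prod_unfold a_def b_def atLeast0LessThan)
    moreover have "(\<Sum>(p, q)\<leftarrow>ps. N (rep (x q) - rep (x p))) = (\<Sum>i<length ps. L2_dist \<mu> (x (a i)) (x (b i)))"
    proof -
      have "(\<Sum>(p, q)\<leftarrow>ps. N (rep (x q) - rep (x p))) = (\<Sum>i<length ps. N (rep (x (b i)) - rep (x (a i))))"
        by (simp add: sum_list_sum_nth case_prod_unfold a_def b_def atLeast0LessThan)
      also have "\<dots> = (\<Sum>i<length ps. L2_dist \<mu> (x (a i)) (x (b i)))"
        unfolding L2_dist_eq using ab x rep_in_V by (intro sum.cong refl sn.N_commute) auto
      finally show ?thesis .
    qed
    ultimately show ?thesis using ac'[of "length ps" a b] ab dj ps(2) by simp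
  qed
  then show "\<exists>\<delta>>0. \<forall>ps. intervals_in I ps \<longrightarrow> (\<Sum>(p, q)\<leftarrow>ps. q - p) < \<delta> \<longrightarrow>
      (\<Sum>(p, q)\<leftarrow>ps. N (rep (x q) - rep (x p))) < \<epsilon>"
    using \<delta> by blast
qed

lemma L2_abs_continuous_of_lip:
  assumes lip: "(\<lambda>t. rep (x t)) \<in> sn.lip s T L" and L: "0 \<le> L"
  shows "L2_abs_continuous_on \<mu> {s..T} x"
  unfolding L2_abs_continuous_on_def
proof (intro allI impI)
  fix \<epsilon> :: real assume \<epsilon>: "\<epsilon> > 0"
  have main: "(\<Sum>i<n. L2_dist \<mu> (x (a i)) (x (b i))) < \<epsilon>"
    if ab: "\<forall>i<n. a i \<in> {s..T} \<and> b i \<in> {s..T} \<and> a i \<le> b i" and len: "(\<Sum>i<n. b i - a i) < \<epsilon> / (L + 1)"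
    for n :: nat and a b
  proof -
    have "(\<Sum>i<n. L2_dist \<mu> (x (a i)) (x (b i))) \<le> (\<Sum>i<n. L * (b i - a i))"
    proof (rule sum_mono)
      fix i assume "i \<in> {..<n}"
      then have "a i \<in> {s..T}" "b i \<in> {s..T}" "a i \<le> b i" using ab by auto
      then show "L2_dist \<mu> (x (a i)) (x (b i)) \<le> L * (b i - a i)"
        using sn.lipD[OF lip, of "a i" "b i"] unfolding L2_dist_eq by simp
    qed
    also have "\<dots> = L * (\<Sum>i<n. b i - a i)" by (simp add: sum_distrib_left)
    also have "\<dots> \<le> L * (\<epsilon> / (L + 1))" using len L by (intro mult_left_mono) auto
    also have "\<dots> < \<epsilon>" using \<epsilon> L by (simp add: field_simps)
    finally show ?thesis .
  qed
  show "\<exists>\<delta>>0. \<forall>(n::nat) a b. (\<forall>i<n. a i \<in> {s..T} \<and> b i \<in> {s..T} \<and> a i \<le> b i) \<longrightarrow>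
        pairwise (\<lambda>i j. disjnt {a i<..<b i} {a j<..<b j}) {..<n} \<longrightarrow>
        (\<Sum>i<n. b i - a i) < \<delta> \<longrightarrow> (\<Sum>i<n. L2_dist \<mu> (x (a i)) (x (b i))) < \<epsilon>"
  proof (intro exI[of _ "\<epsilon> / (L + 1)"] conjI allI impI)
    show "0 < \<epsilon> / (L + 1)" using \<epsilon> L by simp
  qed (rule main)
qed

lemma C_L2_L2: "x \<in> mspace (C_L2 \<mu> s T) \<Longrightarrow> t \<in> {s..T} \<Longrightarrow> x t \<in> L2 \<mu>"
  unfolding C_L2_def mspace_cfunspace by auto

lemma trajectory_solution:
  assumes s: "0 \<le> s" and x: "x \<in> trajectories T \<mu> U f s \<phi>"
  shows "is_solution s (\<lambda>t. rep (x t))" "x s = \<phi>"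
proof -
  have xL: "x t \<in> L2 \<mu>" if "t \<in> {s..T}" for t
    using x that C_L2_L2 by (auto simp: trajectories_def)
  then show "is_solution s (\<lambda>t. rep (x t))"
    unfolding is_solution_def
    using x derivative_inclusion_iff[where x = x, OF s xL] abs_cont_of_L2_abs_continuous[of "{s..T}" x] rep_in_V
    by (auto simp: trajectories_def)
  show "x s = \<phi>" using x by (simp add: trajectories_def)
qed

lemma mcomplete_C_L2: "Metric_space.mcomplete (mspace (C_L2 \<mu> s T :: (real \<Rightarrow> ('w \<Rightarrow> real^'n) set) metric)) (mdist (C_L2 \<mu> s T))"
proof -
  interpret ms: Metric_space "L2 \<mu> :: ('w \<Rightarrow> real^'n) set set" "L2_dist \<mu>" by (rule Metric_space_L2)
  show ?thesis
    using ms.mcomplete_cfunspace[OF L2_mcomplete, of "top_of_set {s..T}"]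
    unfolding mcomplete_of_def ms.Self_def C_L2_def L2_metric_def .
qed

lemma dist_C_L2_le:
  assumes "x \<in> mspace (C_L2 \<mu> s T)" "y \<in> mspace (C_L2 \<mu> s T)" "t \<in> {s..T}"
  shows "L2_dist \<mu> (x t) (y t) \<le> mdist (C_L2 \<mu> s T) x y"
  using mdist_cfunspace_imp_mdist_le[of x "top_of_set {s..T}" "L2_metric \<mu>" y "mdist (C_L2 \<mu> s T) x y" t] assms
  by (simp add: C_L2_def)

lemma dist_C_L2_least:
  assumes "0 \<le> B" "\<And>t. t \<in> {s..T} \<Longrightarrow> L2_dist \<mu> (x t) (y t) \<le> B"
  shows "mdist (C_L2 \<mu> s T) x y \<le> B"
  unfolding C_L2_def using assms by (intro mdist_cfunspace_le) auto

text \<open>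
  For total boundedness, the position of a trajectory is recorded, up to the mesh of a net, at
  the points of a fine grid.  There are finitely many such records, and two trajectories with the same
  record are uniformly close since all are Lipschitz with the same constant.
\<close>

theorem trajectories_compact:
  assumes s: "0 \<le> s" "s < T" and \<phi>: "\<phi> \<in> L2 \<mu>"
  shows "compactin (mtopology_of (C_L2 \<mu> s T)) (trajectories T \<mu> U f s \<phi>)"
proof -
  define M where "M = (C_L2 \<mu> s T :: (real \<Rightarrow> ('w \<Rightarrow> real^'n) set) metric)"
  define S where "S = trajectories T \<mu> U f s \<phi>"
  interpret ms: Metric_space "L2 \<mu> :: ('w \<Rightarrow> real^'n) set set" "L2_dist \<mu>" by (rule Metric_space_L2)
  interpret cs: Metric_space "mspace M" "mdist M" by (rule Metric_space_mspace_mdist)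
  have SM: "S \<subseteq> mspace M" by (auto simp: S_def M_def trajectories_def)
  have M_L2: "x t \<in> L2 \<mu>" if "x \<in> mspace M" "t \<in> {s..T}" for x t using that C_L2_L2 unfolding M_def by blast
  obtain R L where R: "R > 0" and L: "L \<ge> 0"
    and RL: "\<And>X. is_solution s X \<Longrightarrow> N (X s) = N (rep \<phi>) \<Longrightarrow>
      X \<in> sn.lip s T L \<and> (\<forall>t\<in>{s..T}. N (X t) \<le> R)"
    using solutions_lipschitz[OF s, of "N (rep \<phi>)"] by blast
  have sol: "is_solution s (\<lambda>t. rep (x t))" "x s = \<phi>" if "x \<in> S" for x
    using trajectory_solution[OF s(1)] that unfolding S_def by blast+
  have lip: "(\<lambda>t. rep (x t)) \<in> sn.lip s T L" and bnd: "\<And>t. t \<in> {s..T} \<Longrightarrow> N (rep (x t)) \<le> R"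
    if "x \<in> S" for x
    using RL[OF sol(1)[OF that]] sol(2)[OF that] by auto
  have closed: "closedin cs.mtopology S"
    unfolding cs.metric_closedin_iff_sequentially_closed
  proof (intro conjI SM allI impI, elim conjE)
    fix x y assume xS: "range x \<subseteq> S" and lim: "limitin cs.mtopology x y sequentially"
    have xj: "x j \<in> S" "x j \<in> mspace M" for j using xS SM by auto
    have yM: "y \<in> mspace M" using lim cs.limitin_mspace by blast
    have yL: "y t \<in> L2 \<mu>" if "t \<in> {s..T}" for t using M_L2[OF yM that] .
    have md: "(\<lambda>j. mdist M (x j) y) \<longlonglongrightarrow> 0"
      using lim xj(2) unfolding cs.limitin_metric_dist_null by blast
    have conv: "(\<lambda>j. N (rep (x j t) - rep (y t))) \<longlonglongrightarrow> 0" if t: "t \<in> {s..T}" for t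
    proof (rule Lim_null_comparison[OF _ md], intro always_eventually allI)
      fix j
      have "L2_dist \<mu> (x j t) (y t) \<le> mdist M (x j) y"
        unfolding M_def by (rule dist_C_L2_le) (use xj yM t in \<open>auto simp: M_def\<close>)
      then show "norm (N (rep (x j t) - rep (y t))) \<le> mdist M (x j) y"
        unfolding L2_dist_eq by simp
    qed
    define Y where "Y t = rep (y t)" for t
    have YV: "Y t \<in> V" if "t \<in> {s..T}" for t unfolding Y_def by (rule rep_in_V[OF yL[OF that]])
    have Ylip: "Y \<in> sn.lip s T L"
      unfolding sn.lip_def
    proof (intro CollectI conjI ballI YV)
      fix t \<tau> assume t: "t \<in> {s..T}" "\<tau> \<in> {s..T}"
      have le: "N (Y t - Y \<tau>) \<le> N (rep (x j t) - Y t) + L * \<bar>t - \<tau>\<bar> + N (rep (x j \<tau>) - Y \<tau>)" for j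
      proof -
        have V: "rep (x j t) \<in> V" "rep (x j \<tau>) \<in> V" using M_L2[OF xj(2)] t rep_in_V by blast+
        have "N (Y t - Y \<tau>) \<le> N (Y t - rep (x j t)) + N (rep (x j t) - Y \<tau>)"
          using V YV t by (intro sn.N_tri) auto
        moreover have "N (rep (x j t) - Y \<tau>) \<le> N (rep (x j t) - rep (x j \<tau>)) + N (rep (x j \<tau>) - Y \<tau>)"
          using V YV t by (intro sn.N_tri) auto
        moreover have "N (rep (x j t) - rep (x j \<tau>)) \<le> L * \<bar>t - \<tau>\<bar>" using sn.lipD[OF lip[OF xj(1)] t] .
        moreover have "N (Y t - rep (x j t)) = N (rep (x j t) - Y t)" using V YV t by (intro sn.N_commute) auto
        ultimately show ?thesis by linarith
      qed
      have "(\<lambda>j. N (rep (x j t) - Y t) + L * \<bar>t - \<tau>\<bar> + N (rep (x j \<tau>) - Y \<tau>)) \<longlonglongrightarrow> 0 + L * \<bar>t - \<tau>\<bar> + 0"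
        unfolding Y_def using conv t by (intro tendsto_intros) auto
      then show "N (Y t - Y \<tau>) \<le> L * \<bar>t - \<tau>\<bar>"
        using le by (intro LIMSEQ_le_const[of _ "L * \<bar>t - \<tau>\<bar>"]) auto
    qed auto
    have "AE t in lebesgue_on {s..T}. \<exists>u\<in>U t. sn.has_deriv {s..T} Y (dyn t (Y t) u) t"
      by (rule limit_of_solutions_deriv[OF s sol(1)[OF xj(1)] lip[OF xj(1)] Ylip])
        (use conv in \<open>simp add: Y_def\<close>)
    then have "AE t in lebesgue_on {s..T}. \<exists>v\<in>F_dyn \<mu> U f t (y t). has_L2_derivative \<mu> {s..T} y v t"
      using derivative_inclusion_iff[where x = y, OF s(1) yL] unfolding Y_def by blast
    moreover have "L2_abs_continuous_on \<mu> {s..T} y"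
      using Ylip L unfolding Y_def by (intro L2_abs_continuous_of_lip)
    moreover have "y s = \<phi>"
    proof -
      have ss: "s \<in> {s..T}" using s by simp
      have "(\<lambda>j::nat. N (rep \<phi> - rep (y s))) \<longlonglongrightarrow> 0" using conv[OF ss] sol(2)[OF xj(1)] by simp
      then have "N (rep \<phi> - rep (y s)) = 0" using LIMSEQ_unique tendsto_const by blast
      then have "L2_dist \<mu> \<phi> (y s) = 0" by (simp add: L2_dist_eq)
      then show ?thesis using ms.zero[OF \<phi> yL[OF ss]] by simp
    qed
    ultimately show "y \<in> S" using yM by (simp add: S_def trajectories_def M_def)
  qed
  have tb: "cs.mtotally_bounded S"
    unfolding cs.mtotally_bounded_def
  proof (intro allI impI)
    fix \<epsilon> :: real assume \<epsilon>: "\<epsilon> > 0"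
    define \<X> where "\<X> = (\<lambda>x t. rep (x t)) ` S"
    have net: "sn.has_net (\<epsilon> / 8) (reached \<X> s T)"
    proof (rule reached_totally_bounded[OF s])
      show "is_solution s X" if "X \<in> \<X>" for X using that sol by (auto simp: \<X>_def)
      show "\<X> \<subseteq> sn.lip s T L" using lip by (auto simp: \<X>_def)
      show "N (X t) \<le> R" if "X \<in> \<X>" "t \<in> {s..T}" for X t using that bnd by (auto simp: \<X>_def)
      show "sn.has_net e (reached \<X> s s)" if "0 < e" for e
      proof -
        have "N (h - rep \<phi>) \<le> e" if "h \<in> reached \<X> s s" for h
        proof -
          have "h = rep \<phi>" using that sol(2) by (auto simp: reached_def \<X>_def)
          then show ?thesis using \<open>0 < e\<close> by simp
        qed
        then show ?thesis
          unfolding sn.has_net_def using rep_in_V[OF \<phi>] by (intro exI[of _ "{rep \<phi>}"]) auto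
      qed
    qed (use R L \<epsilon> in auto)
    obtain F where F: "finite F" "F \<subseteq> V" "\<And>h. h \<in> reached \<X> s T \<Longrightarrow> \<exists>p\<in>F. N (h - p) \<le> \<epsilon> / 8"
      using net unfolding sn.has_net_def by blast
    have near: "\<exists>p\<in>F. N (rep (x t) - p) \<le> \<epsilon> / 8" if "x \<in> S" "t \<in> {s..T}" for x t
    proof (rule F(3))
      have "(\<lambda>t. rep (x t)) \<in> \<X>" using that(1) by (auto simp: \<X>_def)
      from reachedI[OF this that(2)] show "rep (x t) \<in> reached \<X> s T" .
    qed
    obtain n where n: "(1 / 2 :: real) ^ n < \<epsilon> / (8 * (L * (T - s) + 1))"
      using real_arch_pow_inv[of "\<epsilon> / (8 * (L * (T - s) + 1))" "1 / 2"] \<epsilon> L s by (auto simp: add_nonneg_pos)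
    have mesh: "L * ((T - s) / 2 ^ n) \<le> \<epsilon> / 8"
    proof -
      define K where "K = L * (T - s)"
      have K: "0 \<le> K" using L s by (simp add: K_def)
      have "L * ((T - s) / 2 ^ n) = K * (1 / 2) ^ n" by (simp add: K_def power_one_over field_simps)
      also have "\<dots> \<le> K * (\<epsilon> / (8 * (K + 1)))" using n K unfolding K_def by (intro mult_left_mono) auto
      also have "\<dots> = (K / (K + 1)) * (\<epsilon> / 8)" by simp
      also have "\<dots> \<le> 1 * (\<epsilon> / 8)" using K \<epsilon> by (intro mult_right_mono) simp_all
      finally show ?thesis by simp
    qed
    define g where "g i = grid s T n i" for i
    have g: "g i \<in> {s..T}" if "i \<le> 2 ^ n" for i unfolding g_def using grid_in s that by simp
    define code where "code x = (\<lambda>i\<in>{..2 ^ n}. SOME p. p \<in> F \<and> N (rep (x (g i)) - p) \<le> \<epsilon> / 8)" for x :: "real \<Rightarrow> ('w \<Rightarrow> real^'n) set"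
    have code: "code x i \<in> F" "N (rep (x (g i)) - code x i) \<le> \<epsilon> / 8" if "x \<in> S" "i \<le> 2 ^ n" for x i
    proof -
      have "\<exists>p. p \<in> F \<and> N (rep (x (g i)) - p) \<le> \<epsilon> / 8" using near[OF that(1) g[OF that(2)]] by blast
      from someI_ex[OF this] show "code x i \<in> F" "N (rep (x (g i)) - code x i) \<le> \<epsilon> / 8"
        using that(2) by (simp_all add: code_def)
    qed
    have "code ` S \<subseteq> {..2 ^ n} \<rightarrow>\<^sub>E F"
    proof (intro image_subsetI PiE_I)
      show "code x i \<in> F" if "x \<in> S" "i \<in> {..2 ^ n}" for x i using code(1) that by simp
      show "code x i = undefined" if "i \<notin> {..2 ^ n}" for x i using that by (simp add: code_def)
    qed
    then have fin: "finite (code ` S)" by (rule finite_subset) (intro finite_PiE finite_atMost F(1))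
    define K where "K = inv_into S code ` code ` S"
    have "finite K" unfolding K_def using fin by (rule finite_imageI)
    moreover have KS: "K \<subseteq> S" unfolding K_def by (auto intro: inv_into_into)
    moreover have "S \<subseteq> (\<Union>y\<in>K. cs.mball y \<epsilon>)"
    proof
      fix x assume x: "x \<in> S"
      define y where "y = inv_into S code (code x)"
      have yK: "y \<in> K" unfolding K_def y_def using x by simp
      then have yS: "y \<in> S" using KS by blast
      have cxy: "code y = code x" unfolding y_def using x by (simp add: f_inv_into_f)
      have "mdist M y x \<le> \<epsilon> / 2"
        unfolding M_def
      proof (rule dist_C_L2_least)
        fix t assume t: "t \<in> {s..T}"
        define i where "i = grid_index s T n t"
        have i: "i \<le> 2 ^ n" "\<bar>g i - t\<bar> \<le> (T - s) / 2 ^ n"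
          unfolding g_def i_def using t by (auto intro!: grid_index[OF s(2)])
        define p where "p = code x i"
        have V: "rep (x t) \<in> V" "rep (y t) \<in> V" "rep (x (g i)) \<in> V" "rep (y (g i)) \<in> V" "p \<in> V"
          using M_L2 x yS SM t g[OF i(1)] rep_in_V code(1)[OF x i(1)] F(2) unfolding p_def by blast+
        have move: "N (rep (z t) - rep (z (g i))) \<le> \<epsilon> / 8" if "z \<in> S" for z
        proof -
          have "N (rep (z t) - rep (z (g i))) \<le> L * \<bar>t - g i\<bar>" using sn.lipD[OF lip[OF that] t g[OF i(1)]] .
          also have "\<dots> \<le> L * ((T - s) / 2 ^ n)" using i(2) L by (intro mult_left_mono) (auto simp: abs_minus_commute)
          finally show ?thesis using mesh by linarith
        qed
        have "N (rep (y t) - rep (x t)) \<le> N (rep (y t) - p) + N (p - rep (x t))" using V by (intro sn.N_tri)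
        moreover have "N (p - rep (x t)) = N (rep (x t) - p)" using V by (intro sn.N_commute)
        moreover have "N (rep (y t) - p) \<le> N (rep (y t) - rep (y (g i))) + N (rep (y (g i)) - p)" using V by (intro sn.N_tri)
        moreover have "N (rep (x t) - p) \<le> N (rep (x t) - rep (x (g i))) + N (rep (x (g i)) - p)" using V by (intro sn.N_tri)
        moreover have "N (rep (y (g i)) - p) \<le> \<epsilon> / 8" using code(2)[OF yS i(1)] unfolding p_def cxy .
        moreover have "N (rep (x (g i)) - p) \<le> \<epsilon> / 8" using code(2)[OF x i(1)] unfolding p_def .
        ultimately show "L2_dist \<mu> (y t) (x t) \<le> \<epsilon> / 2"
          unfolding L2_dist_eq using move[OF x] move[OF yS] by linarith
      qed (use \<epsilon> in simp)
      then have "x \<in> cs.mball y \<epsilon>" using x yS SM \<epsilon> by auto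
      then show "x \<in> (\<Union>y\<in>K. cs.mball y \<epsilon>)" using yK by blast
    qed
    ultimately show "\<exists>K. finite K \<and> K \<subseteq> S \<and> S \<subseteq> (\<Union>y\<in>K. cs.mball y \<epsilon>)" by blast
  qed
  have "cs.mcomplete" unfolding M_def by (rule mcomplete_C_L2)
  then have "compactin cs.mtopology (cs.mtopology closure_of S)"
    using tb cs.mtotally_bounded_eq_compact_closure_of by blast
  then have "compactin cs.mtopology S" using closure_of_closedin[OF closed] by simp
  then show ?thesis unfolding mtopology_of_def M_def S_def .
qed

end

theorem theorem3p6:
  fixes T :: real
    and \<mu> :: "'w::metric_space measure"
    and U :: "real \<Rightarrow> (real^'m) set"
    and f :: "real \<Rightarrow> real^'n \<Rightarrow> real^'m \<Rightarrow> 'w \<Rightarrow> real^'n"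
    and g :: "real^'n \<Rightarrow> 'w \<Rightarrow> real"
  assumes "0 < T"
    and "basic_hypotheses T \<mu> U f g"
    and "convexity_hypothesis T \<mu> U f"
    and "measure_modulus_hypothesis T \<mu> U f \<or> compact_range_hypothesis T \<mu> U f"
  shows "\<forall>s\<in>{0..<T}. \<forall>\<phi>\<in>L2 \<mu>.
    compactin (mtopology_of (C_L2 \<mu> s T)) (trajectories T \<mu> U f s \<phi>)"
proof -
  have basic: "compact (UNIV :: 'w set)" "finite_measure \<mu>" "sets \<mu> = sets borel"
    "\<And>t. t \<in> {0..T} \<Longrightarrow> compact (U t)"
    "\<And>x u w. (\<lambda>t. f t x u w) \<in> borel_measurable (lebesgue_on {0..T})"
    "\<And>t. t \<in> {0..T} \<Longrightarrow> continuous_on UNIV (\<lambda>(x, u, w). f t x u w)"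
    using assms(2) by (auto simp: basic_hypotheses_def radon_measure_def)
  obtain UU where UU: "compact UU" "\<And>t. t \<in> {0..T} \<Longrightarrow> U t \<subseteq> UU"
    using assms(2) by (auto simp: basic_hypotheses_def)
  obtain c k where ck: "0 < c" "0 < k" "AE t in lebesgue_on {0..T}. \<forall>x x' u w.
        norm (f t x u w) \<le> c * (1 + norm x) \<and>
        norm (f t x u w - f t x' u w) \<le> k * norm (x - x')"
    using assms(2) unfolding basic_hypotheses_def by blast
  interpret finite_measure \<mu> by (rule basic(2))
  interpret control_dynamics \<mu> T U UU f c k
    by unfold_locales (use basic UU ck assms(3) in \<open>auto simp: convexity_hypothesis_def\<close>)
  show ?thesis using trajectories_compact by simp
qed

end
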